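(* Let $m\ge1$, $d\ge2$, $k_1,\dots,k_m\geq 2$ be integers, and let $$X=\{xy_1^{k_1}\cdots y_m^{k_m}=P(y_1,\dots,y_m,z)\}\subset\mathbb{K}^{m+2},$$ $$P=z^d+s_{d-1}(y_1,\dots,y_m)z^{d-1}+\dots+s_0(y_1,\dots,y_m),$$ where $s_j\in\mathbb{K}[y_1,\dots,y_m]$ and $s_{d-1}=0$, be a Danielewski variety. Let $\mathbb{G}$ be the canonical group of $X$ and let $\mathbb{U}(\widetilde{\partial})$ be the big unipotent subgroup corresponding to the canonical locally nilpotent derivation $\widetilde{\partial}$ on $X$. Then $\mathrm{Aut}(X)$ is isomorphic to a semidirect product $\mathbb{G}\ltimes\mathbb{U}(\widetilde{\partial})$ (with $\mathbb{U}(\widetilde{\partial})$ as the normal factor).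
   Context: $\mathbb{K}$ is an algebraically closed field of characteristic zero. $\mathrm{Aut}(X)$ is the group of automorphisms of the affine variety $X$; automorphisms of $X$ and of the algebra $\mathbb{K}[X]$ are identified as usual. A derivation $\partial$ of a commutative $\mathbb{K}$-algebra $A$ is locally nilpotent (LND) if for every $a\in A$ there is $n$ with $\partial^n(a)=0$. For an LND $\partial$ the big unipotent subgroup is $\mathbb{U}(\partial)=\{\exp(f\partial)\mid f\in\mathrm{Ker}\,\partial\}$. The canonical LND $\widetilde{\partial}$ of $\mathbb{K}[X]$ is given by $\widetilde{\partial}(y_i)=0$ for all $i$, $\widetilde{\partial}(z)=y_1^{k_1}\cdots y_m^{k_m}$, $\widetilde{\partial}(x)=\frac{\partial P}{\partial z}$; its kernel is $\mathbb{K}[y_1,\dots,y_m]$. Canonical group: there is an embedding $\phi\colon\mathbb{K}[X]\hookrightarrow\mathbb{K}(y_1,\dots,y_m,z)$ with $\phi(y_i)=y_i$, $\phi(z)=z$, $\phi(x)=P/(y_1^{k_1}\cdots y_m^{k_m})$. Let $S(X)\subset\mathrm{S}_m$ be the stabilizer of the monomial $y_1^{k_1}\cdots y_m^{k_m}$ under permutations of variables. The semidirect product $G=S(X)\ltimes(\mathbb{K}^\times)^{m+1}$ acts on $\mathbb{K}(y_1,\dots,y_m,z)$ by $(\sigma,t_1,\dots,t_{m+1})\cdot(y_1,\dots,y_m,z)=(t_1y_{\sigma(1)},\dots,t_my_{\sigma(m)},t_{m+1}z)$. The canonical group $\mathbb{G}\subset G$ is the stabilizer of the subalgebra $\phi(\mathbb{K}[X])$;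 it acts on $X$. *)

theory Defs
  imports
    "HOL-Library.Poly_Mapping"
    "HOL-Computational_Algebra.Computational_Algebra"
    "HOL-Algebra.Algebra"
    "HOL-Algebra.Algebraic_Closure_Type"
begin

section \<open>Multivariate polynomials\<close>

text \<open>
  Polynomials in variables indexed by natural numbers: a finitely supported map from exponent
  vectors to coefficients.  Rings in finitely many variables are the sets \<open>mpolys S\<close>.
\<close>

type_synonym 'a mpoly = "(nat \<Rightarrow>\<^sub>0 nat) \<Rightarrow>\<^sub>0 'a"

definition Var :: "nat \<Rightarrow> 'a::comm_ring_1 mpoly" where
  "Var i = Poly_Mapping.single (Poly_Mapping.single i 1) 1"

definition Const :: "'a::comm_ring_1 \<Rightarrow> 'a mpoly" where
  "Const c = Poly_Mapping.single 0 c"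

definition mpolys :: "nat set \<Rightarrow> 'a::comm_ring_1 mpoly set" where
  "mpolys S = {p. \<forall>e \<in> Poly_Mapping.keys p. Poly_Mapping.keys e \<subseteq> S}"

text \<open>Evaluation at \<open>v\<close> in another ring, the coefficients being mapped there by \<open>c\<close>.\<close>

definition mpoly_eval :: "('a::comm_ring_1 \<Rightarrow> 'b::comm_ring_1) \<Rightarrow> (nat \<Rightarrow> 'b) \<Rightarrow> 'a mpoly \<Rightarrow> 'b" where
  "mpoly_eval c v p =
     (\<Sum>e \<in> Poly_Mapping.keys p. c (Poly_Mapping.lookup p e) *
        (\<Prod>i \<in> Poly_Mapping.keys e. v i ^ Poly_Mapping.lookup e i))"

definition mpoly_diff :: "nat \<Rightarrow> 'a::comm_ring_1 mpoly \<Rightarrow> 'a mpoly" where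
  "mpoly_diff i p =
     (\<Sum>e \<in> Poly_Mapping.keys p.
        Poly_Mapping.single (e - Poly_Mapping.single i 1)
          (of_nat (Poly_Mapping.lookup e i) * Poly_Mapping.lookup p e))"


section \<open>Rational functions\<close>

text \<open>The field of rational functions in the variables \<open>S\<close>, inside the field of all rational functions.\<close>

definition rat_funs :: "nat set \<Rightarrow> 'a::field mpoly fract set" where
  "rat_funs S = {Fract p q | p q. p \<in> mpolys S \<and> q \<in> mpolys S \<and> q \<noteq> 0}"

definition rat_const :: "'a::field \<Rightarrow> 'a mpoly fract" where
  "rat_const c = Fract (Const c) 1"

definition rat_var :: "nat \<Rightarrow> 'a::field mpoly fract" where
  "rat_var i = Fract (Var i) 1"

text \<open>
  Substitution of \<open>w\<close> in a rational function; the value does not depend on the fraction chosen,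
  as long as its denominator does not become 0.
\<close>

definition rat_subst :: "(nat \<Rightarrow> 'a mpoly fract) \<Rightarrow> 'a::field mpoly fract \<Rightarrow> 'a mpoly fract" where
  "rat_subst w r =
     (THE c. \<exists>p q. r = Fract p q \<and> mpoly_eval rat_const w q \<noteq> 0 \<and>
        c = mpoly_eval rat_const w p / mpoly_eval rat_const w q)"


section \<open>Affine varieties\<close>

text \<open>
  A point of the affine \<open>n\<close>-space is an extensional function on the index set \<open>{..<n}\<close>.
  The coordinate algebra of \<open>V\<close> is the algebra of polynomial functions on \<open>V\<close>.
\<close>

definition poly_fun :: "(nat \<Rightarrow> 'a::field) set \<Rightarrow> 'a mpoly \<Rightarrow> (nat \<Rightarrow> 'a) \<Rightarrow> 'a" where
  "poly_fun V p = (\<lambda>v \<in> V. mpoly_eval (\<lambda>c. c) v p)"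

definition coord_algebra :: "nat \<Rightarrow> (nat \<Rightarrow> 'a::field) set \<Rightarrow> ('a, (nat \<Rightarrow> 'a) \<Rightarrow> 'a) module" where
  "coord_algebra n V =
     \<lparr>carrier = poly_fun V ` mpolys {..<n},
      monoid.mult = (\<lambda>f g. \<lambda>v \<in> V. f v * g v), one = (\<lambda>v \<in> V. 1),
      ring.zero = (\<lambda>v \<in> V. 0), add = (\<lambda>f g. \<lambda>v \<in> V. f v + g v),
      module.smult = (\<lambda>c f. \<lambda>v \<in> V. c * f v)\<rparr>"

definition regular_self_map :: "nat \<Rightarrow> (nat \<Rightarrow> 'a::field) set \<Rightarrow> ((nat \<Rightarrow> 'a) \<Rightarrow> nat \<Rightarrow> 'a) \<Rightarrow> bool" where
  "regular_self_map n V a \<longleftrightarrow>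
     a \<in> V \<rightarrow>\<^sub>E V \<and> (\<forall>i<n. (\<lambda>v \<in> V. a v i) \<in> carrier (coord_algebra n V))"

definition variety_Aut :: "nat \<Rightarrow> (nat \<Rightarrow> 'a::field) set \<Rightarrow> ((nat \<Rightarrow> 'a) \<Rightarrow> nat \<Rightarrow> 'a) monoid" where
  "variety_Aut n V = (BijGroup V)
     \<lparr>carrier := {a \<in> Bij V. regular_self_map n V a \<and>
                             regular_self_map n V (\<lambda>v \<in> V. inv_into V a v)}\<rparr>"

text \<open>
  The identification of automorphisms of \<open>V\<close> with automorphisms of its coordinate algebra:
  \<open>a\<close> acts on functions by \<open>f \<mapsto> f \<circ> a\<inverse>\<close>.  The inverse makes this a homomorphism for composition
  on both sides.
\<close>

definition induced_aut :: "(nat \<Rightarrow> 'a::field) set \<Rightarrow> ((nat \<Rightarrow> 'a) \<Rightarrow> nat \<Rightarrow> 'a) \<Rightarrow>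
    ((nat \<Rightarrow> 'a) \<Rightarrow> 'a) \<Rightarrow> ((nat \<Rightarrow> 'a) \<Rightarrow> 'a)" where
  "induced_aut V a f = (\<lambda>v \<in> V. f (inv_into V a v))"


section \<open>Locally nilpotent derivations\<close>

definition derivation :: "('k::field, 'b) module \<Rightarrow> ('b \<Rightarrow> 'b) \<Rightarrow> bool" where
  "derivation A D \<longleftrightarrow> D \<in> carrier A \<rightarrow>\<^sub>E carrier A \<and>
     (\<forall>a \<in> carrier A. \<forall>b \<in> carrier A. D (a \<oplus>\<^bsub>A\<^esub> b) = D a \<oplus>\<^bsub>A\<^esub> D b) \<and>
     (\<forall>c. \<forall>a \<in> carrier A. D (c \<odot>\<^bsub>A\<^esub> a) = c \<odot>\<^bsub>A\<^esub> D a) \<and>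
     (\<forall>a \<in> carrier A. \<forall>b \<in> carrier A.
        D (a \<otimes>\<^bsub>A\<^esub> b) = (D a \<otimes>\<^bsub>A\<^esub> b) \<oplus>\<^bsub>A\<^esub> (a \<otimes>\<^bsub>A\<^esub> D b))"

definition LND :: "('k::field, 'b) module \<Rightarrow> ('b \<Rightarrow> 'b) \<Rightarrow> bool" where
  "LND A D \<longleftrightarrow> derivation A D \<and> (\<forall>a \<in> carrier A. \<exists>n. (D ^^ n) a = \<zero>\<^bsub>A\<^esub>)"

definition derivation_Ker :: "('k::field, 'b) module \<Rightarrow> ('b \<Rightarrow> 'b) \<Rightarrow> 'b set" where
  "derivation_Ker A D = {a \<in> carrier A. D a = \<zero>\<^bsub>A\<^esub>}"

text \<open>For a locally nilpotent \<open>D\<close>, the index set of this sum is finite.\<close>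

definition exp_LND :: "('k::field_char_0, 'b) module \<Rightarrow> ('b \<Rightarrow> 'b) \<Rightarrow> 'b \<Rightarrow> 'b" where
  "exp_LND A D = (\<lambda>a \<in> carrier A.
     \<Oplus>\<^bsub>A\<^esub>n \<in> {n. (D ^^ n) a \<noteq> \<zero>\<^bsub>A\<^esub>}. (1 / fact n) \<odot>\<^bsub>A\<^esub> (D ^^ n) a)"

text \<open>A group of bijections of the algebra, under composition.\<close>

definition big_unipotent :: "('k::field_char_0, 'b) module \<Rightarrow> ('b \<Rightarrow> 'b) \<Rightarrow> ('b \<Rightarrow> 'b) monoid" where
  "big_unipotent A D = (BijGroup (carrier A))
     \<lparr>carrier := {exp_LND A (\<lambda>a \<in> carrier A. f \<otimes>\<^bsub>A\<^esub> D a) | f. f \<in> derivation_Ker A D}\<rparr>"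


section \<open>Semidirect products\<close>

text \<open>
  The pair \<open>(h, n)\<close> stands for the product \<open>hn\<close>, and \<open>\<theta> h n\<close> for \<open>h n h\<inverse>\<close>;
  hence \<open>(h n)(h' n') = (h h') ((h'\<inverse> n h') n')\<close>.
\<close>

definition semidirect ::
    "('h, 'c) monoid_scheme \<Rightarrow> ('n, 'd) monoid_scheme \<Rightarrow> ('h \<Rightarrow> 'n \<Rightarrow> 'n) \<Rightarrow> ('h \<times> 'n) monoid" where
  "semidirect H N \<theta> =
     \<lparr>carrier = carrier H \<times> carrier N,
      monoid.mult = (\<lambda>(h, n) (h', n'). (h \<otimes>\<^bsub>H\<^esub> h', \<theta> (inv\<^bsub>H\<^esub> h') n \<otimes>\<^bsub>N\<^esub> n')),
      one = (\<one>\<^bsub>H\<^esub>, \<one>\<^bsub>N\<^esub>)\<rparr>"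


section \<open>Danielewski varieties\<close>

text \<open>
  The coordinates are numbered as follows: \<open>x\<close> has index 0, \<open>y\<^sub>i\<close> has index \<open>i\<close> for
  \<open>1 \<le> i \<le> m\<close>, and \<open>z\<close> has index \<open>m + 1\<close>.
\<close>

definition dan_monom :: "nat \<Rightarrow> (nat \<Rightarrow> nat) \<Rightarrow> 'a::comm_ring_1 mpoly" where
  "dan_monom m k = (\<Prod>i = 1..m. Var i ^ k i)"

definition dan_poly :: "nat \<Rightarrow> nat \<Rightarrow> (nat \<Rightarrow> 'a mpoly) \<Rightarrow> 'a::comm_ring_1 mpoly" where
  "dan_poly m d s = Var (m + 1) ^ d + (\<Sum>j<d. s j * Var (m + 1) ^ j)"

definition dan_variety :: "nat \<Rightarrow> (nat \<Rightarrow> nat) \<Rightarrow> 'a::field mpoly \<Rightarrow> (nat \<Rightarrow> 'a) set" where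
  "dan_variety m k P =
     {v \<in> {..<m + 2} \<rightarrow>\<^sub>E UNIV. v 0 * (\<Prod>i = 1..m. v i ^ k i) = mpoly_eval (\<lambda>c. c) v P}"

abbreviation dan_algebra ::
    "nat \<Rightarrow> (nat \<Rightarrow> nat) \<Rightarrow> 'a::field mpoly \<Rightarrow> ('a, (nat \<Rightarrow> 'a) \<Rightarrow> 'a) module" where
  "dan_algebra m k P \<equiv> coord_algebra (m + 2) (dan_variety m k P)"

abbreviation dan_fun ::
    "nat \<Rightarrow> (nat \<Rightarrow> nat) \<Rightarrow> 'a::field mpoly \<Rightarrow> 'a mpoly \<Rightarrow> (nat \<Rightarrow> 'a) \<Rightarrow> 'a" where
  "dan_fun m k P \<equiv> poly_fun (dan_variety m k P)"

definition canonical_LND ::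
    "nat \<Rightarrow> (nat \<Rightarrow> nat) \<Rightarrow> 'a::field_char_0 mpoly \<Rightarrow> ((nat \<Rightarrow> 'a) \<Rightarrow> 'a) \<Rightarrow> ((nat \<Rightarrow> 'a) \<Rightarrow> 'a)" where
  "canonical_LND m k P =
     (THE D. LND (dan_algebra m k P) D \<and>
       (\<forall>i \<in> {1..m}. D (dan_fun m k P (Var i)) = \<zero>\<^bsub>dan_algebra m k P\<^esub>) \<and>
       D (dan_fun m k P (Var (m + 1))) = dan_fun m k P (dan_monom m k) \<and>
       D (dan_fun m k P (Var 0)) = dan_fun m k P (mpoly_diff (m + 1) P))"

text \<open>The embedding \<open>\<phi>\<close> of the coordinate algebra into the field of rational functions in \<open>y\<^sub>1, \<dots>, y\<^sub>m, z\<close>.\<close>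

definition dan_embedding ::
    "nat \<Rightarrow> (nat \<Rightarrow> nat) \<Rightarrow> 'a::field mpoly \<Rightarrow> ((nat \<Rightarrow> 'a) \<Rightarrow> 'a) \<Rightarrow> 'a mpoly fract" where
  "dan_embedding m k P f =
     (THE r. \<exists>p \<in> mpolys {..<m + 2}. f = dan_fun m k P p \<and>
        r = mpoly_eval rat_const (rat_var(0 := Fract P (dan_monom m k))) p)"

text \<open>The type argument fixes the ground field, over which the invariance of the monomial is stated.\<close>

definition monom_stabilizer :: "'a::field itself \<Rightarrow> nat \<Rightarrow> (nat \<Rightarrow> nat) \<Rightarrow> (nat \<Rightarrow> nat) monoid" where
  "monom_stabilizer _ m k = (sym_group m)
     \<lparr>carrier := {\<sigma> \<in> carrier (sym_group m).
        (\<Prod>i = 1..m. Var (\<sigma> i) ^ k i :: 'a mpoly) = dan_monom m k}\<rparr>"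

definition torus :: "nat \<Rightarrow> (nat \<Rightarrow> 'a::field) monoid" where
  "torus n = product_group {1..n} (\<lambda>_. units_of ring_of_type_algebra)"

definition torus_perm :: "nat \<Rightarrow> (nat \<Rightarrow> nat) \<Rightarrow> (nat \<Rightarrow> 'a::field) \<Rightarrow> (nat \<Rightarrow> 'a)" where
  "torus_perm n \<sigma> = (\<lambda>t \<in> carrier (torus n). \<lambda>i \<in> {1..n}. t (inv_into UNIV \<sigma> i))"

definition monomial_group ::
    "nat \<Rightarrow> (nat \<Rightarrow> nat) \<Rightarrow> ((nat \<Rightarrow> nat) \<times> (nat \<Rightarrow> 'a::field)) monoid" where
  "monomial_group m k =
     semidirect (monom_stabilizer TYPE('a) m k) (torus (m + 1)) (torus_perm (m + 1))"

text \<open>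
  \<open>\<sigma>\<close> fixes \<open>m + 1\<close>, so that this sends \<open>y\<^sub>i\<close> to \<open>t\<^sub>i y\<^bsub>\<sigma>(i)\<^esub>\<close> and \<open>z\<close> to \<open>t\<^bsub>m+1\<^esub> z\<close>.
\<close>

definition monomial_action ::
    "nat \<Rightarrow> ((nat \<Rightarrow> nat) \<times> (nat \<Rightarrow> 'a::field)) \<Rightarrow> 'a mpoly fract \<Rightarrow> 'a mpoly fract" where
  "monomial_action m = (\<lambda>(\<sigma>, t). \<lambda>r \<in> rat_funs {1..m + 1}.
     rat_subst (\<lambda>i. rat_const (t i) * rat_var (\<sigma> i)) r)"

definition canonical_group ::
    "nat \<Rightarrow> (nat \<Rightarrow> nat) \<Rightarrow> 'a::field mpoly \<Rightarrow> ((nat \<Rightarrow> nat) \<times> (nat \<Rightarrow> 'a)) monoid" where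
  "canonical_group m k P = (monomial_group m k)
     \<lparr>carrier := {g \<in> carrier (monomial_group m k).
        monomial_action m g ` dan_embedding m k P ` carrier (dan_algebra m k P) =
        dan_embedding m k P ` carrier (dan_algebra m k P)}\<rparr>"

end

theory Submission
  imports
    Defs
    "HOL-Library.Product_Lexorder"
    "HOL-Library.Product_Plus"
begin

text \<open>
  Write \<open>M = y\<^sub>1\<^bsup>k\<^sub>1\<^esup> \<cdots> y\<^sub>m\<^bsup>k\<^sub>m\<^esup>\<close>.  Where \<open>M\<close> does not vanish, \<open>x = P/M\<close>; hence the coordinate algebra is
  the subring \<open>B\<close> of \<open>F[z]\<close> generated by the constants, the \<open>y\<^sub>i\<close>, \<open>z\<close> and \<open>P/M\<close>, where \<open>F\<close> is a field of
  rational functions.  In \<open>B\<close> the canonical derivation is \<open>M d/dz\<close>, and the exponentials of its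
  multiples are the translations \<open>z \<mapsto> z + M r\<close> with \<open>r \<in> K[y]\<close>.

  The heart of the matter is that every automorphism \<open>\<phi>\<close> of \<open>B\<close> maps \<open>K[y]\<close> onto itself.  The derivation
  that \<open>\<phi>\<close> conjugates to \<open>M d/dz\<close> is locally nilpotent, and the kernel of \<open>M d/dz\<close> is \<open>K[y]\<close>, so it is
  enough that every locally nilpotent derivation \<open>D\<close> of \<open>B\<close> kills the \<open>y\<^sub>i\<close> (\<open>LND_annihilates_y\<close>).
  Compare monomials first by their degree in \<open>z\<close> and then lexicographically in \<open>y\<close>.  As \<open>P\<close> is monic in
  \<open>z\<close>, the monomials \<open>x\<^sup>a y\<^sup>b z\<^sup>c\<close> with \<open>c < d\<close> span \<open>B\<close> and have distinct leading terms
  \<open>z\<^bsup>ad + c\<^esup> y\<^sup>b / M\<^sup>a\<close>, which tells which exponents occur as leading exponents in \<open>B\<close> (\<open>plead_B_bounds\<close>).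
  Let \<open>\<epsilon>\<close> be the largest amount by which \<open>D\<close> raises a leading exponent.  The factor by which \<open>D\<close>
  multiplies a leading coefficient when it raises the exponent by \<open>\<epsilon>\<close> is additive in the exponent.
  Since \<open>D\<close> is locally nilpotent, all these factors are natural multiples \<open>n\<close> of one
  constant (\<open>nilpotency_degree\<close>), and \<open>n\<close> is a linear form on exponents with value \<open>-1\<close> at \<open>\<epsilon>\<close>.
  If \<open>n\<close> were positive on some \<open>y\<^sub>i\<close>, it would be positive on \<open>z\<close> too, and both \<open>y\<^sub>i\<close> and \<open>z\<close> shifted by \<open>\<epsilon>\<close> would
  be leading exponents in \<open>B\<close>; as \<open>d \<ge> 2\<close> and \<open>k\<^sub>i \<ge> 2\<close>, this is arithmetically impossible
  (\<open>no_small_weights\<close>).  So \<open>n\<close> is a multiple of the degree in \<open>z\<close>, \<open>D\<close> lowers that degree, and \<open>D y\<^sub>i = 0\<close>.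

  Now \<open>\<phi>\<close> conjugates \<open>M d/dz\<close> to a multiple of \<open>d/dz\<close>, which forces \<open>\<phi> z = t z + b\<close> with \<open>t\<close> constant and
  \<open>b \<in> K[y]\<close>.  In \<open>\<phi> x \<cdot> \<phi> M = \<phi> P\<close> the leading coefficients show that \<open>\<phi> M\<close> divides \<open>M\<close>; by symmetry
  \<open>\<phi> M\<close> is a multiple of \<open>M\<close> by a constant, so that \<open>\<phi>\<close> permutes the \<open>y\<^sub>i\<close> up to scalars, preserving the
  exponents \<open>k\<^sub>i\<close>.  Because \<open>P\<close> has no term of degree \<open>d - 1\<close>, the coefficients of \<open>z\<^bsup>d - 1\<^esup>\<close> show that
  \<open>M\<close> divides \<open>b\<close> (\<open>automorphism_shape\<close>).  Thus \<open>\<phi>\<close> is a translation followed by an automorphism that permutes and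
  scales the coordinates, in exactly one way (\<open>automorphism_decomposition\<close>,
  \<open>decomposition_unique\<close>), and conjugating a translation by such an automorphism gives a translation
  (\<open>gact_shift_swap\<close>).

  What remains is translation between languages: polynomial functions correspond to \<open>B\<close> by
  normal forms and by density of the points with \<open>M \<noteq> 0\<close>; automorphisms of the algebra
  come from automorphisms of the variety (\<open>algebra_automorphism_induced\<close>); and the canonical group
  consists of the automorphisms of \<open>B\<close> that permute and scale (\<open>G_memI\<close>).
\<close>

section \<open>Polynomials and their evaluation\<close>

alias lookup = Poly_Mapping.lookup
alias keys = Poly_Mapping.keys
alias single = Poly_Mapping.single
alias degree = Polynomial.degree

definition monom_value :: "(nat \<Rightarrow> 'b::comm_ring_1) \<Rightarrow> (nat \<Rightarrow>\<^sub>0 nat) \<Rightarrow> 'b" where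
  "monom_value v e = (\<Prod>i \<in> keys e. v i ^ lookup e i)"

lemma monom_value_superset:
  assumes "finite S" "keys e \<subseteq> S"
  shows "monom_value v e = (\<Prod>i \<in> S. v i ^ lookup e i)"
  unfolding monom_value_def
  by (rule prod.mono_neutral_left) (use assms in \<open>auto simp: in_keys_iff\<close>)

lemma monom_value_zero [simp]: "monom_value v 0 = 1"
  by (simp add: monom_value_def)

lemma monom_value_add: "monom_value v (e + e') = monom_value v e * monom_value v e'"
proof -
  let ?S = "keys e \<union> keys e'"
  have "monom_value v (e + e') = (\<Prod>i \<in> ?S. v i ^ lookup (e + e') i)"
    by (rule monom_value_superset) (auto simp: keys_add)
  also have "\<dots> = (\<Prod>i \<in> ?S. v i ^ lookup e i) * (\<Prod>i \<in> ?S. v i ^ lookup e' i)"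
    by (simp add: lookup_add power_add prod.distrib)
  also have "\<dots> = monom_value v e * monom_value v e'"
    by (simp add: monom_value_superset[of ?S])
  finally show ?thesis .
qed

lemma monom_value_single [simp]: "monom_value v (single i n) = v i ^ n"
  by (cases "n = 0") (auto simp: monom_value_def)

lemma monom_value_cong:
  "(\<And>i. i \<in> keys e \<Longrightarrow> v i = w i) \<Longrightarrow> monom_value v e = monom_value w e"
  by (auto simp: monom_value_def)

lemma mpoly_eval_alt:
  "mpoly_eval c v p = (\<Sum>e \<in> keys p. c (lookup p e) * monom_value v e)"
  by (simp add: mpoly_eval_def monom_value_def)

lemma mpoly_expansion:
  "(p :: 'a::comm_ring_1 mpoly) = (\<Sum>e \<in> keys p. single e (lookup p e))"
proof (rule poly_mapping_eqI)
  fix x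
  have "lookup (\<Sum>e \<in> keys p. single e (lookup p e)) x
     = (\<Sum>e \<in> keys p. if e = x then lookup p e else 0)"
    by (auto simp: lookup_sum lookup_single when_def intro!: sum.cong)
  also have "\<dots> = lookup p x"
    by (simp add: sum.delta' in_keys_iff)
  finally show "lookup p x = lookup
    (\<Sum>e \<in> keys p. single e (lookup p e)) x" by simp
qed

text \<open>Evaluation asks for a homomorphism on the coefficients and is itself one, so a single notion
  serves for all ring homomorphisms below.\<close>

locale ring_map =
  fixes c :: "'a::comm_ring_1 \<Rightarrow> 'b::comm_ring_1"
  assumes hom_add: "c (a + b) = c a + c b"
    and hom_mult: "c (a * b) = c a * c b"
    and hom_one: "c 1 = 1"
begin

lemma hom_zero: "c 0 = 0"
  using hom_add[of 0 0] by simp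

lemma hom_uminus: "c (- a) = - c a"
  using hom_add[of a "- a"] by (simp add: eq_neg_iff_add_eq_0 add.commute hom_zero)

lemma hom_diff: "c (a - b) = c a - c b"
  using hom_add[of a "- b"] by (simp add: hom_uminus)

lemma hom_power: "c (a ^ n) = c a ^ n"
  by (induction n) (auto simp: hom_mult hom_one)

lemma hom_sum: "c (sum f A) = (\<Sum>x\<in>A. c (f x))"
  by (induction A rule: infinite_finite_induct) (auto simp: hom_add hom_zero hom_one)

lemma hom_prod: "c (prod f A) = (\<Prod>x\<in>A. c (f x))"
  by (induction A rule: infinite_finite_induct) (auto simp: hom_mult hom_one)

lemma hom_of_nat: "c (of_nat n) = of_nat n"
  by (induction n) (auto simp: hom_add hom_zero hom_one)

lemma eval_superset:
  assumes "finite S" "keys p \<subseteq> S"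
  shows "mpoly_eval c v p = (\<Sum>e \<in> S. c (lookup p e) * monom_value v e)"
  unfolding mpoly_eval_alt
  by (rule sum.mono_neutral_left) (use assms in \<open>auto simp: in_keys_iff hom_zero\<close>)

lemma eval_single [simp]: "mpoly_eval c v (single e a) = c a * monom_value v e"
  by (cases "a = 0") (auto simp: mpoly_eval_alt hom_zero)

lemma eval_add: "mpoly_eval c v (p + q) = mpoly_eval c v p + mpoly_eval c v q"
proof -
  let ?S = "keys p \<union> keys q"
  have "mpoly_eval c v (p + q) = (\<Sum>e \<in> ?S. c (lookup (p + q) e) * monom_value v e)"
    by (rule eval_superset) (auto simp: keys_add)
  also have "\<dots> = mpoly_eval c v p + mpoly_eval c v q"
    by (simp add: eval_superset[of ?S] lookup_add hom_add distrib_right sum.distrib)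
  finally show ?thesis .
qed

lemma eval_zero [simp]: "mpoly_eval c v 0 = 0"
  by (simp add: mpoly_eval_alt)

lemma eval_sum: "mpoly_eval c v (sum f A) = (\<Sum>x\<in>A. mpoly_eval c v (f x))"
  by (induction A rule: infinite_finite_induct) (auto simp: eval_add)

lemma eval_mult: "mpoly_eval c v (p * q) = mpoly_eval c v p * mpoly_eval c v q"
proof -
  have "p * q = (\<Sum>e \<in> keys p. \<Sum>e' \<in> keys q.
      single (e + e') (lookup p e * lookup q e'))"
    by (subst (1) mpoly_expansion[of p], subst (1) mpoly_expansion[of q])
       (simp only: sum_product mult_single)
  then have "mpoly_eval c v (p * q) = (\<Sum>e \<in> keys p. \<Sum>e' \<in> keys q.
      c (lookup p e) * monom_value v e * (c (lookup q e') * monom_value v e'))"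
    by (simp only: eval_sum eval_single hom_mult monom_value_add mult_ac)
  then show ?thesis
    by (simp only: mpoly_eval_alt sum_product)
qed

lemma eval_Const [simp]: "mpoly_eval c v (Const a) = c a"
  by (simp add: Const_def)

lemma eval_Var [simp]: "mpoly_eval c v (Var i) = v i"
  by (simp add: Var_def hom_one)

lemma eval_one [simp]: "mpoly_eval c v 1 = 1"
  using eval_single[of v 0 1] by (simp add: hom_one)

lemma eval_ring_map: "ring_map (mpoly_eval c v)"
  by standard (auto simp: eval_add eval_mult)

lemmas eval_uminus = ring_map.hom_uminus[OF eval_ring_map]
  and eval_diff = ring_map.hom_diff[OF eval_ring_map]
  and eval_power = ring_map.hom_power[OF eval_ring_map]
  and eval_prod = ring_map.hom_prod[OF eval_ring_map]

end

lemma mpoly_eval_cong: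
  assumes "p \<in> mpolys S" "\<And>i. i \<in> S \<Longrightarrow> v i = w i"
  shows "mpoly_eval c v p = mpoly_eval c w p"
  unfolding mpoly_eval_alt
  by (intro sum.cong refl arg_cong[where f = "\<lambda>x. _ * x"] monom_value_cong)
     (use assms in \<open>auto simp: mpolys_def\<close>)

lemma Const_hom: "ring_map (Const :: 'a::comm_ring_1 \<Rightarrow> _)"
  by standard (auto simp: Const_def single_add mult_single single_one)

lemma id_hom: "ring_map (\<lambda>c. c)"
  by standard auto

lemma rat_const_hom: "ring_map (rat_const :: 'a::field \<Rightarrow> _)"
  by standard (auto simp: rat_const_def ring_map.hom_add[OF Const_hom] ring_map.hom_mult[OF Const_hom]
      ring_map.hom_one[OF Const_hom] One_fract_def)

lemma Fract_1_hom: "ring_map (\<lambda>p. Fract p 1)"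
  by standard (auto simp: One_fract_def)

lemma Var_power: "(Var i :: 'a::comm_ring_1 mpoly) ^ n = single (single i n) 1"
  by (induction n) (auto simp: Var_def mult_single single_add[symmetric])

lemma monom_value_Var: "monom_value Var e = (single e 1 :: 'a::comm_ring_1 mpoly)"
proof -
  have *: "(\<Prod>i\<in>S. single (f i) (1::'a)) = single (sum f S) 1"
    if "finite S" for f :: "nat \<Rightarrow> nat \<Rightarrow>\<^sub>0 nat" and S
    using that by (induction S) (auto simp: mult_single)
  have "e = (\<Sum>i\<in>keys e. single i (lookup e i))"
    by (rule poly_mapping_eqI)
       (auto simp: lookup_sum lookup_single when_def in_keys_iff sum.delta' cong: if_cong)
  then show ?thesis
    by (simp add: monom_value_def Var_power *)
qed

lemma single_eq_Const_mult:
  "single e a = Const a * (monom_value Var e :: 'a::comm_ring_1 mpoly)"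
  by (simp add: monom_value_Var Const_def mult_single)

lemma Const_in_mpolys [simp]: "Const a \<in> mpolys S"
  by (auto simp: mpolys_def Const_def)

lemma zero_in_mpolys [simp]: "0 \<in> mpolys S"
  by (auto simp: mpolys_def)

lemma one_in_mpolys [simp]: "1 \<in> mpolys S"
  by (auto simp: mpolys_def)

lemma Var_in_mpolys [simp]: "(Var i :: 'a::comm_ring_1 mpoly) \<in> mpolys S \<longleftrightarrow> i \<in> S"
  by (auto simp: mpolys_def Var_def)

lemma add_in_mpolys: "p \<in> mpolys S \<Longrightarrow> q \<in> mpolys S \<Longrightarrow> p + q \<in> mpolys S"
  using keys_add[of p q] by (fastforce simp: mpolys_def)

lemma mult_in_mpolys: "p \<in> mpolys S \<Longrightarrow> q \<in> mpolys S \<Longrightarrow> p * q \<in> mpolys S"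
proof -
  assume a: "p \<in> mpolys S" "q \<in> mpolys S"
  { fix e assume "e \<in> keys (p * q)"
    then obtain e1 e2 where "e = e1 + e2" "e1 \<in> keys p" "e2 \<in> keys q"
      using keys_mult[of p q] by auto
    then have "keys e \<subseteq> S"
      using a keys_add[of e1 e2] by (fastforce simp: mpolys_def) }
  then show ?thesis by (auto simp: mpolys_def)
qed

lemma uminus_in_mpolys: "p \<in> mpolys S \<Longrightarrow> - p \<in> mpolys S"
  by (auto simp: mpolys_def in_keys_iff)

lemma diff_in_mpolys: "p \<in> mpolys S \<Longrightarrow> q \<in> mpolys S \<Longrightarrow> p - q \<in> mpolys S"
  using add_in_mpolys[of p S "- q"] uminus_in_mpolys[of q S] by simp

lemma power_in_mpolys: "p \<in> mpolys S \<Longrightarrow> p ^ n \<in> mpolys S"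
  by (induction n) (auto intro: mult_in_mpolys)

lemma sum_in_mpolys: "(\<And>x. x \<in> A \<Longrightarrow> f x \<in> mpolys S) \<Longrightarrow> sum f A \<in> mpolys S"
  by (induction A rule: infinite_finite_induct) (auto intro: add_in_mpolys)

lemma prod_in_mpolys: "(\<And>x. x \<in> A \<Longrightarrow> f x \<in> mpolys S) \<Longrightarrow> prod f A \<in> mpolys S"
  by (induction A rule: infinite_finite_induct) (auto intro: mult_in_mpolys)

lemma mpolys_mono: "S \<subseteq> T \<Longrightarrow> p \<in> mpolys S \<Longrightarrow> p \<in> mpolys T"
  by (auto simp: mpolys_def)

text \<open>The ring \<open>mpolys S\<close> is generated by the constants and the variables in \<open>S\<close>.\<close>

lemma mpolys_induct [consumes 1, case_names Const Var add mult]: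
  fixes p :: "'a::comm_ring_1 mpoly"
  assumes p: "p \<in> mpolys S"
    and C: "\<And>a. Q (Const a)" and V: "\<And>i. i \<in> S \<Longrightarrow> Q (Var i)"
    and A: "\<And>p q. p \<in> mpolys S \<Longrightarrow> q \<in> mpolys S \<Longrightarrow> Q p \<Longrightarrow> Q q \<Longrightarrow> Q (p + q)"
    and M: "\<And>p q. p \<in> mpolys S \<Longrightarrow> q \<in> mpolys S \<Longrightarrow> Q p \<Longrightarrow> Q q \<Longrightarrow> Q (p * q)"
  shows "Q p"
proof -
  let ?R = "\<lambda>p. p \<in> mpolys S \<and> Q p"
  have R1: "?R 1" using C[of 1] ring_map.hom_one[OF Const_hom] by (metis one_in_mpolys)
  have R0: "?R 0" using C[of 0] ring_map.hom_zero[OF Const_hom] by (metis zero_in_mpolys)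
  have pow: "?R p \<Longrightarrow> ?R (p ^ n)" for p n
    by (induction n) (use R1 in \<open>auto intro: mult_in_mpolys M\<close>)
  have prod: "(\<And>x. x \<in> Y \<Longrightarrow> ?R (f x)) \<Longrightarrow> ?R (prod f Y)" for Y and f :: "nat \<Rightarrow> 'a mpoly"
    by (induction Y rule: infinite_finite_induct) (use R1 in \<open>auto intro: mult_in_mpolys M\<close>)
  have sum: "(\<And>x. x \<in> Y \<Longrightarrow> ?R (f x)) \<Longrightarrow> ?R (sum f Y)" for Y and f :: "(nat \<Rightarrow>\<^sub>0 nat) \<Rightarrow> 'a mpoly"
    by (induction Y rule: infinite_finite_induct) (use R0 in \<open>auto intro: add_in_mpolys A\<close>)
  have single: "?R (single e a)" if e: "keys e \<subseteq> S" for e a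
  proof -
    have "?R (monom_value Var e)"
      unfolding monom_value_def by (rule prod, rule pow) (use e V in auto)
    then show ?thesis
      unfolding single_eq_Const_mult using C M by (auto intro: mult_in_mpolys)
  qed
  have "?R (\<Sum>e \<in> keys p. single e (lookup p e))"
    by (rule sum, rule single) (use p in \<open>auto simp: mpolys_def\<close>)
  then show ?thesis by (simp add: mpoly_expansion[symmetric])
qed

lemma mpoly_eval_hom_unique:
  assumes "ring_map h" "ring_map h'" "p \<in> mpolys S"
    "\<And>a. h (Const a) = h' (Const a)" "\<And>i. i \<in> S \<Longrightarrow> h (Var i) = h' (Var i)"
  shows "h p = h' p"
  using assms(3)
proof (induction rule: mpolys_induct)
  case (add p q)
  have "h (p + q) = h p + h q" "h' (p + q) = h' p + h' q"
    by (rule ring_map.hom_add[OF assms(1)], rule ring_map.hom_add[OF assms(2)])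
  then show ?case by (simp only: add.IH)
next
  case (mult p q)
  have "h (p * q) = h p * h q" "h' (p * q) = h' p * h' q"
    by (rule ring_map.hom_mult[OF assms(1)], rule ring_map.hom_mult[OF assms(2)])
  then show ?case by (simp only: mult.IH)
qed (rule assms(4), rule assms(5))

lemma ring_map_comp: "ring_map f \<Longrightarrow> ring_map g \<Longrightarrow> ring_map (\<lambda>x. f (g x))"
  unfolding ring_map_def by auto

lemma mpoly_eval_subst:
  assumes c: "ring_map c"
  shows "mpoly_eval c v (mpoly_eval Const q p) = mpoly_eval c (\<lambda>i. mpoly_eval c v (q i)) p"
proof (rule mpoly_eval_hom_unique[where S = UNIV])
  show "ring_map (\<lambda>x. mpoly_eval c v (mpoly_eval Const q x))"
    by (rule ring_map_comp; intro ring_map.eval_ring_map c Const_hom)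
  show "ring_map (mpoly_eval c (\<lambda>i. mpoly_eval c v (q i)))"
    by (intro ring_map.eval_ring_map c)
qed (auto simp: mpolys_def ring_map.eval_Const[OF c] ring_map.eval_Var[OF c]
       ring_map.eval_Const[OF Const_hom] ring_map.eval_Var[OF Const_hom])

lemma mpoly_eval_in_mpolys:
  assumes "p \<in> mpolys S" "\<And>i. i \<in> S \<Longrightarrow> q i \<in> mpolys T"
  shows "mpoly_eval Const q p \<in> mpolys T"
  using assms(1)
  by (induction rule: mpolys_induct)
     (use assms(2) in \<open>auto simp: ring_map.eval_add[OF Const_hom] ring_map.eval_mult[OF Const_hom]
         ring_map.eval_Const[OF Const_hom] ring_map.eval_Var[OF Const_hom] intro: add_in_mpolys mult_in_mpolys\<close>)

text \<open>If two exponents of \<open>p\<close> differ at the variable \<open>i\<close>, then doubling the value of that variable and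
  subtracting a suitable multiple of \<open>p\<close> removes one of the two terms but not the other.  So the
  number of terms can be reduced to one, and a single term does not vanish at \<open>(1, 1, \<dots>)\<close>.\<close>

lemma mpoly_nonvanishing_point:
  fixes p :: "'a::field_char_0 mpoly"
  assumes "p \<noteq> 0"
  shows "\<exists>v. mpoly_eval (\<lambda>c. c) v p \<noteq> 0"
  using assms
proof (induction "card (keys p)" arbitrary: p rule: less_induct)
  case less
  interpret ring_map "\<lambda>c::'a. c" by (rule id_hom)
  from less.prems obtain e where e: "e \<in> keys p" by (metis keys_eq_empty ex_in_conv)
  show ?case
  proof (cases "keys p = {e}")
    case True
    then have "mpoly_eval (\<lambda>c. c) (\<lambda>_. 1) p = lookup p e"
      by (simp add: mpoly_eval_alt monom_value_def)
    then show ?thesis using e by (metis in_keys_iff)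
  next
    case False
    then obtain e' where e': "e' \<in> keys p" "e' \<noteq> e" using e by auto
    then obtain i where i: "lookup e' i \<noteq> lookup e i"
      by (metis poly_mapping_eqI)
    define s :: "(nat \<Rightarrow>\<^sub>0 nat) \<Rightarrow> 'a" where
      "s a = 2 ^ lookup a i - 2 ^ lookup e i" for a
    define q where "q = (\<Sum>a \<in> keys p. single a (s a * lookup p a))"
    have lq: "lookup q a = s a * lookup p a" for a
      by (auto simp: q_def lookup_sum lookup_single when_def in_keys_iff sum.delta' cong: if_cong)
    have "(2::'a) ^ a = 2 ^ b \<longleftrightarrow> a = b" for a b :: nat
    proof -
      have "(2::'a) ^ a = of_nat (2 ^ a)" for a by simp
      then show ?thesis by (simp only: of_nat_eq_iff) simp
    qed
    then have "s e' \<noteq> 0"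
      using i by (simp add: s_def)
    then have "e' \<in> keys q" using e' by (auto simp: in_keys_iff lq)
    moreover have "keys q \<subseteq> keys p - {e}"
      by (auto simp: in_keys_iff lq s_def)
    then have "card (keys q) < card (keys p)"
      using e by (intro psubset_card_mono) auto
    ultimately obtain v where v: "mpoly_eval (\<lambda>c. c) v q \<noteq> 0"
      using less.hyps[of q] by fastforce
    have mv: "monom_value (v(i := 2 * v i)) a = 2 ^ lookup a i * monom_value v a" for a
    proof -
      have "monom_value (v(i := 2 * v i)) a =
          (\<Prod>j\<in>insert i (keys a). (v(i := 2 * v i)) j ^ lookup a j)"
        by (rule monom_value_superset) auto
      also have "\<dots> = 2 ^ lookup a i *
          (\<Prod>j\<in>insert i (keys a). v j ^ lookup a j)"
        by (subst (1 2) prod.insert_remove) (auto simp: power_mult_distrib mult_ac intro!: prod.cong)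
      also have "(\<Prod>j\<in>insert i (keys a). v j ^ lookup a j) = monom_value v a"
        by (rule monom_value_superset[symmetric]) auto
      finally show ?thesis .
    qed
    have "mpoly_eval (\<lambda>c. c) v q = mpoly_eval (\<lambda>c. c) (v(i := 2 * v i)) p
        - 2 ^ lookup e i * mpoly_eval (\<lambda>c. c) v p"
      unfolding q_def eval_sum eval_single
      unfolding mpoly_eval_alt mv s_def sum_distrib_left sum_subtractf[symmetric]
      by (intro sum.cong) (auto simp: algebra_simps)
    then show ?thesis using v by (cases "mpoly_eval (\<lambda>c. c) v p = 0") auto
  qed
qed

section \<open>Leading terms\<close>

text \<open>Exponents will be pairs, compared lexicographically.\<close>

instance prod :: (linordered_ab_group_add, linordered_ab_group_add) linordered_ab_group_add
  by standard (auto simp: less_eq_prod_def)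

instance fract :: ("{idom, ring_char_0}") field_char_0
proof
  show "inj (of_nat :: nat \<Rightarrow> 'a fract)"
    by (auto simp: inj_def of_nat_fract eq_fract)
qed

definition below :: "('r::zero \<Rightarrow> 'g::ord) \<Rightarrow> 'g \<Rightarrow> 'r \<Rightarrow> bool" where
  "below lead \<gamma> f \<longleftrightarrow> f = 0 \<or> lead f \<le> \<gamma>"

text \<open>The coefficient at \<open>\<gamma>\<close>, for \<open>f\<close> all of whose exponents are at most \<open>\<gamma>\<close>.  Unlike the leading
  coefficient, it is additive on such \<open>f\<close>.\<close>

definition coeff_at :: "('r::zero \<Rightarrow> 'g) \<Rightarrow> ('r \<Rightarrow> 'k::zero) \<Rightarrow> 'g \<Rightarrow> 'r \<Rightarrow> 'k" where
  "coeff_at lead lc \<gamma> f = (if f \<noteq> 0 \<and> lead f = \<gamma> then lc f else 0)"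

text \<open>A valuation with values in an ordered group, together with a leading coefficient that embeds each
  graded piece into a field.\<close>

locale leading_terms =
  fixes lead :: "'r::idom \<Rightarrow> 'g::linordered_ab_group_add"
    and lc :: "'r \<Rightarrow> 'k::field"
  assumes lc_eq_0_iff: "lc f = 0 \<longleftrightarrow> f = 0"
    and lead_mult: "f \<noteq> 0 \<Longrightarrow> g \<noteq> 0 \<Longrightarrow> lead (f * g) = lead f + lead g"
    and lc_mult: "lc (f * g) = lc f * lc g"
    and below_add: "below lead \<gamma> f \<Longrightarrow> below lead \<gamma> g \<Longrightarrow> below lead \<gamma> (f + g)"
    and coeff_at_add: "below lead \<gamma> f \<Longrightarrow> below lead \<gamma> g \<Longrightarrow>
      coeff_at lead lc \<gamma> (f + g) = coeff_at lead lc \<gamma> f + coeff_at lead lc \<gamma> g"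
begin

lemma below_zero [simp]: "below lead \<gamma> 0"
  by (simp add: below_def)

lemma coeff_at_zero [simp]: "coeff_at lead lc \<gamma> 0 = 0"
  by (simp add: coeff_at_def)

lemma below_lead [simp]: "below lead (lead f) f"
  by (simp add: below_def)

lemma coeff_at_lead [simp]: "coeff_at lead lc (lead f) f = lc f"
  using lc_eq_0_iff[of 0] by (simp add: coeff_at_def)

lemma coeff_at_nonzero: "coeff_at lead lc \<gamma> f \<noteq> 0 \<Longrightarrow> f \<noteq> 0 \<and> lead f = \<gamma>"
  by (auto simp: coeff_at_def split: if_splits)

lemma below_mono: "below lead \<gamma> f \<Longrightarrow> \<gamma> \<le> \<delta> \<Longrightarrow> below lead \<delta> f"
  by (auto simp: below_def)

lemma below_mult: "below lead \<gamma> f \<Longrightarrow> below lead \<delta> g \<Longrightarrow> below lead (\<gamma> + \<delta>) (f * g)"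
  by (cases "f = 0 \<or> g = 0") (auto simp: below_def lead_mult intro: add_mono)

lemma coeff_at_mult:
  assumes "below lead \<gamma> f" "below lead \<delta> g"
  shows "coeff_at lead lc (\<gamma> + \<delta>) (f * g) = coeff_at lead lc \<gamma> f * coeff_at lead lc \<delta> g"
proof (cases "f = 0 \<or> g = 0")
  case False
  then have "lead f \<le> \<gamma>" "lead g \<le> \<delta>" using assms by (auto simp: below_def)
  then have "lead f + lead g = \<gamma> + \<delta> \<longleftrightarrow> lead f = \<gamma> \<and> lead g = \<delta>"
    by (metis add_mono add_le_cancel_left add_le_cancel_right antisym)
  then show ?thesis using False by (auto simp: coeff_at_def lead_mult lc_mult)
qed auto

lemma lead_1 [simp]: "lead 1 = 0"
  using lead_mult[of 1 1] by simp

lemma below_sum: "(\<And>x. x \<in> S \<Longrightarrow> below lead \<gamma> (f x)) \<Longrightarrow> below lead \<gamma> (sum f S)"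
  by (induction S rule: infinite_finite_induct) (auto intro: below_add)

lemma coeff_at_sum:
  "(\<And>x. x \<in> S \<Longrightarrow> below lead \<gamma> (f x)) \<Longrightarrow>
    coeff_at lead lc \<gamma> (sum f S) = (\<Sum>x\<in>S. coeff_at lead lc \<gamma> (f x))"
  by (induction S rule: infinite_finite_induct) (auto simp: coeff_at_add below_sum)

text \<open>Distinct leading exponents cannot cancel.\<close>

lemma lead_sum_distinct:
  assumes "finite S" "S \<noteq> {}" "\<And>x. x \<in> S \<Longrightarrow> f x \<noteq> 0" "inj_on (\<lambda>x. lead (f x)) S"
  shows "sum f S \<noteq> 0" "\<exists>x\<in>S. lead (sum f S) = lead (f x) \<and> (\<forall>y\<in>S. lead (f y) \<le> lead (f x))"
proof -
  have "Max ((\<lambda>x. lead (f x)) ` S) \<in> (\<lambda>x. lead (f x)) ` S" using assms by (intro Max_in) auto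
  then obtain x where x: "x \<in> S" "lead (f x) = Max ((\<lambda>x. lead (f x)) ` S)" by auto
  then have le: "lead (f y) \<le> lead (f x)" if "y \<in> S" for y using assms that by simp
  have "coeff_at lead lc (lead (f x)) (sum f S) = (\<Sum>y\<in>S. coeff_at lead lc (lead (f x)) (f y))"
    by (rule coeff_at_sum) (auto simp: below_def le)
  also have "\<dots> = (\<Sum>y\<in>S. if y = x then lc (f x) else 0)"
    by (rule sum.cong) (use x assms in \<open>auto simp: coeff_at_def inj_on_def\<close>)
  also have "\<dots> = lc (f x)" using x assms by simp
  finally have "coeff_at lead lc (lead (f x)) (sum f S) \<noteq> 0"
    using assms x by (auto simp: lc_eq_0_iff)
  then have "sum f S \<noteq> 0 \<and> lead (sum f S) = lead (f x)" by (rule coeff_at_nonzero)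
  then show "sum f S \<noteq> 0"
    "\<exists>x\<in>S. lead (sum f S) = lead (f x) \<and> (\<forall>y\<in>S. lead (f y) \<le> lead (f x))"
    using x(1) le by metis+
qed

end

subsection \<open>Fractions\<close>

context leading_terms
begin

text \<open>The choice of the fraction does not matter, because \<open>lead\<close> turns products into sums.\<close>

definition fract_lead :: "'r fract \<Rightarrow> 'g" where
  "fract_lead a = (SOME \<gamma>. \<exists>p q. q \<noteq> 0 \<and> a = Fract p q \<and> \<gamma> = lead p - lead q)"

definition fract_lc :: "'r fract \<Rightarrow> 'k" where
  "fract_lc a = (SOME c. \<exists>p q. q \<noteq> 0 \<and> a = Fract p q \<and> c = lc p / lc q)"

lemma fract_lead_Fract:
  assumes "p \<noteq> 0" "q \<noteq> 0"
  shows "fract_lead (Fract p q) = lead p - lead q"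
  unfolding fract_lead_def
proof (rule some_equality)
  fix \<gamma> assume "\<exists>p' q'. q' \<noteq> 0 \<and> Fract p q = Fract p' q' \<and> \<gamma> = lead p' - lead q'"
  then obtain p' q' where *: "q' \<noteq> 0" "Fract p q = Fract p' q'" "\<gamma> = lead p' - lead q'" by auto
  then have eq: "p * q' = p' * q" using assms by (simp add: eq_fract)
  then have "p' \<noteq> 0" using assms * by auto
  then have "lead p + lead q' = lead p' + lead q"
    using assms * eq lead_mult[of p q'] lead_mult[of p' q] by simp
  then have "lead p' - lead q' = lead p - lead q"
    by (simp add: eq_diff_eq diff_add_eq diff_eq_eq)
  then show "\<gamma> = lead p - lead q" using * by simp
qed (use assms in auto)

lemma fract_lc_Fract:
  assumes "q \<noteq> 0"
  shows "fract_lc (Fract p q) = lc p / lc q"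
  unfolding fract_lc_def
proof (rule some_equality)
  fix c assume "\<exists>p' q'. q' \<noteq> 0 \<and> Fract p q = Fract p' q' \<and> c = lc p' / lc q'"
  then obtain p' q' where *: "q' \<noteq> 0" "Fract p q = Fract p' q'" "c = lc p' / lc q'" by auto
  then have "p * q' = p' * q" using assms by (simp add: eq_fract)
  then have "lc p * lc q' = lc p' * lc q" by (metis lc_mult)
  then show "c = lc p / lc q" using * assms by (simp add: frac_eq_eq lc_eq_0_iff)
qed (use assms in auto)

lemma Fract_eq_0_iff: "q \<noteq> 0 \<Longrightarrow> Fract p q = 0 \<longleftrightarrow> (p::'r) = 0"
  by (auto simp: Zero_fract_def eq_fract)

lemma below_Fract:
  "q \<noteq> 0 \<Longrightarrow> below fract_lead \<gamma> (Fract p q) \<longleftrightarrow> below lead (\<gamma> + lead q) p"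
  by (cases "p = 0") (auto simp: below_def fract_lead_Fract Fract_eq_0_iff algebra_simps)

lemma coeff_at_Fract:
  "q \<noteq> 0 \<Longrightarrow> coeff_at fract_lead fract_lc \<gamma> (Fract p q) = coeff_at lead lc (\<gamma> + lead q) p / lc q"
  by (cases "p = 0") (auto simp: coeff_at_def fract_lead_Fract fract_lc_Fract Fract_eq_0_iff algebra_simps)

lemma leading_terms_fract: "leading_terms fract_lead fract_lc"
proof
  fix f g :: "'r fract" and \<gamma>
  obtain p q where f: "f = Fract p q" "q \<noteq> 0" by (cases f)
  obtain p' q' where g: "g = Fract p' q'" "q' \<noteq> 0" by (cases g)
  show "fract_lc f = 0 \<longleftrightarrow> f = 0"
    using f by (simp add: fract_lc_Fract Fract_eq_0_iff lc_eq_0_iff)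
  show "fract_lead (f * g) = fract_lead f + fract_lead g" if "f \<noteq> 0" "g \<noteq> 0"
    using f g that by (simp add: fract_lead_Fract Fract_eq_0_iff lead_mult)
  show "fract_lc (f * g) = fract_lc f * fract_lc g"
    using f g by (simp add: fract_lc_Fract lc_mult)
  define r where "r = q * q'"
  have r: "r \<noteq> 0" using f g by (simp add: r_def)
  have f': "f = Fract (p * q') r" and g': "g = Fract (p' * q) r"
    using f g by (auto simp: r_def eq_fract)
  have fg: "f + g = Fract (p * q' + p' * q) r"
    using f g by (simp add: r_def)
  assume "below fract_lead \<gamma> f" "below fract_lead \<gamma> g"
  then have b: "below lead (\<gamma> + lead r) (p * q')" "below lead (\<gamma> + lead r) (p' * q)"
    unfolding f' g' using r by (simp_all add: below_Fract)
  show "below fract_lead \<gamma> (f + g)"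
    unfolding fg using r b by (simp add: below_Fract below_add)
  show "coeff_at fract_lead fract_lc \<gamma> (f + g) =
      coeff_at fract_lead fract_lc \<gamma> f + coeff_at fract_lead fract_lc \<gamma> g"
  proof -
    note * = coeff_at_Fract[OF r, of \<gamma>]
    have "coeff_at fract_lead fract_lc \<gamma> f = coeff_at lead lc (\<gamma> + lead r) (p * q') / lc r"
      "coeff_at fract_lead fract_lc \<gamma> g = coeff_at lead lc (\<gamma> + lead r) (p' * q) / lc r"
      by (simp_all only: * f'[THEN arg_cong] g'[THEN arg_cong])
    moreover have "coeff_at fract_lead fract_lc \<gamma> (f + g) = coeff_at lead lc (\<gamma> + lead r) (p * q' + p' * q) / lc r"
      by (simp only: fg *)
    ultimately show ?thesis by (simp only: coeff_at_add[OF b] add_divide_distrib)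
  qed
qed

end

subsection \<open>Polynomials\<close>

context leading_terms
begin

text \<open>The degree comes first, and counts most in the lexicographic order of pairs.\<close>

definition poly_lead :: "'r poly \<Rightarrow> int \<times> 'g" where
  "poly_lead f = (int (degree f), lead (lead_coeff f))"

definition poly_lc :: "'r poly \<Rightarrow> 'k" where
  "poly_lc f = lc (lead_coeff f)"

lemma below_poly:
  "below poly_lead (int n, \<gamma>) f \<longleftrightarrow> degree f \<le> n \<and> below lead \<gamma> (coeff f n)"
  by (cases "f = 0") (auto simp: below_def poly_lead_def coeff_eq_0 le_less)

lemma coeff_at_poly:
  "degree f \<le> n \<Longrightarrow>
    coeff_at poly_lead poly_lc (int n, \<gamma>) f = coeff_at lead lc \<gamma> (coeff f n)"
  by (cases "f = 0") (auto simp: coeff_at_def poly_lead_def poly_lc_def coeff_eq_0 le_less)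

lemma below_poly_neg: "m < 0 \<Longrightarrow> below poly_lead (m, \<gamma>) f \<longleftrightarrow> f = 0"
  by (auto simp: below_def poly_lead_def)

lemma leading_terms_poly: "leading_terms poly_lead poly_lc"
proof
  fix f g :: "'r poly" and \<gamma> :: "int \<times> 'g"
  show "poly_lc f = 0 \<longleftrightarrow> f = 0"
    by (simp add: poly_lc_def lc_eq_0_iff)
  show "poly_lead (f * g) = poly_lead f + poly_lead g" if "f \<noteq> 0" "g \<noteq> 0"
    using that lead_mult[of "lead_coeff f" "lead_coeff g"] lead_coeff_mult[of f g]
    by (simp add: poly_lead_def degree_mult_eq)
  show "poly_lc (f * g) = poly_lc f * poly_lc g"
    by (simp add: poly_lc_def lead_coeff_mult lc_mult)
  assume b: "below poly_lead \<gamma> f" "below poly_lead \<gamma> g"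
  obtain m \<delta> where \<gamma>: "\<gamma> = (m, \<delta>)" by (cases \<gamma>)
  have "below poly_lead \<gamma> (f + g) \<and> coeff_at poly_lead poly_lc \<gamma> (f + g) =
      coeff_at poly_lead poly_lc \<gamma> f + coeff_at poly_lead poly_lc \<gamma> g"
  proof (cases "m < 0")
    case True
    then show ?thesis using b by (simp add: \<gamma> below_poly_neg coeff_at_def)
  next
    case False
    then obtain n where "m = int n" by (metis nonneg_int_cases not_less)
    then show ?thesis using b
      by (simp add: \<gamma> below_poly coeff_at_poly degree_add_le below_add coeff_at_add)
  qed
  then show "below poly_lead \<gamma> (f + g)" "coeff_at poly_lead poly_lc \<gamma> (f + g) =
      coeff_at poly_lead poly_lc \<gamma> f + coeff_at poly_lead poly_lc \<gamma> g" by auto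
qed

end

subsection \<open>The lexicographic leading term\<close>

text \<open>Leading exponents of fractions can be negative.\<close>

definition int_exp :: "(nat \<Rightarrow>\<^sub>0 nat) \<Rightarrow> (nat \<Rightarrow>\<^sub>0 int)" where
  "int_exp = Poly_Mapping.map int"

lemma lookup_int_exp [simp]: "lookup (int_exp e) i = int (lookup e i)"
  by (simp add: int_exp_def Poly_Mapping.map.rep_eq when_def)

lemma int_exp_add: "int_exp (e + e') = int_exp e + int_exp e'"
  by (rule poly_mapping_eqI) (simp add: lookup_add)

lemma int_exp_less_iff: "int_exp e < int_exp e' \<longleftrightarrow> e < e'"
  by (simp add: less_poly_mapping.rep_eq less_fun_def)

lemma int_exp_eq_iff: "int_exp e = int_exp e' \<longleftrightarrow> e = e'"
  by (simp add: poly_mapping_eq_iff fun_eq_iff)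

lemma int_exp_le_iff: "int_exp e \<le> int_exp e' \<longleftrightarrow> e \<le> e'"
  by (metis int_exp_less_iff not_less)

definition lex_exp :: "'a::zero mpoly \<Rightarrow> (nat \<Rightarrow>\<^sub>0 nat)" where
  "lex_exp p = Max (keys p)"

definition lex_lead :: "'a::zero mpoly \<Rightarrow> (nat \<Rightarrow>\<^sub>0 int)" where
  "lex_lead p = int_exp (lex_exp p)"

definition lex_lc :: "'a::zero mpoly \<Rightarrow> 'a" where
  "lex_lc p = lookup p (lex_exp p)"

lemma lex_exp_in_keys: "p \<noteq> 0 \<Longrightarrow> lex_exp p \<in> keys (p :: 'a::field mpoly)"
  unfolding lex_exp_def by (rule Max_in) auto

lemma lex_exp_ge: "e \<in> keys p \<Longrightarrow> e \<le> lex_exp (p :: 'a::field mpoly)"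
  unfolding lex_exp_def by (rule Max_ge) auto

lemma lex_exp_eqI:
  fixes p :: "'a::field mpoly"
  shows "e \<in> keys p \<Longrightarrow> (\<And>e'. e' \<in> keys p \<Longrightarrow> e' \<le> e) \<Longrightarrow> lex_exp p = e"
  unfolding lex_exp_def by (intro Max_eqI) auto

text \<open>A term of a product that arises from only one pair of factors cannot be cancelled.\<close>

lemma lookup_mult_unique:
  fixes p q :: "'a::comm_ring_1 mpoly"
  assumes "a \<in> keys p" "b \<in> keys q"
    and unique: "\<And>a' b'. a' \<in> keys p \<Longrightarrow> b' \<in> keys q \<Longrightarrow>
      a' + b' = a + b \<Longrightarrow> a' = a \<and> b' = b"
  shows "lookup (p * q) (a + b) = lookup p a * lookup q b"
proof -
  let ?l = lookup and ?K = keys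
  have "p * q = (\<Sum>x\<in>?K p. \<Sum>y\<in>?K q. single (x + y) (?l p x * ?l q y))"
    by (subst (1) mpoly_expansion[of p], subst (1) mpoly_expansion[of q])
       (simp only: sum_product mult_single)
  then have "?l (p * q) (a + b) =
      (\<Sum>x\<in>?K p. \<Sum>y\<in>?K q. if x + y = a + b then ?l p x * ?l q y else 0)"
    by (simp add: lookup_sum lookup_single when_def)
  also have "\<dots> = (\<Sum>x\<in>?K p. if x = a then \<Sum>y\<in>?K q. if y = b then ?l p x * ?l q y else 0 else 0)"
    by (intro sum.cong refl) (auto intro!: sum.cong sum.neutral dest: unique)
  also have "\<dots> = ?l p a * ?l q b"
    using assms(1,2) by simp
  finally show ?thesis .
qed

lemma lex_mult:
  fixes p q :: "'a::field mpoly"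
  assumes "p \<noteq> 0" "q \<noteq> 0"
  shows "lex_exp (p * q) = lex_exp p + lex_exp q" "lex_lc (p * q) = lex_lc p * lex_lc q"
proof -
  let ?m = "lex_exp p" and ?n = "lex_exp q"
  have le: "e \<le> ?m + ?n" if "e \<in> keys (p * q)" for e
  proof -
    have "e \<in> {a + b |a b. a \<in> keys p \<and> b \<in> keys q}"
      using that keys_mult[of p q] by (rule rev_subsetD)
    then obtain a b where "a \<in> keys p" "b \<in> keys q" "e = a + b"
      by blast
    then show ?thesis by (simp add: lex_exp_ge add_mono)
  qed
  have lk: "lookup (p * q) (?m + ?n) = lex_lc p * lex_lc q"
    unfolding lex_lc_def
  proof (rule lookup_mult_unique)
    fix a b assume ab: "a \<in> keys p" "b \<in> keys q" "a + b = ?m + ?n"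
    then have "a \<le> ?m" "b \<le> ?n" by (auto intro: lex_exp_ge)
    then show "a = ?m \<and> b = ?n"
      using ab(3) add_less_le_mono[of a ?m b ?n] add_le_less_mono[of a ?m b ?n] by (auto simp: le_less)
  qed (use assms lex_exp_in_keys in auto)
  moreover have "lex_lc p \<noteq> 0" "lex_lc q \<noteq> 0"
    using assms by (auto simp: lex_lc_def dest!: lex_exp_in_keys)
  ultimately have "?m + ?n \<in> keys (p * q)" by (simp add: in_keys_iff)
  then show *: "lex_exp (p * q) = ?m + ?n" by (rule lex_exp_eqI) (rule le)
  show "lex_lc (p * q) = lex_lc p * lex_lc q"
    using lk unfolding lex_lc_def[of "p * q"] * .
qed

text \<open>The largest exponent of a product is the sum of the largest exponents of its factors, and
  likewise for the smallest ones.  In a monomial both coincide, hence also in its factors.\<close>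

lemma monomial_factor:
  fixes p q :: "'a::field mpoly"
  assumes pq: "p * q = single \<kappa> c" and c: "c \<noteq> 0"
  shows "\<exists>e a. a \<noteq> 0 \<and> p = single e a"
proof -
  let ?K = keys
  have nz: "p \<noteq> 0" "q \<noteq> 0" using pq c by (auto dest: arg_cong[where f = "\<lambda>x. lookup x \<kappa>"])
  have ne: "?K p \<noteq> {}" "?K q \<noteq> {}" using nz by auto
  have mp: "Min (?K p) \<in> ?K p" and mq: "Min (?K q) \<in> ?K q" using ne by (auto intro: Min_in)
  have "lookup (p * q) (Min (?K p) + Min (?K q)) =
      lookup p (Min (?K p)) * lookup q (Min (?K q))"
  proof (rule lookup_mult_unique[OF mp mq])
    fix a b assume ab: "a \<in> ?K p" "b \<in> ?K q" "a + b = Min (?K p) + Min (?K q)"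
    then have "Min (?K p) \<le> a" "Min (?K q) \<le> b" by auto
    then show "a = Min (?K p) \<and> b = Min (?K q)"
      using ab(3) add_less_le_mono[of "Min (?K p)" a "Min (?K q)" b]
        add_le_less_mono[of "Min (?K p)" a "Min (?K q)" b] by (auto simp: le_less)
  qed
  then have "lookup (p * q) (Min (?K p) + Min (?K q)) \<noteq> 0"
    using mp mq by (auto simp: in_keys_iff)
  then have min: "Min (?K p) + Min (?K q) = \<kappa>"
    unfolding pq by (simp add: lookup_single when_def split: if_splits)
  have "lex_exp (p * q) = \<kappa>" using c by (simp add: pq lex_exp_def)
  then have max: "lex_exp p + lex_exp q = \<kappa>" using lex_mult[OF nz] by simp
  have "Min (?K p) \<le> lex_exp p" "Min (?K q) \<le> lex_exp q" using mp mq by (auto intro: lex_exp_ge)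
  then have eq: "Min (?K p) = lex_exp p"
    using min max add_less_le_mono[of "Min (?K p)" "lex_exp p" "Min (?K q)" "lex_exp q"] by (auto simp: le_less)
  have "e = lex_exp p" if "e \<in> ?K p" for e
    using that eq lex_exp_ge[OF that] Min_le[OF finite_keys that] by auto
  then have "lookup p e = lookup (single (lex_exp p) (lex_lc p)) e" for e
    by (cases "e \<in> ?K p") (auto simp: lookup_single lex_lc_def when_def in_keys_iff)
  then have "p = single (lex_exp p) (lex_lc p)" by (rule poly_mapping_eqI)
  then show ?thesis using nz by (metis single_zero)
qed

lemma below_lex: "below lex_lead \<gamma> (p :: 'a::field mpoly) \<longleftrightarrow> (\<forall>e\<in>keys p. int_exp e \<le> \<gamma>)"
proof (cases "p = 0")
  case False
  have "int_exp e \<le> \<gamma>" if "e \<in> keys p" "int_exp (lex_exp p) \<le> \<gamma>" for e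
    using lex_exp_ge[OF that(1)] that(2) by (meson int_exp_le_iff order_trans)
  then show ?thesis using False lex_exp_in_keys[OF False] by (auto simp: below_def lex_lead_def)
qed (simp add: below_def)

lemma coeff_at_lex:
  assumes "below lex_lead (int_exp e) (p :: 'a::field mpoly)"
  shows "coeff_at lex_lead lex_lc (int_exp e) p = lookup p e"
proof (cases "p = 0 \<or> lex_exp p = e")
  case False
  have "e \<notin> keys p"
  proof
    assume e: "e \<in> keys p"
    have "lex_exp p \<le> e" using assms False by (auto simp: below_def lex_lead_def int_exp_le_iff)
    with lex_exp_ge[OF e] False show False by auto
  qed
  then show ?thesis using False
    by (simp add: coeff_at_def lex_lead_def int_exp_eq_iff in_keys_iff)
qed (auto simp: coeff_at_def lex_lead_def lex_lc_def)

lemma leading_terms_lex: "leading_terms (lex_lead :: 'a::field mpoly \<Rightarrow> _) lex_lc"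
proof
  fix f g :: "'a mpoly" and \<gamma> :: "nat \<Rightarrow>\<^sub>0 int"
  show z: "lex_lc f = 0 \<longleftrightarrow> f = 0" for f :: "'a mpoly"
    using lex_exp_in_keys[of f] by (auto simp: lex_lc_def in_keys_iff)
  show "lex_lead (f * g) = lex_lead f + lex_lead g" if "f \<noteq> 0" "g \<noteq> 0"
    using that by (simp add: lex_lead_def lex_mult int_exp_add)
  show "lex_lc (f * g) = lex_lc f * lex_lc g"
    using lex_mult[of f g] z by (cases "f = 0 \<or> g = 0") auto
  assume b: "below lex_lead \<gamma> f" "below lex_lead \<gamma> g"
  show b': "below lex_lead \<gamma> (f + g)"
    using b keys_add[of f g] by (force simp: below_lex)
  show "coeff_at lex_lead lex_lc \<gamma> (f + g) = coeff_at lex_lead lex_lc \<gamma> f + coeff_at lex_lead lex_lc \<gamma> g"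
  proof (cases "\<exists>e. \<gamma> = int_exp e")
    case True
    then show ?thesis using b b' by (auto simp: coeff_at_lex lookup_add)
  qed (auto simp: coeff_at_def lex_lead_def)
qed

subsection \<open>Locally nilpotent derivations\<close>

text \<open>A locally nilpotent derivation that raises leading exponents by at most \<open>e\<close>.\<close>

locale filtered_LND = leading_terms lead lc
  for lead :: "'r::idom \<Rightarrow> 'g::linordered_ab_group_add" and lc :: "'r \<Rightarrow> 'k::field_char_0" +
  fixes const :: "'k \<Rightarrow> 'r" and B :: "'r set" and D :: "'r \<Rightarrow> 'r" and e :: 'g
  assumes const_hom: "ring_map const"
    and lead_const: "c \<noteq> 0 \<Longrightarrow> lead (const c) = 0"
    and lc_const: "lc (const c) = c"
    and B_const: "const c \<in> B"
    and B_add: "f \<in> B \<Longrightarrow> g \<in> B \<Longrightarrow> f + g \<in> B"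
    and B_mult: "f \<in> B \<Longrightarrow> g \<in> B \<Longrightarrow> f * g \<in> B"
    and D_closed: "f \<in> B \<Longrightarrow> D f \<in> B"
    and D_add: "f \<in> B \<Longrightarrow> g \<in> B \<Longrightarrow> D (f + g) = D f + D g"
    and D_const_mult: "f \<in> B \<Longrightarrow> D (const c * f) = const c * D f"
    and D_mult: "f \<in> B \<Longrightarrow> g \<in> B \<Longrightarrow> D (f * g) = D f * g + f * D g"
    and D_nilpotent: "f \<in> B \<Longrightarrow> \<exists>n. (D ^^ n) f = 0"
    and D_below: "f \<in> B \<Longrightarrow> f \<noteq> 0 \<Longrightarrow> below lead (lead f + e) (D f)"
begin

text \<open>The factor by which \<open>D\<close> multiplies the leading coefficient of \<open>f\<close> while it raises the exponent by
  \<open>e\<close>; it is 0 if \<open>D\<close> raises the exponent of \<open>f\<close> by less.\<close>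

definition weight :: "'r \<Rightarrow> 'k" where
  "weight f = coeff_at lead lc (lead f + e) (D f) / lc f"

lemma weight_mult:
  assumes "f \<in> B" "g \<in> B" "f \<noteq> 0" "g \<noteq> 0"
  shows "weight (f * g) = weight f + weight g"
proof -
  let ?c = "coeff_at lead lc"
  have b: "below lead (lead f + e) (D f)" "below lead (lead g + e) (D g)"
    using assms by (auto intro: D_below)
  have "?c (lead (f * g) + e) (D (f * g)) =
      ?c ((lead f + e) + lead g) (D f * g) + ?c (lead f + (lead g + e)) (f * D g)"
    using assms b below_mult[OF b(1) below_lead[of g]] below_mult[OF below_lead[of f] b(2)]
    by (subst D_mult) (auto simp: lead_mult add_ac intro!: coeff_at_add)
  also have "\<dots> = ?c (lead f + e) (D f) * lc g + lc f * ?c (lead g + e) (D g)"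
    using b by (simp add: coeff_at_mult)
  finally show ?thesis
    using assms by (simp add: weight_def lc_mult field_simps lc_eq_0_iff)
qed

text \<open>Some combination \<open>f + c g\<close> vanishes or has a smaller leading exponent, so that \<open>D (f + c g)\<close> does not reach the
  exponent \<open>lead f + e\<close>.\<close>

lemma weight_eq_if_lead_eq:
  assumes "f \<in> B" "g \<in> B" "f \<noteq> 0" "g \<noteq> 0" "lead f = lead g"
  shows "weight f = weight g"
proof -
  let ?c = "coeff_at lead lc"
  define c where "c = - (lc f / lc g)"
  have c: "c \<noteq> 0" using assms by (simp add: c_def lc_eq_0_iff)
  then have c': "const c \<noteq> 0" using lc_eq_0_iff[of "const c"] by (auto simp: lc_const)
  have cB: "const c * g \<in> B" "const c * g \<noteq> 0" using assms B_const c' by (auto intro: B_mult)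
  have lcg: "lead (const c * g) = lead f" using assms c' lead_const[OF c] by (simp add: lead_mult)
  have "?c (lead f) (f + const c * g) = ?c (lead f) f + ?c (lead f) (const c * g)"
    by (rule coeff_at_add) (simp_all add: below_def lcg)
  also have "\<dots> = lc f + lc (const c * g)"
    by (metis coeff_at_lead lcg)
  also have "\<dots> = 0"
    using assms by (simp add: lc_mult lc_const c_def lc_eq_0_iff)
  finally have 0: "?c (lead f) (f + const c * g) = 0" .
  have bf: "below lead (lead f + e) (D f)" "below lead (lead f + e) (D (const c * g))"
    using D_below[of f] D_below[of "const c * g"] assms cB lcg by auto
  have "?c (lead f + e) (D (f + const c * g)) = 0"
  proof (cases "f + const c * g = 0")
    case True
    have "const 0 = 0" by (rule ring_map.hom_zero[OF const_hom])
    then have "D 0 = 0" using D_const_mult[of 0 0] B_const[of 0] by simp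
    then show ?thesis using True by simp
  next
    case False
    have "below lead (lead f) (f + const c * g)"
      by (rule below_add) (simp_all add: below_def lcg)
    then have "lead (f + const c * g) < lead f"
      using False 0 by (auto simp: below_def coeff_at_def le_less lc_eq_0_iff split: if_splits)
    then show ?thesis
      using D_below[of "f + const c * g"] False assms cB
      by (auto simp: below_def coeff_at_def B_add)
  qed
  then have "?c (lead f + e) (D f) + ?c (lead f + e) (D (const c * g)) = 0"
    using assms cB bf by (simp add: D_add coeff_at_add)
  moreover have "?c (lead f + e) (D (const c * g)) = c * ?c (lead f + e) (D g)"
  proof -
    have "?c (0 + (lead g + e)) (const c * D g) = ?c 0 (const c) * ?c (lead g + e) (D g)"
      using assms by (intro coeff_at_mult D_below) (auto simp: below_def lead_const c)
    moreover have "?c 0 (const c) = c"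
      using c' lead_const[OF c] by (simp add: coeff_at_def lc_const)
    ultimately show ?thesis
      using assms by (simp add: D_const_mult)
  qed
  ultimately have "?c (lead f + e) (D f) = lc f / lc g * ?c (lead g + e) (D g)"
    using assms by (simp add: c_def)
  then show ?thesis
    using assms by (simp add: weight_def field_simps lc_eq_0_iff)
qed

lemma weight_nonzero:
  assumes "f \<in> B" "weight f \<noteq> 0"
  shows "D f \<noteq> 0" "lead (D f) = lead f + e"
  using assms coeff_at_nonzero[of "lead f + e" "D f"] by (auto simp: weight_def)

text \<open>While weights are nonzero, applying \<open>D\<close> adds a constant \<open>\<epsilon>\<close> to the weight and keeps the element nonzero.
  By local nilpotency the weight of every element must therefore reach 0, so it is \<open>- n \<epsilon>\<close> for a
  natural number \<open>n\<close>.\<close>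

lemma nilpotency_degree:
  assumes f0: "f0 \<in> B" "f0 \<noteq> 0" "weight f0 \<noteq> 0"
  obtains n :: "'r \<Rightarrow> nat" where
    "\<And>f g. f \<in> B \<Longrightarrow> g \<in> B \<Longrightarrow> f \<noteq> 0 \<Longrightarrow> g \<noteq> 0 \<Longrightarrow> n (f * g) = n f + n g"
    "\<And>f g. f \<in> B \<Longrightarrow> g \<in> B \<Longrightarrow> f \<noteq> 0 \<Longrightarrow> g \<noteq> 0 \<Longrightarrow> lead f = lead g \<Longrightarrow> n f = n g"
    "\<And>f. f \<in> B \<Longrightarrow> f \<noteq> 0 \<Longrightarrow> n f > 0 \<Longrightarrow> D f \<noteq> 0 \<and> lead (D f) = lead f + e \<and> n f = Suc (n (D f))"
    "n f0 > 0"
proof -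
  define \<epsilon> where "\<epsilon> = weight (D f0) - weight f0"
  have step: "weight (D f) = weight f + \<epsilon>" if f: "f \<in> B" "f \<noteq> 0" "weight f \<noteq> 0" for f
  proof -
    note w = weight_nonzero[OF f(1,3)] weight_nonzero[OF f0(1,3)]
    have "weight (D f * f0) = weight (f * D f0)"
      by (rule weight_eq_if_lead_eq) (use f f0 w in \<open>auto simp: D_closed B_mult lead_mult algebra_simps\<close>)
    then show ?thesis using f f0 w by (simp add: weight_mult D_closed \<epsilon>_def algebra_simps)
  qed
  have iter: "(D ^^ m) f \<in> B \<and> (D ^^ m) f \<noteq> 0 \<and> weight ((D ^^ m) f) = weight f + of_nat m * \<epsilon>"
    if f: "f \<in> B" "f \<noteq> 0" and "\<forall>j<m. weight f + of_nat j * \<epsilon> \<noteq> 0" for f m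
    using that(3)
  proof (induction m)
    case (Suc m)
    then have IH: "(D ^^ m) f \<in> B" "(D ^^ m) f \<noteq> 0" "weight ((D ^^ m) f) = weight f + of_nat m * \<epsilon>"
      by auto
    have "weight ((D ^^ m) f) \<noteq> 0" using Suc.prems IH by auto
    then show ?case
      using step[OF IH(1,2)] weight_nonzero[OF IH(1)] IH by (simp add: D_closed algebra_simps)
  qed (use f in auto)
  have ex: "\<exists>j. weight f + of_nat j * \<epsilon> = 0" if f: "f \<in> B" "f \<noteq> 0" for f
    using iter[OF f] D_nilpotent[OF f(1)] by blast
  have \<epsilon>: "\<epsilon> \<noteq> 0" using ex[OF f0(1,2)] f0(3) by auto
  define n where "n f = (THE j. weight f + of_nat j * \<epsilon> = 0)" for f
  have n_eqI: "n f = j" if "weight f + of_nat j * \<epsilon> = 0" for f j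
    unfolding n_def
  proof (rule the_equality)
    fix i assume "weight f + of_nat i * \<epsilon> = 0"
    with that have "of_nat i * \<epsilon> = of_nat j * \<epsilon>" by (metis add_left_imp_eq)
    then show "i = j" using \<epsilon> by simp
  qed (rule that)
  have n: "weight f + of_nat (n f) * \<epsilon> = 0" if "f \<in> B" "f \<noteq> 0" for f
    using ex[OF that] n_eqI by metis
  show thesis
  proof (rule that[of n])
    show "n (f * g) = n f + n g" if "f \<in> B" "g \<in> B" "f \<noteq> 0" "g \<noteq> 0" for f g
      by (rule n_eqI) (use that n[of f] n[of g] in \<open>simp add: weight_mult algebra_simps add_eq_0_iff\<close>)
    show "n f = n g" if "f \<in> B" "g \<in> B" "f \<noteq> 0" "g \<noteq> 0" "lead f = lead g" for f g
      by (rule n_eqI) (use that n[of g] weight_eq_if_lead_eq[of f g] in simp)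
    show "D f \<noteq> 0 \<and> lead (D f) = lead f + e \<and> n f = Suc (n (D f))"
      if f: "f \<in> B" "f \<noteq> 0" "n f > 0" for f
    proof -
      have w: "weight f \<noteq> 0" using n[OF f(1,2)] f(3) \<epsilon> by auto
      have "n (D f) = n f - 1"
        by (rule n_eqI) (use n[OF f(1,2)] f(3) step[OF f(1,2) w] in \<open>simp add: of_nat_diff algebra_simps\<close>)
      then show ?thesis using weight_nonzero[OF f(1) w] f(3) by simp
    qed
    show "n f0 > 0" using n[OF f0(1,2)] f0(3) by (cases "n f0") auto
  qed
qed

end

section \<open>The algebra as a subring of a polynomial ring over a field\<close>

global_interpretation lex: leading_terms "lex_lead :: 'a::field mpoly \<Rightarrow> _" lex_lc
  by (rule leading_terms_lex)

global_interpretation rat: leading_terms "lex.fract_lead :: 'a::field mpoly fract \<Rightarrow> _" lex.fract_lc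
  by (rule lex.leading_terms_fract)

global_interpretation pol: leading_terms "rat.poly_lead :: 'a::field mpoly fract poly \<Rightarrow> _" rat.poly_lc
  by (rule rat.leading_terms_poly)

abbreviation plead :: "'a::field mpoly fract poly \<Rightarrow> int \<times> (nat \<Rightarrow>\<^sub>0 int)" where
  "plead \<equiv> rat.poly_lead"

context leading_terms
begin

lemma lead_prod:
  "(\<And>x. x \<in> S \<Longrightarrow> f x \<noteq> 0) \<Longrightarrow> lead (prod f S) = (\<Sum>x\<in>S. lead (f x))"
  by (induction S rule: infinite_finite_induct) (auto simp: lead_mult)

end

lemma fst_plead_power: "f \<noteq> 0 \<Longrightarrow> fst (plead (f ^ n)) = int n * fst (plead f)"
  by (induction n) (auto simp: pol.lead_mult algebra_simps)

lemma snd_plead_power: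
  "f \<noteq> 0 \<Longrightarrow> lookup (snd (plead (f ^ n))) j = int n * lookup (snd (plead f)) j"
  by (induction n) (auto simp: pol.lead_mult lookup_add algebra_simps)

lemma lex_lead_single: "c \<noteq> 0 \<Longrightarrow> lex_lead (single e (c::'a::field)) = int_exp e"
  by (simp add: lex_lead_def lex_exp_def)

lemma lex_lc_single: "lex_lc (single e (c::'a::field)) = c"
proof (cases "c = 0")
  case False
  then show ?thesis by (simp add: lex_lc_def lex_exp_def)
qed (simp add: lex_lc_def)

lemma int_exp_zero [simp]: "int_exp 0 = 0"
  by (rule poly_mapping_eqI) simp

lemma int_exp_single: "int_exp (single i n) = single i (int n)"
  by (rule poly_mapping_eqI) (simp add: lookup_single when_def)

lemma Var_nonzero: "(Var i :: 'a::comm_ring_1 mpoly) \<noteq> 0"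
  by (metis Var_def lookup_single_eq lookup_zero zero_neq_one)

lemma rat_var_nonzero: "rat_var i \<noteq> 0"
  by (simp add: rat_var_def lex.Fract_eq_0_iff Var_nonzero)

lemma single_eq_0_iff [simp]: "single e c = 0 \<longleftrightarrow> c = 0"
  by (metis lookup_single_eq lookup_zero single_zero)

lemma rat_const_eq_0_iff [simp]: "rat_const c = 0 \<longleftrightarrow> c = 0"
  by (simp add: rat_const_def lex.Fract_eq_0_iff Const_def)

definition pconst :: "'a::field \<Rightarrow> 'a mpoly fract poly" where
  "pconst c = [:rat_const c:]"

lemma pconst_hom: "ring_map pconst"
  by standard (auto simp: pconst_def ring_map.hom_add[OF rat_const_hom]
      ring_map.hom_mult[OF rat_const_hom] ring_map.hom_one[OF rat_const_hom] one_pCons)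

lemma pconst_eq_0_iff [simp]: "pconst c = 0 \<longleftrightarrow> c = 0"
  by (simp add: pconst_def)

lemma plead_pconst: "c \<noteq> 0 \<Longrightarrow> plead (pconst c) = 0"
  by (simp add: pconst_def rat.poly_lead_def rat_const_def lex.fract_lead_Fract Const_def
      lex_lead_single zero_prod_def)

lemma poly_lc_pconst: "rat.poly_lc (pconst c) = c"
  using lex_lc_single[of 0 "1 :: 'a"]
  by (simp add: pconst_def rat.poly_lc_def rat_const_def lex.fract_lc_Fract Const_def lex_lc_single)

locale danielewski =
  fixes m d :: nat and k :: "nat \<Rightarrow> nat" and s :: "nat \<Rightarrow> 'a::field_char_0 mpoly"
  assumes d2: "d \<ge> 2"
    and k2: "\<And>i. i \<in> {1..m} \<Longrightarrow> k i \<ge> 2"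
    and s_in: "\<And>j. j < d \<Longrightarrow> s j \<in> mpolys {1..m}"
    and s_top: "s (d - 1) = 0"
begin

abbreviation P :: "'a mpoly" where "P \<equiv> dan_poly m d s"
abbreviation M :: "'a mpoly" where "M \<equiv> dan_monom m k"

text \<open>The polynomial \<open>P\<close>, read as a polynomial in \<open>z\<close>.\<close>

definition PZ :: "'a mpoly fract poly" where
  "PZ = monom 1 d + (\<Sum>j<d. monom (Fract (s j) 1) j)"

text \<open>The images of the coordinates, with the same numbering: \<open>x \<mapsto> P/M\<close>, and the variable of the polynomial ring
  is \<open>z\<close>.\<close>

definition gen :: "nat \<Rightarrow> 'a mpoly fract poly" where
  "gen i = (if i = 0 then smult (Fract 1 M) PZ else if i = m + 1 then [:0, 1:] else [:rat_var i:])"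

definition iota :: "'a mpoly \<Rightarrow> 'a mpoly fract poly" where
  "iota = mpoly_eval pconst gen"

sublocale iota: ring_map iota
  unfolding iota_def by (rule ring_map.eval_ring_map[OF pconst_hom])

lemma iota_Var [simp]: "iota (Var i) = gen i"
  by (simp add: iota_def ring_map.eval_Var[OF pconst_hom])

lemma iota_Const [simp]: "iota (Const c) = pconst c"
  by (simp add: iota_def ring_map.eval_Const[OF pconst_hom])

definition B :: "'a mpoly fract poly set" where
  "B = iota ` mpolys {..<m + 2}"

lemma iota_in_B: "p \<in> mpolys {..<m + 2} \<Longrightarrow> iota p \<in> B"
  by (simp add: B_def)

lemma B_add: "f \<in> B \<Longrightarrow> g \<in> B \<Longrightarrow> f + g \<in> B"
  by (auto simp: B_def iota.hom_add[symmetric] intro!: imageI add_in_mpolys)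

lemma B_mult: "f \<in> B \<Longrightarrow> g \<in> B \<Longrightarrow> f * g \<in> B"
  by (auto simp: B_def iota.hom_mult[symmetric] intro!: imageI mult_in_mpolys)

lemma B_pconst: "pconst c \<in> B"
  using iota_in_B[of "Const c"] by simp

lemma B_one: "1 \<in> B"
  using B_pconst[of 1] unfolding ring_map.hom_one[OF pconst_hom] .

lemma B_zero: "0 \<in> B"
  using B_pconst[of 0] by (simp add: pconst_def ring_map.hom_zero[OF rat_const_hom])

lemma B_uminus: "f \<in> B \<Longrightarrow> - f \<in> B"
  by (auto simp: B_def iota.hom_uminus[symmetric] intro!: imageI uminus_in_mpolys)

lemma B_diff: "f \<in> B \<Longrightarrow> g \<in> B \<Longrightarrow> f - g \<in> B"
  using B_add[of f "- g"] B_uminus[of g] by simp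

lemma B_gen: "i < m + 2 \<Longrightarrow> gen i \<in> B"
  using iota_in_B[of "Var i"] by simp

lemma B_power: "f \<in> B \<Longrightarrow> f ^ n \<in> B"
  by (induction n) (auto intro: B_mult B_one)

lemma B_sum: "(\<And>x. x \<in> A \<Longrightarrow> f x \<in> B) \<Longrightarrow> sum f A \<in> B"
  by (induction A rule: infinite_finite_induct) (auto intro: B_add B_zero)

lemma B_prod: "(\<And>x. x \<in> A \<Longrightarrow> f x \<in> B) \<Longrightarrow> prod f A \<in> B"
  by (induction A rule: infinite_finite_induct) (auto intro: B_mult B_one)

lemma iota_y: "p \<in> mpolys {1..m} \<Longrightarrow> iota p = [:Fract p 1:]"
proof (rule mpoly_eval_hom_unique[where h = iota and h' = "\<lambda>p. [:Fract p 1:]" and S = "{1..m}"])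
  show "ring_map iota" by unfold_locales
  show "ring_map (\<lambda>p :: 'a mpoly. [:Fract p 1:])"
    by standard (auto simp: One_fract_def one_pCons mult.commute)
qed (auto simp: pconst_def rat_const_def gen_def rat_var_def)

lemma iota_y_B: "p \<in> mpolys {1..m} \<Longrightarrow> iota p \<in> B"
  by (intro iota_in_B) (auto intro: mpolys_mono[rotated])

lemma iota_yz_B: "p \<in> mpolys {1..m + 1} \<Longrightarrow> iota p \<in> B"
  by (intro iota_in_B) (auto intro: mpolys_mono[rotated])

lemma M_in: "M \<in> mpolys {1..m}"
  unfolding dan_monom_def by (intro prod_in_mpolys power_in_mpolys) auto

definition kexp :: "nat \<Rightarrow>\<^sub>0 nat" where
  "kexp = (\<Sum>i=1..m. single i (k i))"

lemma lookup_kexp: "lookup kexp i = (if i \<in> {1..m} then k i else 0)"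
  by (simp add: kexp_def lookup_sum lookup_single when_def sum.delta' cong: if_cong)

lemma M_single: "M = single kexp 1"
proof -
  have "(\<Prod>i\<in>S. Var i ^ k i) = single (\<Sum>i\<in>S. single i (k i)) (1::'a)"
    if "finite S" for S :: "nat set"
    using that by (induction S) (auto simp: Var_power mult_single)
  then show ?thesis by (simp add: dan_monom_def kexp_def)
qed

lemma M_nonzero: "M \<noteq> 0"
  by (simp add: M_single)

lemma P_in: "P \<in> mpolys {1..m + 1}"
  unfolding dan_poly_def
  by (intro add_in_mpolys power_in_mpolys sum_in_mpolys mult_in_mpolys)
     (auto intro: mpolys_mono[OF _ s_in])

lemma P_in': "P \<in> mpolys {..<m + 2}"
  by (rule mpolys_mono[OF _ P_in]) auto

lemma M_in': "M \<in> mpolys {..<m + 2}"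
  by (rule mpolys_mono[OF _ M_in]) auto

lemma gen_z: "gen (Suc m) = [:0, 1:]"
  by (simp add: gen_def)

lemma gen_y: "i \<in> {1..m} \<Longrightarrow> gen i = [:rat_var i:]"
  by (auto simp: gen_def)

lemma gen_x: "gen 0 = smult (Fract 1 M) PZ"
  by (simp add: gen_def)

lemma z_power: "[:0, 1:] ^ n = monom (1 :: 'b::comm_semiring_1) n"
  by (metis monom_altdef smult_1_left)

lemma iota_M: "iota M = [:Fract M 1:]"
  by (rule iota_y[OF M_in])

lemma iota_P: "iota P = PZ"
  by (simp add: dan_poly_def iota.hom_add iota.hom_sum iota.hom_mult iota.hom_power gen_z z_power
      PZ_def iota_y[OF s_in] smult_monom)

lemma x_times_M: "gen 0 * iota M = iota P"
proof -
  have "Fract M M = (1 :: 'a mpoly fract)" using M_nonzero by (simp add: One_fract_def eq_fract)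
  then show ?thesis by (simp add: gen_x iota_M iota_P)
qed

lemma PZ_coeff: "coeff PZ n = (if n = d then 1 else if n < d then Fract (s n) 1 else 0)"
  by (simp add: PZ_def coeff_sum sum.delta' cong: if_cong)

lemma PZ_degree: "degree PZ = d"
  by (rule antisym) (auto intro!: degree_le le_degree simp: PZ_coeff)

lemma PZ_nonzero: "PZ \<noteq> 0"
  using PZ_degree d2 by auto

lemma gen_nonzero: "gen i \<noteq> 0"
  using PZ_nonzero M_nonzero by (simp add: gen_def rat_var_nonzero lex.Fract_eq_0_iff)

lemma plead_x: "plead (gen 0) = (int d, - int_exp kexp)"
proof -
  have "Fract 1 M \<noteq> 0" using M_nonzero by (simp add: lex.Fract_eq_0_iff)
  then show ?thesis
    using M_nonzero lex.fract_lead_Fract[of 1 M]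
    by (simp add: gen_x rat.poly_lead_def PZ_degree PZ_coeff M_single lex_lead_single)
qed

lemma plead_PZ: "plead PZ = (int d, 0)"
  by (simp add: rat.poly_lead_def PZ_degree PZ_coeff)

lemma plead_y: "i \<in> {1..m} \<Longrightarrow> plead (gen i) = (0, single i 1)"
  using lex.fract_lead_Fract[of "Var i" 1] Var_nonzero
  by (simp add: gen_y rat.poly_lead_def rat_var_def Var_def lex_lead_single int_exp_single)

lemma plead_z: "plead (gen (Suc m)) = (1, 0)"
  by (simp add: gen_z rat.poly_lead_def)

text \<open>As \<open>P\<close> is monic of degree \<open>d\<close> in \<open>z\<close>, the relation \<open>x M = P\<close> eliminates \<open>z\<^sup>d\<close>.\<close>

definition red_exps :: "(nat \<Rightarrow>\<^sub>0 nat) set" where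
  "red_exps = {e. keys e \<subseteq> {..<m + 2} \<and> lookup e (m + 1) < d}"

lemma monom_value_nonzero: "monom_value gen e \<noteq> 0"
  by (simp add: monom_value_def gen_nonzero)

lemma index_split: "{..<m + 2} = insert 0 (insert (m + 1) {1..m})"
  by auto

lemma plead_monom:
  assumes "keys e \<subseteq> {..<m + 2}"
  shows "fst (plead (monom_value gen e)) =
      int d * int (lookup e 0) + int (lookup e (m + 1))"
    and "j \<in> {1..m} \<Longrightarrow> lookup (snd (plead (monom_value gen e))) j =
      int (lookup e j) - int (k j) * int (lookup e 0)"
proof -
  have l: "plead (monom_value gen e) = (\<Sum>i<m + 2. plead (gen i ^ lookup e i))"
    unfolding monom_value_superset[OF finite_lessThan assms]
    by (rule pol.lead_prod) (simp add: gen_nonzero)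
  have "fst (plead (monom_value gen e)) = (\<Sum>i<m + 2. int (lookup e i) * fst (plead (gen i)))"
    by (simp only: l fst_sum fst_plead_power[OF gen_nonzero])
  then show "fst (plead (monom_value gen e)) =
      int d * int (lookup e 0) + int (lookup e (m + 1))"
    unfolding index_split
    by (simp add: plead_x plead_y plead_z[unfolded Suc_eq_plus1] del: One_nat_def)
  assume j: "j \<in> {1..m}"
  have "lookup (snd (plead (monom_value gen e))) j =
      (\<Sum>i<m + 2. int (lookup e i) * lookup (snd (plead (gen i))) j)"
    by (simp only: l snd_sum lookup_sum snd_plead_power[OF gen_nonzero])
  also have "\<dots> = - int (lookup e 0) * int (k j) +
      (\<Sum>i\<in>{1..m}. int (lookup e i) * (if j = i then 1 else 0))"
    unfolding index_split using j
    by (simp add: plead_x plead_y plead_z[unfolded Suc_eq_plus1] lookup_single when_def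
        lookup_kexp del: One_nat_def)
  also have "\<dots> = int (lookup e j) - int (k j) * int (lookup e 0)"
    using j by (simp add: sum.delta' if_distrib cong: if_cong)
  finally show "lookup (snd (plead (monom_value gen e))) j =
      int (lookup e j) - int (k j) * int (lookup e 0)" .
qed

text \<open>The degree in \<open>z\<close> of the leading term is \<open>d e\<^sub>0 + e\<^bsub>m + 1\<^esub>\<close>; division by \<open>d\<close> with remainder recovers
  both exponents, and then the exponents of the \<open>y\<^sub>i\<close>.\<close>

lemma plead_monom_inj: "inj_on (\<lambda>e. plead (monom_value gen e)) red_exps"
proof (rule inj_onI)
  fix e e' assume e: "e \<in> red_exps" "e' \<in> red_exps"
    and eq: "plead (monom_value gen e) = plead (monom_value gen e')"
  let ?l = lookup
  have k: "keys e \<subseteq> {..<m + 2}" "keys e' \<subseteq> {..<m + 2}"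
    and r: "?l e (m + 1) < d" "?l e' (m + 1) < d"
    using e by (auto simp: red_exps_def)
  have "int d * int (?l e 0) + int (?l e (m + 1)) = int d * int (?l e' 0) + int (?l e' (m + 1))"
    using plead_monom(1)[OF k(1)] plead_monom(1)[OF k(2)] eq by simp
  then have *: "d * ?l e 0 + ?l e (m + 1) = d * ?l e' 0 + ?l e' (m + 1)"
    by (metis of_nat_add of_nat_eq_iff of_nat_mult)
  have "(d * ?l e 0 + ?l e (m + 1)) div d = ?l e 0" "(d * ?l e' 0 + ?l e' (m + 1)) div d = ?l e' 0"
    using r by auto
  with * have 0: "?l e 0 = ?l e' 0" by metis
  with * have z: "?l e (m + 1) = ?l e' (m + 1)" by simp
  have y: "?l e j = ?l e' j" if "j \<in> {1..m}" for j
    using plead_monom(2)[OF k(1) that] plead_monom(2)[OF k(2) that] eq 0 by simp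
  show "e = e'"
  proof (rule poly_mapping_eqI)
    fix j
    show "?l e j = ?l e' j"
    proof (cases "j < m + 2")
      case True
      then have "j = 0 \<or> j = m + 1 \<or> j \<in> {1..m}" by auto
      then show ?thesis using 0 z y by auto
    next
      case False
      then have "j \<notin> keys e" "j \<notin> keys e'" using k by auto
      then show ?thesis by (simp add: in_keys_iff)
    qed
  qed
qed

definition reduced :: "'a mpoly set" where
  "reduced = {p. keys p \<subseteq> red_exps}"

lemma iota_expansion:
  "iota p = (\<Sum>e\<in>keys p. pconst (lookup p e) * monom_value gen e)"
  by (simp add: iota_def mpoly_eval_alt)

text \<open>No two reduced monomials have the same leading exponent, so that there is no cancellation.\<close>

lemma plead_reduced:
  assumes "p \<in> reduced" "p \<noteq> 0"
  shows "iota p \<noteq> 0"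
    "\<exists>e\<in>keys p. plead (iota p) = plead (monom_value gen e) \<and>
      (\<forall>e'\<in>keys p. plead (monom_value gen e') \<le> plead (monom_value gen e))"
proof -
  let ?f = "\<lambda>e. pconst (lookup p e) * monom_value gen e"
  have l: "plead (?f e) = plead (monom_value gen e)" if "e \<in> keys p" for e
    using that by (simp add: pol.lead_mult monom_value_nonzero plead_pconst in_keys_iff)
  have inj: "inj_on (\<lambda>e. plead (?f e)) (keys p)"
  proof (rule inj_onI)
    fix e e' assume e: "e \<in> keys p" "e' \<in> keys p" "plead (?f e) = plead (?f e')"
    then show "e = e'"
      using inj_onD[OF plead_monom_inj, of e e'] assms(1) l[OF e(1)] l[OF e(2)] by (auto simp: reduced_def)
  qed
  have nz: "?f e \<noteq> 0" if "e \<in> keys p" for e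
    using that by (simp add: monom_value_nonzero in_keys_iff)
  have ne: "keys p \<noteq> {}" using assms by simp
  show "iota p \<noteq> 0"
    unfolding iota_expansion by (rule pol.lead_sum_distinct(1)[OF finite_keys ne nz inj])
  show "\<exists>e\<in>keys p. plead (iota p) = plead (monom_value gen e) \<and>
      (\<forall>e'\<in>keys p. plead (monom_value gen e') \<le> plead (monom_value gen e))"
  proof -
    obtain e where e: "e \<in> keys p" "plead (iota p) = plead (?f e)"
      "\<forall>y\<in>keys p. plead (?f y) \<le> plead (?f e)"
      unfolding iota_expansion using pol.lead_sum_distinct(2)[OF finite_keys ne nz inj] by blast
    then show ?thesis using l by (intro bexI[of _ e]) auto
  qed
qed

lemma iota_inj_on_reduced: "inj_on iota reduced"
proof (rule inj_onI)
  fix p q assume pq: "p \<in> reduced" "q \<in> reduced" "iota p = iota q"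
  have "p - q \<in> reduced"
    using pq keys_diff[of p q] by (auto simp: reduced_def in_keys_iff lookup_minus)
  then show "p = q"
    using plead_reduced(1)[of "p - q"] pq by (auto simp: iota.hom_diff)
qed

subsection \<open>Reduction\<close>

definition zle :: "nat \<Rightarrow> 'a mpoly set" where
  "zle n = {p \<in> mpolys {..<m + 2}. \<forall>e\<in>keys p. lookup e (m + 1) \<le> n}"

lemma reduced_zle: "reduced = zle (d - 1)"
  using d2 by (auto simp: reduced_def red_exps_def zle_def mpolys_def)

lemma zle_add: "p \<in> zle n \<Longrightarrow> q \<in> zle n \<Longrightarrow> p + q \<in> zle n"
  using keys_add[of p q] by (auto simp: zle_def add_in_mpolys)

lemma zle_uminus: "p \<in> zle n \<Longrightarrow> - p \<in> zle n"
  by (simp add: zle_def uminus_in_mpolys in_keys_iff)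

lemma zle_diff: "p \<in> zle n \<Longrightarrow> q \<in> zle n \<Longrightarrow> p - q \<in> zle n"
  using zle_add[of p n "- q"] zle_uminus[of q] by simp

lemma zle_mult: "p \<in> zle n \<Longrightarrow> q \<in> zle n' \<Longrightarrow> p * q \<in> zle (n + n')"
proof -
  assume a: "p \<in> zle n" "q \<in> zle n'"
  { fix e assume "e \<in> keys (p * q)"
    then have "e \<in> {a + b |a b. a \<in> keys p \<and> b \<in> keys q}"
      using keys_mult[of p q] by (rule rev_subsetD)
    then have "lookup e (m + 1) \<le> n + n'"
      using a by (auto simp: zle_def lookup_add intro!: add_mono) }
  then show ?thesis using a by (auto simp: zle_def mult_in_mpolys)
qed

lemma zle_zero: "0 \<in> zle n"
  by (simp add: zle_def)

lemma zle_sum: "(\<And>x. x \<in> A \<Longrightarrow> f x \<in> zle n) \<Longrightarrow> sum f A \<in> zle n"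
  by (induction A rule: infinite_finite_induct) (auto intro: zle_add zle_zero)

lemma zle_mono: "n \<le> n' \<Longrightarrow> p \<in> zle n \<Longrightarrow> p \<in> zle n'"
  by (auto simp: zle_def intro: order_trans)

lemma mpolys_y_zle: "p \<in> mpolys {1..m} \<Longrightarrow> p \<in> zle 0"
proof -
  assume p: "p \<in> mpolys {1..m}"
  have "lookup e (m + 1) = 0" if "e \<in> keys p" for e
  proof -
    have "keys e \<subseteq> {1..m}" using p that by (simp add: mpolys_def)
    then have "m + 1 \<notin> keys e" by auto
    then show ?thesis by (simp add: in_keys_iff)
  qed
  moreover have "p \<in> mpolys {..<m + 2}" by (rule mpolys_mono[OF _ p]) auto
  ultimately show ?thesis by (simp add: zle_def)
qed

lemma Var_power_zle: "i < m + 2 \<Longrightarrow> Var i ^ n \<in> zle (if i = m + 1 then n else 0)"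
  by (auto simp: zle_def Var_power mpolys_def lookup_single when_def split: if_splits)

lemma Var_x_zle: "Var 0 \<in> zle 0"
  using Var_power_zle[of 0 1] by simp

text \<open>What \<open>z\<^sup>d\<close> equals modulo the relation \<open>x M = P\<close>.\<close>

definition zd_red :: "'a mpoly" where
  "zd_red = Var 0 * M - (\<Sum>j<d. s j * Var (m + 1) ^ j)"

lemma zd_red_zle: "zd_red \<in> zle (d - 1)"
proof -
  have "Var 0 * M \<in> zle (0 + 0)" by (intro zle_mult Var_x_zle mpolys_y_zle M_in)
  then have "Var 0 * M \<in> zle (d - 1)" by (rule zle_mono[rotated]) simp
  moreover have "s j * Var (m + 1) ^ j \<in> zle (d - 1)" if "j < d" for j
    using zle_mult[OF mpolys_y_zle[OF s_in[OF that]] Var_power_zle[of "m + 1" j]] that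
    by (auto intro: zle_mono[rotated])
  ultimately show ?thesis unfolding zd_red_def by (intro zle_diff zle_sum) auto
qed

lemma zd_relation: "Var (m + 1) ^ d - zd_red = - (Var 0 * M - P)"
  by (simp add: zd_red_def dan_poly_def)

text \<open>Replacing \<open>z\<^sup>d\<close> in all terms of the highest degree in \<open>z\<close> by \<open>zd_red\<close> lowers that degree.\<close>

lemma reduce_zle:
  "p \<in> zle n \<Longrightarrow> \<exists>p'\<in>reduced. \<exists>q. p - p' = q * (Var 0 * M - P)"
proof (induction n arbitrary: p)
  case 0
  then have "p \<in> reduced" by (auto simp: reduced_zle intro: zle_mono[rotated])
  then show ?case by (metis diff_self mult_zero_left)
next
  case (Suc n)
  show ?case
  proof (cases "Suc n < d")
    case True
    then have "p \<in> reduced" using Suc.prems by (auto simp: reduced_zle intro: zle_mono[rotated])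
    then show ?thesis by (metis diff_self mult_zero_left)
  next
    case False
    define T where "T = {e \<in> keys p. lookup e (m + 1) = Suc n}"
    define low where "low e = e - single (m + 1) d" for e :: "nat \<Rightarrow>\<^sub>0 nat"
    define c where "c = (\<Sum>e\<in>T. single (low e) (lookup p e))"
    have fin: "finite T" by (simp add: T_def)
    have e_low: "e = low e + single (m + 1) d" if "e \<in> T" for e
      by (rule poly_mapping_eqI) (use that False in \<open>auto simp: low_def T_def lookup_add lookup_minus lookup_single when_def\<close>)
    have top: "c * Var (m + 1) ^ d = (\<Sum>e\<in>T. single e (lookup p e))"
      unfolding c_def Var_power sum_distrib_right mult_single
      by (rule sum.cong) (use e_low in auto)
    have c: "c \<in> zle (Suc n - d)"
      unfolding c_def
    proof (rule zle_sum)
      fix e assume e: "e \<in> T"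
      then have "keys e \<subseteq> {..<m + 2}" using Suc.prems by (auto simp: T_def zle_def mpolys_def)
      moreover have "keys (low e) \<subseteq> keys e"
        by (auto simp: low_def in_keys_iff lookup_minus)
      moreover have "lookup (low e) (m + 1) = Suc n - d"
        using e by (simp add: low_def T_def lookup_minus)
      ultimately show "single (low e) (lookup p e) \<in> zle (Suc n - d)"
        by (auto simp: zle_def mpolys_def split: if_splits)
    qed
    define p1 where "p1 = (p - c * Var (m + 1) ^ d) + c * zd_red"
    have lk: "lookup (p - c * Var (m + 1) ^ d) e = (if e \<in> T then 0 else lookup p e)" for e
      using fin unfolding top
      by (auto simp: lookup_minus lookup_sum lookup_single when_def sum.delta' cong: if_cong)
    have "p - c * Var (m + 1) ^ d \<in> zle n"
    proof -
      have "e \<in> keys p \<and> lookup e (m + 1) \<le> n"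
        if "e \<in> keys (p - c * Var (m + 1) ^ d)" for e
      proof -
        have "e \<notin> T" "e \<in> keys p" using that lk[of e] by (auto simp: in_keys_iff split: if_splits)
        moreover have "lookup e (m + 1) \<le> Suc n"
          using Suc.prems calculation(2) by (simp add: zle_def)
        ultimately show ?thesis by (auto simp: T_def)
      qed
      then show ?thesis using Suc.prems by (auto simp: zle_def mpolys_def)
    qed
    moreover have "c * zd_red \<in> zle n"
      using zle_mult[OF c zd_red_zle] by (rule zle_mono[rotated]) (use False d2 in auto)
    ultimately have "p1 \<in> zle n" unfolding p1_def by (rule zle_add)
    then obtain p' q where p': "p' \<in> reduced" "p1 - p' = q * (Var 0 * M - P)" using Suc.IH by blast
    have "p - p1 = c * (Var (m + 1) ^ d - zd_red)" by (simp add: p1_def algebra_simps)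
    also have "\<dots> = (- c) * (Var 0 * M - P)" unfolding zd_relation by (metis minus_mult_commute)
    finally have "p - p1 + (p1 - p') = (- c + q) * (Var 0 * M - P)"
      using p'(2) by (simp only: distrib_right)
    then have "p - p' = (- c + q) * (Var 0 * M - P)" by simp
    then show ?thesis using p'(1) by blast
  qed
qed

lemma reduce_ex:
  assumes "p \<in> mpolys {..<m + 2}"
  shows "\<exists>p'\<in>reduced. \<exists>q. p - p' = q * (Var 0 * M - P)"
proof -
  have "p \<in> zle (Max (insert 0 ((\<lambda>e. lookup e (m + 1)) ` keys p)))"
    using assms by (auto simp: zle_def intro!: Max_ge)
  then show ?thesis by (rule reduce_zle)
qed

lemma iota_relation: "iota (Var 0 * M - P) = 0"
  by (simp add: iota.hom_diff iota.hom_mult x_times_M)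

lemma B_reduced: "f \<in> B \<Longrightarrow> \<exists>p\<in>reduced. f = iota p"
proof -
  assume "f \<in> B"
  then obtain p where p: "p \<in> mpolys {..<m + 2}" "f = iota p" by (auto simp: B_def)
  obtain p' q where "p' \<in> reduced" "p - p' = q * (Var 0 * M - P)" using reduce_ex[OF p(1)] by blast
  moreover have "iota (p - p') = 0" using calculation(2) by (simp only: iota.hom_mult iota_relation) simp
  then have "iota p = iota p'" by (simp add: iota.hom_diff)
  ultimately show ?thesis using p(2) by auto
qed

lemma plead_B:
  assumes "f \<in> B" "f \<noteq> 0"
  shows "\<exists>e\<in>red_exps. plead f = plead (monom_value gen e)"
proof -
  obtain p where p: "p \<in> reduced" "f = iota p" using B_reduced[OF assms(1)] by blast
  then have "p \<noteq> 0" using assms(2) by (auto simp: iota.hom_zero)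
  then show ?thesis using plead_reduced(2)[OF p(1)] p by (auto simp: reduced_def)
qed

text \<open>Negative exponents come from powers of \<open>x\<close> only, and the leading term of an element of degree \<open>c\<close> in \<open>z\<close>
  involves \<open>x\<close> to the power \<open>c div d\<close>.\<close>

lemma plead_B_bounds:
  assumes "f \<in> B" "f \<noteq> 0"
  shows "fst (plead f) \<ge> 0"
    "j \<in> {1..m} \<Longrightarrow> lookup (snd (plead f)) j + fst (plead f) div int d * int (k j) \<ge> 0"
proof -
  obtain e where e: "e \<in> red_exps" "plead f = plead (monom_value gen e)" using plead_B[OF assms] by blast
  then have ke: "keys e \<subseteq> {..<m + 2}" and z: "lookup e (m + 1) < d"
    by (auto simp: red_exps_def)
  show "fst (plead f) \<ge> 0" using e plead_monom(1)[OF ke] by simp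
  assume j: "j \<in> {1..m}"
  have "fst (plead f) div int d = int (lookup e 0)"
    using e plead_monom(1)[OF ke] z by simp
  then show "lookup (snd (plead f)) j + fst (plead f) div int d * int (k j) \<ge> 0"
    using e plead_monom(2)[OF ke j] by (simp add: algebra_simps)
qed

end

section \<open>Locally nilpotent derivations annihilate the parameters\<close>

text \<open>Here \<open>p\<close>, \<open>q\<close>, \<open>r\<close> are the values of a linear form at \<open>y\<close>, \<open>z\<close>, \<open>x\<close>, and \<open>(ez, \<epsilon>)\<close> is an exponent at which
  it takes the value \<open>-1\<close> and by which both \<open>y\<^sub>i\<close> and \<open>z\<close> can be shifted within the leading exponents.
  Let \<open>ez = a d + \<rho>\<close>.  If \<open>\<rho> + 1 < d\<close>, then \<open>(1 + ez) div d = a\<close>, and the bounds for \<open>z\<close> make the value of the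
  form at \<open>(ez, \<epsilon>)\<close> at least \<open>q \<rho> + a r \<ge> 0\<close>.  If \<open>\<rho> = d - 1\<close>, the bounds for \<open>y\<^sub>i\<close> give \<open>q (d - 1) < p\<^sub>i\<close>, whereas
  \<open>2 p\<^sub>i \<le> k\<^sub>i p\<^sub>i \<le> d q \<le> 2 q (d - 1)\<close>.\<close>

lemma no_small_weights:
  fixes d q r ez :: int and p k \<epsilon> :: "nat \<Rightarrow> int"
  assumes d: "d \<ge> 2" and i: "i \<in> {1..m}" and k: "k i \<ge> 2"
    and p: "\<And>j. p j \<ge> 0" "p i > 0" and q: "q \<ge> 0" and r: "r \<ge> 0"
    and rel: "r + (\<Sum>j=1..m. k j * p j) = d * q"
    and k0: "\<And>j. j \<in> {1..m} \<Longrightarrow> k j \<ge> 0"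
    and W: "q * ez + (\<Sum>j=1..m. p j * \<epsilon> j) = - 1"
    and ez: "ez \<ge> 0"
    and y: "\<And>j. j \<in> {1..m} \<Longrightarrow> (if j = i then 1 else 0) + \<epsilon> j + ez div d * k j \<ge> 0"
    and z: "\<And>j. j \<in> {1..m} \<Longrightarrow> \<epsilon> j + (1 + ez) div d * k j \<ge> 0"
  shows False
proof -
  define a where "a = ez div d"
  define \<rho> where "\<rho> = ez mod d"
  have ez_eq: "ez = a * d + \<rho>" by (simp add: a_def \<rho>_def)
  have \<rho>: "0 \<le> \<rho>" "\<rho> < d" using d by (auto simp: \<rho>_def)
  have a: "a \<ge> 0" using ez d by (simp add: a_def pos_imp_zdiv_nonneg_iff)
  have sum_kp: "(\<Sum>j=1..m. p j * (a * k j)) = a * (d * q - r)"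
  proof -
    have "(\<Sum>j=1..m. p j * (a * k j)) = a * (\<Sum>j=1..m. k j * p j)"
      by (simp add: sum_distrib_left mult_ac)
    moreover have "(\<Sum>j=1..m. k j * p j) = d * q - r" using rel by simp
    ultimately show ?thesis by (simp only:)
  qed
  show False
  proof (cases "\<rho> + 1 < d")
    case True
    have "(\<rho> + 1) div d = 0" using True \<rho> by (intro div_pos_pos_trivial) auto
    moreover have "1 + ez = (\<rho> + 1) + a * d" by (simp add: ez_eq)
    moreover have "((\<rho> + 1) + a * d) div d = a + (\<rho> + 1) div d" using d by (intro div_mult_self1) auto
    ultimately have "(1 + ez) div d = a" by (metis add.right_neutral)
    then have "p j * \<epsilon> j \<ge> - (p j * (a * k j))" if "j \<in> {1..m}" for j
      using z[OF that] p(1)[of j] mult_left_mono[of "- (a * k j)" "\<epsilon> j" "p j"] by auto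
    then have "(\<Sum>j=1..m. - (p j * (a * k j))) \<le> (\<Sum>j=1..m. p j * \<epsilon> j)"
      by (intro sum_mono) auto
    then have "- 1 \<ge> q * ez - a * (d * q - r)" using W sum_kp by (simp add: sum_negf)
    moreover have "q * ez - a * (d * q - r) = q * \<rho> + a * r" by (simp add: ez_eq algebra_simps)
    ultimately show False using q \<rho> a r by (smt (verit) mult_nonneg_nonneg)
  next
    case False
    then have \<rho>d: "\<rho> = d - 1" using \<rho> by simp
    have "p j * \<epsilon> j \<ge> - (p j * (a * k j)) - (if j = i then p i else 0)" if "j \<in> {1..m}" for j
      using y[OF that, folded a_def] p(1)[of j]
        mult_left_mono[of "- (a * k j) - (if j = i then 1 else 0)" "\<epsilon> j" "p j"]
      by (auto simp: algebra_simps)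
    then have "(\<Sum>j=1..m. - (p j * (a * k j)) - (if j = i then p i else 0)) \<le> (\<Sum>j=1..m. p j * \<epsilon> j)"
      by (intro sum_mono) auto
    moreover have "(\<Sum>j=1..m. if j = i then p i else 0) = p i" using i by simp
    ultimately have "- 1 \<ge> q * ez - a * (d * q - r) - p i"
      using W sum_kp by (simp add: sum_negf sum_subtractf)
    moreover have "q * ez - a * (d * q - r) = q * (d - 1) + a * r"
      by (simp add: ez_eq \<rho>d algebra_simps)
    ultimately have 1: "q * (d - 1) \<le> p i - 1" using a r by (smt (verit) mult_nonneg_nonneg)
    have "k i * p i \<le> (\<Sum>j=1..m. k j * p j)"
      by (rule member_le_sum) (use i p k0 in auto)
    moreover have "2 * p i \<le> k i * p i" using k p(2) by (intro mult_right_mono) auto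
    ultimately have 2: "2 * p i \<le> d * q" using rel r by simp
    have "d * q \<le> 2 * (q * (d - 1))"
    proof -
      have "q * d \<le> q * (2 * (d - 1))" using q d by (intro mult_left_mono) auto
      then show ?thesis by (simp add: mult_ac)
    qed
    then show False using 1 2 p(2) by linarith
  qed
qed

context danielewski
begin

definition B_derivation :: "('a mpoly fract poly \<Rightarrow> 'a mpoly fract poly) \<Rightarrow> bool" where
  "B_derivation D \<longleftrightarrow> (\<forall>f\<in>B. D f \<in> B) \<and> (\<forall>f\<in>B. \<forall>g\<in>B. D (f + g) = D f + D g) \<and>
     (\<forall>c. \<forall>f\<in>B. D (pconst c * f) = pconst c * D f) \<and>
     (\<forall>f\<in>B. \<forall>g\<in>B. D (f * g) = D f * g + f * D g)"

definition B_LND :: "('a mpoly fract poly \<Rightarrow> 'a mpoly fract poly) \<Rightarrow> bool" where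
  "B_LND D \<longleftrightarrow> B_derivation D \<and> (\<forall>f\<in>B. \<exists>n. (D ^^ n) f = 0)"

lemma B_derivation_simps:
  assumes "B_derivation D"
  shows "f \<in> B \<Longrightarrow> D f \<in> B" "f \<in> B \<Longrightarrow> g \<in> B \<Longrightarrow> D (f + g) = D f + D g"
    "f \<in> B \<Longrightarrow> D (pconst c * f) = pconst c * D f"
    "f \<in> B \<Longrightarrow> g \<in> B \<Longrightarrow> D (f * g) = D f * g + f * D g"
  using assms by (auto simp: B_derivation_def)

lemma B_derivation_one:
  assumes "B_derivation D"
  shows "D 1 = 0"
  using B_derivation_simps(4)[OF assms B_one B_one] by simp

lemma B_derivation_zero:
  assumes "B_derivation D"
  shows "D 0 = 0"
  using B_derivation_simps(2)[OF assms B_zero B_zero] by simp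

lemma B_derivation_const:
  assumes "B_derivation D"
  shows "D (pconst c) = 0"
  using B_derivation_simps(3)[OF assms B_one, of c] B_derivation_one[OF assms] by simp

lemma B_derivation_sum:
  assumes "B_derivation D"
  shows "(\<And>x. x \<in> A \<Longrightarrow> f x \<in> B) \<Longrightarrow> D (sum f A) = (\<Sum>x\<in>A. D (f x))"
  by (induction A rule: infinite_finite_induct)
     (simp_all add: B_derivation_zero[OF assms] B_derivation_simps(2)[OF assms] B_sum)

lemma monom_value_B: "e \<in> red_exps \<Longrightarrow> monom_value gen e \<in> B"
  unfolding monom_value_def by (intro B_prod B_power B_gen) (auto simp: red_exps_def)

text \<open>By the Leibniz rule the bound passes from the generators to the reduced monomials, and from there to
  all of \<open>B\<close> because the leading exponent of an element is the largest one among its reduced monomials.\<close>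

lemma derivation_degree_bound:
  assumes D: "B_derivation D"
    and gens: "\<And>i. i < m + 2 \<Longrightarrow> below plead (plead (gen i) + \<epsilon>) (D (gen i))"
    and f: "f \<in> B" "f \<noteq> 0"
  shows "below plead (plead f + \<epsilon>) (D f)"
proof -
  define Q where "Q g \<longleftrightarrow> g \<in> B \<and> g \<noteq> 0 \<and> below plead (plead g + \<epsilon>) (D g)" for g
  have Q1: "Q 1" by (simp add: Q_def B_one B_derivation_one[OF D])
  have Qm: "Q (g * h)" if "Q g" "Q h" for g h
  proof -
    have g: "g \<in> B" "g \<noteq> 0" "below plead (plead g + \<epsilon>) (D g)"
      and h: "h \<in> B" "h \<noteq> 0" "below plead (plead h + \<epsilon>) (D h)" using that by (auto simp: Q_def)
    have "below plead (plead g + \<epsilon> + plead h) (D g * h)"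
      "below plead (plead g + (plead h + \<epsilon>)) (g * D h)"
      by (intro pol.below_mult g h pol.below_lead)+
    then have "below plead (plead g + plead h + \<epsilon>) (D g * h + g * D h)"
      by (intro pol.below_add) (simp_all add: add_ac)
    then show ?thesis
      using g h by (simp add: Q_def B_mult pol.lead_mult B_derivation_simps(4)[OF D])
  qed
  have Qp: "Q (g ^ n)" if "Q g" for g n
    by (induction n) (auto intro: Q1 Qm that)
  have Qmon: "Q (monom_value gen e)" if e: "e \<in> red_exps" for e
  proof -
    have "Q (\<Prod>i\<in>S. gen i ^ lookup e i)" if "S \<subseteq> {..<m + 2}" "finite S" for S
      using that(2,1)
    proof (induction S)
      case (insert i S)
      then have "Q (gen i)" by (auto simp: Q_def B_gen gen_nonzero gens)
      then show ?case using insert by (auto intro!: Qm Qp)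
    qed (simp add: Q1)
    then show ?thesis using e by (auto simp: monom_value_def red_exps_def)
  qed
  obtain p where p: "p \<in> reduced" "f = iota p" using B_reduced[OF f(1)] by blast
  have "p \<noteq> 0" using p f by (auto simp: iota.hom_zero)
  then obtain e0 where e0: "plead f = plead (monom_value gen e0)"
    "\<forall>e'\<in>keys p. plead (monom_value gen e') \<le> plead (monom_value gen e0)"
    using plead_reduced(2)[OF p(1)] p(2) by auto
  have red: "e \<in> red_exps" if "e \<in> keys p" for e using p(1) that by (auto simp: reduced_def)
  have "D f = (\<Sum>e\<in>keys p. pconst (lookup p e) * D (monom_value gen e))"
    unfolding p(2) iota_expansion
    by (subst B_derivation_sum[OF D])
       (auto intro!: B_mult B_pconst monom_value_B red sum.cong B_derivation_simps(3)[OF D])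
  moreover have "below plead (plead f + \<epsilon>) (pconst c * D (monom_value gen e))"
    if e: "e \<in> keys p" for c e
  proof -
    have "below plead (plead (monom_value gen e) + \<epsilon>) (D (monom_value gen e))"
      using Qmon[OF red[OF e]] by (simp add: Q_def)
    moreover have "plead (monom_value gen e) + \<epsilon> \<le> plead f + \<epsilon>" using e0 e by simp
    ultimately have "below plead (plead f + \<epsilon>) (D (monom_value gen e))" by (rule pol.below_mono)
    moreover have "below plead 0 (pconst c)" by (cases "c = 0") (auto simp: below_def plead_pconst)
    ultimately have "below plead (0 + (plead f + \<epsilon>)) (pconst c * D (monom_value gen e))"
      by (intro pol.below_mult)
    then show ?thesis by simp
  qed
  ultimately show ?thesis by (simp add: pol.below_sum)
qed

lemma nat_additive_prod:
  fixes n :: "'a mpoly fract poly \<Rightarrow> nat"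
  assumes n: "\<And>f g. f \<in> B \<Longrightarrow> g \<in> B \<Longrightarrow> f \<noteq> 0 \<Longrightarrow> g \<noteq> 0 \<Longrightarrow> n (f * g) = n f + n g"
  shows "f \<in> B \<Longrightarrow> f \<noteq> 0 \<Longrightarrow> n (f ^ a) = a * n f"
    "finite S \<Longrightarrow> (\<And>x. x \<in> S \<Longrightarrow> h x \<in> B \<and> h x \<noteq> 0) \<Longrightarrow> n (prod h S) = (\<Sum>x\<in>S. n (h x))"
proof -
  have 1: "n 1 = 0" using n[OF B_one B_one] by simp
  show "n (f ^ a) = a * n f" if "f \<in> B" "f \<noteq> 0"
    using that by (induction a) (auto simp: 1 n B_power)
  show "n (prod h S) = (\<Sum>x\<in>S. n (h x))" if "finite S" "\<And>x. x \<in> S \<Longrightarrow> h x \<in> B \<and> h x \<noteq> 0"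
    using that
  proof (induction S)
    case (insert x S)
    then have "n (h x * prod h S) = n (h x) + n (prod h S)" by (intro n B_prod) auto
    then show ?case using insert by simp
  qed (simp add: 1)
qed

text \<open>The bound \<open>\<epsilon>\<close> on the rise of leading exponents is chosen so that some generator attains it;
  then the weight of that generator is nonzero.\<close>

theorem LND_annihilates_y:
  assumes D: "B_LND D" and i: "i \<in> {1..m}"
  shows "D (gen i) = 0"
proof (rule ccontr)
  assume nz: "D (gen i) \<noteq> 0"
  have der: "B_derivation D" using D by (simp add: B_LND_def)
  define I where "I = {j. j < m + 2 \<and> D (gen j) \<noteq> 0}"
  define \<epsilon> where "\<epsilon> = Max ((\<lambda>j. plead (D (gen j)) - plead (gen j)) ` I)"
  have fin: "finite I" and ne: "I \<noteq> {}" using nz i by (auto simp: I_def intro!: exI[of _ i])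
  have "\<epsilon> \<in> (\<lambda>j. plead (D (gen j)) - plead (gen j)) ` I"
    unfolding \<epsilon>_def by (rule Max_in) (use fin ne in auto)
  then obtain j0 where j0: "j0 \<in> I" "plead (D (gen j0)) = plead (gen j0) + \<epsilon>" by auto
  have gens: "below plead (plead (gen j) + \<epsilon>) (D (gen j))" if "j < m + 2" for j
  proof (cases "D (gen j) = 0")
    case False
    then have "plead (D (gen j)) - plead (gen j) \<le> \<epsilon>"
      unfolding \<epsilon>_def using that fin by (intro Max_ge) (auto simp: I_def)
    then have "plead (D (gen j)) \<le> plead (gen j) + \<epsilon>" by (metis add.commute diff_le_eq)
    then show ?thesis by (simp add: below_def)
  qed simp
  interpret filtered_LND rat.poly_lead rat.poly_lc pconst B D \<epsilon>
  proof unfold_locales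
    show "below plead (plead f + \<epsilon>) (D f)" if "f \<in> B" "f \<noteq> 0" for f
      by (rule derivation_degree_bound[OF der gens that])
    show "\<exists>n. (D ^^ n) f = 0" if "f \<in> B" for f using D that by (simp add: B_LND_def)
  qed (auto simp: B_derivation_simps[OF der] B_derivation_const[OF der] B_add B_mult B_pconst plead_pconst poly_lc_pconst
        ring_map.hom_add[OF pconst_hom] ring_map.hom_mult[OF pconst_hom] ring_map.hom_one[OF pconst_hom])
  have j0B: "gen j0 \<in> B" using j0(1) by (auto simp: I_def intro: B_gen)
  have w0: "weight (gen j0) \<noteq> 0"
    using j0 by (simp add: weight_def coeff_at_def I_def pol.lc_eq_0_iff gen_nonzero)
  obtain n where
    n_mult: "\<And>f g. f \<in> B \<Longrightarrow> g \<in> B \<Longrightarrow> f \<noteq> 0 \<Longrightarrow> g \<noteq> 0 \<Longrightarrow> n (f * g) = n f + n g" and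
    n_lead: "\<And>f g. f \<in> B \<Longrightarrow> g \<in> B \<Longrightarrow> f \<noteq> 0 \<Longrightarrow> g \<noteq> 0 \<Longrightarrow> plead f = plead g \<Longrightarrow> n f = n g" and
    n_D: "\<And>f. f \<in> B \<Longrightarrow> f \<noteq> 0 \<Longrightarrow> n f > 0 \<Longrightarrow> D f \<noteq> 0 \<and> plead (D f) = plead f + \<epsilon> \<and> n f = Suc (n (D f))" and
    n_j0: "n (gen j0) > 0"
  proof (rule nilpotency_degree[OF j0B gen_nonzero w0], goal_cases)
    case (1 n)
    from 1(2-5) show thesis by (rule 1(1)[of n])
  qed
  note n_prod = nat_additive_prod[of n, OF n_mult]
  define p where "p j = int (n (gen j))" for j
  define q where "q = int (n (gen (m + 1)))"
  define r where "r = int (n (gen 0))"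
  have BM: "iota M \<in> B" "iota M \<noteq> 0"
    using iota_in_B[OF M_in'] M_nonzero by (simp_all add: iota_M lex.Fract_eq_0_iff)
  have "int (n (iota M)) = (\<Sum>j=1..m. int (k j) * p j)"
  proof -
    have "iota M = (\<Prod>j=1..m. gen j ^ k j)"
      unfolding dan_monom_def by (simp add: iota.hom_prod iota.hom_power)
    then have "n (iota M) = (\<Sum>j=1..m. n (gen j ^ k j))"
      by (simp only:) (rule n_prod(2); auto intro!: B_power B_gen simp: gen_nonzero)
    also have "\<dots> = (\<Sum>j=1..m. k j * n (gen j))"
      by (intro sum.cong refl n_prod(1) B_gen gen_nonzero) auto
    finally show ?thesis by (simp add: p_def)
  qed
  moreover have "n (gen 0) + n (iota M) = d * n (gen (m + 1))"
  proof -
    have "n (gen 0) + n (iota M) = n (gen 0 * iota M)"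
      using BM by (intro n_mult[symmetric] B_gen gen_nonzero) auto
    also have "\<dots> = n (gen (m + 1) ^ d)"
    proof (rule n_lead)
      show "gen 0 * iota M \<in> B" by (intro B_mult B_gen BM) auto
      show "gen (m + 1) ^ d \<in> B" by (intro B_power B_gen) auto
      show "gen 0 * iota M \<noteq> 0" using BM gen_nonzero by simp
      show "gen (m + 1) ^ d \<noteq> 0" using gen_nonzero by simp
      have "plead (gen (m + 1) ^ d) = (int d, 0)"
        using fst_plead_power[OF gen_nonzero, of "m + 1" d] snd_plead_power[OF gen_nonzero, of "m + 1" d]
        by (simp add: plead_z prod_eq_iff poly_mapping_eq_iff fun_eq_iff)
      then show "plead (gen 0 * iota M) = plead (gen (m + 1) ^ d)"
        by (simp add: x_times_M iota_P plead_PZ)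
    qed
    also have "\<dots> = d * n (gen (m + 1))" by (intro n_prod(1) B_gen gen_nonzero) auto
    finally show ?thesis .
  qed
  ultimately have rel: "r + (\<Sum>j=1..m. int (k j) * p j) = int d * q"
    by (metis of_nat_add of_nat_mult q_def r_def)
  define W where "W \<gamma> = q * fst \<gamma> + (\<Sum>j=1..m. p j * lookup (snd \<gamma>) j)"
    for \<gamma> :: "int \<times> (nat \<Rightarrow>\<^sub>0 int)"
  have W_add: "W (\<gamma> + \<delta>) = W \<gamma> + W \<delta>" for \<gamma> \<delta>
    by (simp add: W_def lookup_add algebra_simps sum.distrib)
  have nW: "int (n f) = W (plead f)" if f: "f \<in> B" "f \<noteq> 0" for f
  proof -
    obtain e where e: "e \<in> red_exps" "plead f = plead (monom_value gen e)" using plead_B[OF f] by blast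
    then have ke: "keys e \<subseteq> {..<m + 2}" by (simp add: red_exps_def)
    let ?l = "\<lambda>j. int (lookup e j)"
    have "n f = n (monom_value gen e)"
      by (intro n_lead f monom_value_B e monom_value_nonzero)
    also have "\<dots> = (\<Sum>j<m + 2. n (gen j ^ lookup e j))"
      unfolding monom_value_superset[OF finite_lessThan ke]
      by (rule n_prod(2)) (auto intro!: B_power B_gen simp: gen_nonzero)
    also have "\<dots> = (\<Sum>j<m + 2. lookup e j * n (gen j))"
      by (intro sum.cong refl n_prod(1) B_gen gen_nonzero) auto
    finally have "int (n f) = (\<Sum>j<m + 2. ?l j * int (n (gen j)))" by (simp only: of_nat_sum of_nat_mult)
    also have "\<dots> = ?l 0 * r + ?l (m + 1) * q + (\<Sum>j=1..m. ?l j * p j)"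
      unfolding index_split by (simp add: r_def q_def p_def)
    also have "\<dots> = q * (int d * ?l 0 + ?l (m + 1)) + (\<Sum>j=1..m. p j * (?l j - int (k j) * ?l 0))"
    proof -
      have "(\<Sum>j=1..m. p j * (?l j - int (k j) * ?l 0)) =
          (\<Sum>j=1..m. ?l j * p j) - ?l 0 * (\<Sum>j=1..m. int (k j) * p j)"
        by (simp add: sum_subtractf sum_distrib_left algebra_simps)
      moreover have "r = int d * q - (\<Sum>j=1..m. int (k j) * p j)" using rel by simp
      ultimately show ?thesis by (simp only:) (simp only: algebra_simps)
    qed
    also have "\<dots> = W (plead f)"
      unfolding W_def e(2) plead_monom(1)[OF ke] by (simp add: plead_monom(2)[OF ke])
    finally show ?thesis .
  qed
  have W\<epsilon>: "W \<epsilon> = - 1"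
  proof -
    have g: "gen j0 \<in> B" "gen j0 \<noteq> 0" using j0 by (auto simp: I_def B_gen gen_nonzero)
    have "D (gen j0) \<in> B" using g by (simp add: B_derivation_simps(1)[OF der])
    then have "int (n (D (gen j0))) = W (plead (gen j0)) + W \<epsilon>"
      using n_D[OF g n_j0] nW[of "D (gen j0)"] by (simp add: W_add)
    then show ?thesis using n_D[OF g n_j0] nW[OF g] by simp
  qed
  show False
  proof (cases "\<exists>i\<in>{1..m}. p i > 0")
    case True
    then obtain i where i: "i \<in> {1..m}" "p i > 0" by blast
    have img: "D (gen j) \<in> B \<and> D (gen j) \<noteq> 0 \<and> plead (D (gen j)) = plead (gen j) + \<epsilon>"
      if "j < m + 2" "n (gen j) > 0" for j
      using n_D[OF B_gen[OF that(1)] gen_nonzero that(2)] B_derivation_simps(1)[OF der B_gen[OF that(1)]]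
      by blast
    have yi: "D (gen i) \<in> B" "D (gen i) \<noteq> 0" "plead (D (gen i)) = (0, single i 1) + \<epsilon>"
      using img[of i] i by (auto simp: p_def plead_y)
    have q0: "q > 0"
    proof -
      have "int (k i) * p i \<le> (\<Sum>j=1..m. int (k j) * p j)"
        by (rule member_le_sum) (use i in \<open>auto simp: p_def\<close>)
      moreover have "0 < int (k i) * p i" using i k2[of i] by auto
      ultimately have "int d * q > 0" using rel by (simp add: r_def)
      then show ?thesis by (simp add: zero_less_mult_iff)
    qed
    have zi: "D (gen (m + 1)) \<in> B" "D (gen (m + 1)) \<noteq> 0" "plead (D (gen (m + 1))) = (1, 0) + \<epsilon>"
      using img[of "m + 1"] q0 by (auto simp: q_def plead_z)
    show False
    proof (rule no_small_weights[where d = "int d" and i = i and m = m and p = p and k = "\<lambda>j. int (k j)" and q = q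
        and r = r and ez = "fst \<epsilon>" and \<epsilon> = "\<lambda>j. lookup (snd \<epsilon>) j"])
      show "2 \<le> int d" using d2 by simp
      show "2 \<le> int (k i)" using k2[OF i(1)] by simp
      show "r + (\<Sum>j = 1..m. int (k j) * p j) = int d * q" by (rule rel)
      show "q * fst \<epsilon> + (\<Sum>j = 1..m. p j * lookup (snd \<epsilon>) j) = - 1"
        using W\<epsilon> by (simp add: W_def)
      show "0 \<le> fst \<epsilon>" using plead_B_bounds(1)[OF yi(1,2)] yi(3) by simp
      show "0 \<le> (if j = i then 1 else 0) + lookup (snd \<epsilon>) j + fst \<epsilon> div int d * int (k j)"
        if "j \<in> {1..m}" for j
        using plead_B_bounds(2)[OF yi(1,2) that] yi(3) by (simp add: lookup_add lookup_single when_def)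
      show "0 \<le> lookup (snd \<epsilon>) j + (1 + fst \<epsilon>) div int d * int (k j)"
        if "j \<in> {1..m}" for j
        using plead_B_bounds(2)[OF zi(1,2) that] zi(3) by (simp add: lookup_add)
    qed (use i in \<open>auto simp: p_def q_def r_def\<close>)
  next
    case False
    then have "p j = 0" if "j \<in> {1..m}" for j using that by (force simp: p_def)
    then have qe: "q * fst \<epsilon> = - 1" using W\<epsilon> by (simp add: W_def)
    then have "fst \<epsilon> < 0" using q_def by (smt (verit) mult_nonneg_nonneg of_nat_0_le_iff)
    moreover have "below plead (plead (gen i) + \<epsilon>) (D (gen i))" by (rule gens) (use i in auto)
    ultimately have "fst (plead (D (gen i))) < 0"
      using nz i by (auto simp: below_def plead_y less_eq_prod_def)
    then show False
      using plead_B_bounds(1)[of "D (gen i)"] nz i B_derivation_simps(1)[OF der] B_gen by force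
  qed
qed

end

section \<open>The canonical derivation and the structure of automorphisms\<close>

lemma keys_exp_diff: "keys (e - e') \<subseteq> keys (e :: nat \<Rightarrow>\<^sub>0 nat)"
  by (auto simp: in_keys_iff lookup_minus)

context danielewski
begin

definition yring :: "'a mpoly fract set" where
  "yring = {Fract q 1 | q. q \<in> mpolys {1..m}}"

lemma yringI: "q \<in> mpolys {1..m} \<Longrightarrow> Fract q 1 \<in> yring"
  by (auto simp: yring_def)

lemma pderiv_sum: "pderiv (sum f A) = (\<Sum>x\<in>A. pderiv (f x :: 'a mpoly fract poly))"
  by (induction A rule: infinite_finite_induct) (auto simp: pderiv_add)

lemma yring_zero: "0 \<in> yring"
  using yringI[of 0] by (simp add: Zero_fract_def)

lemma yring_one: "1 \<in> yring"
  using yringI[of 1] by (simp add: One_fract_def)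

lemma yring_add: "a \<in> yring \<Longrightarrow> b \<in> yring \<Longrightarrow> a + b \<in> yring"
  by (auto simp: yring_def intro: add_in_mpolys)

lemma yring_mult: "a \<in> yring \<Longrightarrow> b \<in> yring \<Longrightarrow> a * b \<in> yring"
  by (auto simp: yring_def intro: mult_in_mpolys)

lemma yring_sum: "(\<And>x. x \<in> A \<Longrightarrow> f x \<in> yring) \<Longrightarrow> sum f A \<in> yring"
  by (induction A rule: infinite_finite_induct) (auto intro: yring_zero yring_add)

lemma coeff_in_yring: "p \<in> mpolys {1..m + 1} \<Longrightarrow> coeff (iota p) n \<in> yring"
proof (induction p arbitrary: n rule: mpolys_induct)
  case (Const a)
  have "rat_const a \<in> yring" unfolding rat_const_def by (intro yringI) simp
  then show ?case by (simp add: pconst_def coeff_pCons yring_zero split: nat.split)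
next
  case (Var i)
  show ?case
  proof (cases "i = m + 1")
    case True
    then show ?thesis by (auto simp: gen_z coeff_pCons yring_zero yring_one split: nat.split)
  next
    case False
    then have "i \<in> {1..m}" using Var by auto
    moreover have "rat_var i \<in> yring" unfolding rat_var_def by (intro yringI) (use calculation in simp)
    ultimately show ?thesis by (simp add: gen_y coeff_pCons yring_zero split: nat.split)
  qed
next
  case (add p q)
  then show ?case by (simp add: iota.hom_add yring_add)
next
  case (mult p q)
  then show ?case by (simp add: iota.hom_mult coeff_mult yring_sum yring_mult)
qed

lemma monom_value_yz:
  assumes "keys e \<subseteq> {1..m + 1}"
  shows "monom_value gen e =
    monom (Fract (\<Prod>i=1..m. Var i ^ lookup e i) 1) (lookup e (m + 1))"
proof -
  have "monom_value gen e = (\<Prod>i\<in>insert (m + 1) {1..m}. gen i ^ lookup e i)"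
    by (rule monom_value_superset) (use assms in auto)
  also have "\<dots> = iota (\<Prod>i=1..m. Var i ^ lookup e i) * gen (m + 1) ^ lookup e (m + 1)"
    by (simp add: iota.hom_prod iota.hom_power mult.commute)
  also have "iota (\<Prod>i=1..m. Var i ^ lookup e i) =
      [:Fract (\<Prod>i=1..m. Var i ^ lookup e i) 1:]"
    by (rule iota_y) (auto intro!: prod_in_mpolys power_in_mpolys)
  finally show ?thesis by (simp add: gen_z z_power smult_monom)
qed

lemma mpoly_diff_in_mpolys: "p \<in> mpolys S \<Longrightarrow> mpoly_diff i p \<in> mpolys S"
  unfolding mpoly_diff_def
proof (rule sum_in_mpolys)
  fix e assume "p \<in> mpolys S" "e \<in> keys p"
  then have "keys (e - single i 1) \<subseteq> S"
    using keys_exp_diff[of e "single i 1"] by (auto simp: mpolys_def)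
  then show "single (e - single i 1)
      (of_nat (lookup e i) * lookup p e) \<in> mpolys S"
    by (auto simp: mpolys_def split: if_splits)
qed

text \<open>On \<open>K[y, z]\<close> the map to \<open>F[z]\<close> only groups terms by their power of \<open>z\<close>.\<close>

lemma pderiv_iota:
  assumes "p \<in> mpolys {1..m + 1}"
  shows "pderiv (iota p) = iota (mpoly_diff (m + 1) p)"
proof -
  have "pderiv (pconst (lookup p e) * monom_value gen e) =
      iota (single (e - single (m + 1) 1)
          (of_nat (lookup e (m + 1)) * lookup p e))"
    if e: "e \<in> keys p" for e
  proof -
    let ?e = "e - single (m + 1) 1"
    have k: "keys e \<subseteq> {1..m + 1}" using assms e by (simp add: mpolys_def)
    then have k': "keys ?e \<subseteq> {1..m + 1}" using keys_exp_diff[of e "single (m + 1) 1"] by blast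
    have "(\<Prod>i=1..m. Var i ^ lookup ?e i) = (\<Prod>i=1..m. Var i ^ lookup e i :: 'a mpoly)"
      by (rule prod.cong) (auto simp: lookup_minus lookup_single)
    moreover have "rat_const (of_nat n * c) = (of_nat n * rat_const c :: 'a mpoly fract)" for n c
      by (simp add: ring_map.hom_mult[OF rat_const_hom] ring_map.hom_of_nat[OF rat_const_hom])
    ultimately show ?thesis
      unfolding iota_def ring_map.eval_single[OF pconst_hom] monom_value_yz[OF k] monom_value_yz[OF k']
      by (simp add: pconst_def pderiv_smult pderiv_monom smult_monom lookup_minus mult_ac)
  qed
  then show ?thesis
    unfolding mpoly_diff_def iota.hom_sum
    by (subst iota_expansion) (simp only: pderiv_sum cong: sum.cong)
qed

text \<open>The canonical derivation, transported to \<open>B\<close>.\<close>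

definition dz :: "'a mpoly fract poly \<Rightarrow> 'a mpoly fract poly" where
  "dz f = iota M * pderiv f"

lemma dz_y: "i \<in> {1..m} \<Longrightarrow> dz (gen i) = 0"
  by (simp add: dz_def gen_y)

lemma dz_z: "dz (gen (m + 1)) = iota M"
  by (simp add: dz_def gen_z pderiv_pCons)

lemma dz_x: "dz (gen 0) = iota (mpoly_diff (m + 1) P)"
proof -
  have "dz (gen 0) = pderiv (gen 0 * iota M)"
    by (simp add: dz_def iota_M pderiv_smult mult.commute)
  then show ?thesis unfolding x_times_M by (simp only: pderiv_iota[OF P_in])
qed

lemma dz_add: "dz (f + g) = dz f + dz g"
  by (simp add: dz_def pderiv_add algebra_simps)

lemma dz_mult: "dz (f * g) = dz f * g + f * dz g"
  by (simp add: dz_def pderiv_mult algebra_simps)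

lemma dz_pconst: "dz (pconst c) = 0"
  by (simp add: dz_def pconst_def)

lemma dz_closed: "f \<in> B \<Longrightarrow> dz f \<in> B"
proof -
  have "dz (iota p) \<in> B" if "p \<in> mpolys {..<m + 2}" for p
    using that
  proof (induction rule: mpolys_induct)
    case (Const a)
    then show ?case by (simp add: dz_pconst B_zero)
  next
    case (Var i)
    then consider "i = 0" | "i = m + 1" | "i \<in> {1..m}" by force
    then show ?case
    proof cases
      case 1
      have "iota (mpoly_diff (m + 1) P) \<in> B" by (intro iota_in_B mpoly_diff_in_mpolys P_in')
      then show ?thesis using dz_x 1 by simp
    next
      case 2
      have "iota M \<in> B" by (intro iota_in_B M_in')
      then show ?thesis using dz_z 2 by (metis iota_Var)
    next
      case 3
      then show ?thesis by (simp add: dz_y B_zero)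
    qed
  next
    case (add p q)
    then show ?case by (simp add: iota.hom_add dz_add B_add)
  next
    case (mult p q)
    then show ?case by (simp add: iota.hom_mult dz_mult B_add B_mult iota_in_B)
  qed
  then show "f \<in> B \<Longrightarrow> dz f \<in> B" by (auto simp: B_def)
qed

lemma iota_M_nonzero: "iota M \<noteq> 0"
  using M_nonzero by (simp add: iota_M lex.Fract_eq_0_iff)

lemma dz_eq_0_iff: "dz f = 0 \<longleftrightarrow> degree f = 0"
  using iota_M_nonzero by (simp add: dz_def pderiv_eq_0_iff)

lemma degree_dz: "degree (dz f) = degree f - 1"
proof (cases "pderiv f = 0")
  case True
  then have "degree f = 0" by (simp add: pderiv_eq_0_iff)
  then show ?thesis using True by (simp add: dz_def)
next
  case False
  then have "degree (dz f) = degree (iota M) + degree (pderiv f)"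
    unfolding dz_def by (intro degree_mult_eq iota_M_nonzero)
  then show ?thesis by (simp add: iota_M degree_pderiv)
qed

lemma degree_dz_iter: "degree ((dz ^^ n) f) = degree f - n"
  by (induction n) (auto simp: degree_dz)

lemma dz_nilpotent: "(dz ^^ Suc (degree f)) f = 0"
  using degree_dz_iter[of "degree f" f] by (simp add: dz_eq_0_iff)

lemma dz_derivation: "B_derivation dz"
  by (simp add: B_derivation_def dz_closed dz_add dz_mult dz_pconst)

subsection \<open>Elements of small degree\<close>

lemma reduced_degree:
  assumes "p \<in> reduced" "e \<in> keys p"
  shows "d * lookup e 0 + lookup e (m + 1) \<le> degree (iota p)"
proof -
  have "p \<noteq> 0" using assms by auto
  then have "plead (monom_value gen e) \<le> plead (iota p)"
    using plead_reduced(2)[OF assms(1)] assms(2) by auto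
  then have "fst (plead (monom_value gen e)) \<le> fst (plead (iota p))"
    by (auto simp: less_eq_prod_def)
  moreover have "keys e \<subseteq> {..<m + 2}" using assms by (auto simp: reduced_def red_exps_def)
  ultimately have "int (d * lookup e 0 + lookup e (m + 1)) \<le> int (degree (iota p))"
    using plead_monom(1)[of e] by (simp add: rat.poly_lead_def)
  then show ?thesis by linarith
qed

lemma keys_avoid: "i \<notin> keys e \<longleftrightarrow> lookup e i = 0"
  by (simp add: in_keys_iff)

lemma keys_without_x:
  assumes "keys e \<subseteq> {..<m + 2}" "0 \<notin> keys e"
  shows "keys e \<subseteq> {1..m + 1}"
proof
  fix i assume i: "i \<in> keys e"
  then have "i < m + 2" using assms(1) by blast
  moreover have "i \<noteq> 0" using i assms(2) by metis
  ultimately show "i \<in> {1..m + 1}" by simp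
qed

lemma B_degree_less:
  assumes "f \<in> B" "degree f < d"
  shows "\<exists>p\<in>mpolys {1..m + 1}. f = iota p"
proof -
  obtain p where p: "p \<in> reduced" "f = iota p" using B_reduced[OF assms(1)] by blast
  have "keys e \<subseteq> {1..m + 1}" if e: "e \<in> keys p" for e
  proof -
    have "d * lookup e 0 < d * 1" using reduced_degree[OF p(1) e] assms(2) unfolding p(2) by linarith
    then have "lookup e 0 = 0" by simp
    then have "0 \<notin> keys e" by (simp add: keys_avoid)
    moreover have "keys e \<subseteq> {..<m + 2}" using p(1) e by (auto simp: reduced_def red_exps_def)
    ultimately show ?thesis by (intro keys_without_x)
  qed
  then have "p \<in> mpolys {1..m + 1}" by (simp add: mpolys_def)
  then show ?thesis using p(2) by blast
qed

lemma B_degree_0: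
  assumes "f \<in> B" "degree f = 0"
  shows "\<exists>p\<in>mpolys {1..m}. f = iota p"
proof -
  obtain p where p: "p \<in> reduced" "f = iota p" using B_reduced[OF assms(1)] by blast
  have "keys e \<subseteq> {1..m}" if e: "e \<in> keys p" for e
  proof -
    have "d * lookup e 0 + lookup e (m + 1) \<le> 0"
      using reduced_degree[OF p(1) e] assms(2) p(2) by simp
    then have "lookup e 0 = 0" "lookup e (m + 1) = 0" using d2 by auto
    then have "0 \<notin> keys e" "m + 1 \<notin> keys e" by (simp_all add: keys_avoid)
    moreover have "keys e \<subseteq> insert 0 (insert (m + 1) {1..m})"
      using p(1) e unfolding index_split[symmetric] by (auto simp: reduced_def red_exps_def)
    ultimately show ?thesis by auto
  qed
  then have "p \<in> mpolys {1..m}" by (simp add: mpolys_def)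
  then show ?thesis using p(2) by blast
qed

text \<open>Among the reduced monomials of degree at most \<open>d\<close> in \<open>z\<close>, only those of the form \<open>x y\<^sup>b\<close> have denominators.
  They contribute \<open>y\<^sup>b P/M\<close>, and \<open>P\<close> has no term of degree \<open>d - 1\<close>.\<close>

lemma B_degree_d:
  assumes "f \<in> B" "degree f \<le> d"
  shows "Fract M 1 * coeff f d \<in> yring" "coeff f (d - 1) \<in> yring"
proof -
  obtain p where p: "p \<in> reduced" "f = iota p" using B_reduced[OF assms(1)] by blast
  have MR: "Fract M 1 \<in> yring" by (intro yringI M_in)
  have *: "Fract M 1 * coeff (pconst (lookup p e) * monom_value gen e) d \<in> yring \<and>
      coeff (pconst (lookup p e) * monom_value gen e) (d - 1) \<in> yring"
    if e: "e \<in> keys p" for e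
  proof (cases "lookup e 0 = 0")
    case True
    let ?c = "lookup p e"
    have "keys e \<subseteq> {..<m + 2}" "0 \<notin> keys e"
      using p(1) e True by (auto simp: reduced_def red_exps_def keys_avoid)
    then have "keys e \<subseteq> {1..m + 1}" by (intro keys_without_x)
    then have "single e ?c \<in> mpolys {1..m + 1}" by (auto simp: mpolys_def split: if_splits)
    then have "coeff (iota (single e ?c)) n \<in> yring" for n by (rule coeff_in_yring)
    moreover have "iota (single e ?c) = pconst ?c * monom_value gen e"
      by (simp add: iota_def ring_map.eval_single[OF pconst_hom])
    ultimately show ?thesis using MR by (auto intro: yring_mult)
  next
    case False
    have le: "d * lookup e 0 + lookup e (m + 1) \<le> d"
      using reduced_degree[OF p(1) e] assms(2) p(2) by simp
    then have "d * lookup e 0 \<le> d * 1" by linarith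
    then have "lookup e 0 \<le> 1" using d2 by (simp only: mult_le_cancel1)
    then have e0: "lookup e 0 = 1" using False by simp
    then have ez: "lookup e (m + 1) = 0" using le by simp
    define e' where "e' = e - single 0 1"
    have ee: "e = e' + single 0 1"
      by (rule poly_mapping_eqI) (use e0 in \<open>auto simp: e'_def lookup_add lookup_minus lookup_single when_def\<close>)
    have "0 \<notin> keys e'" "m + 1 \<notin> keys e'"
      using e0 ez by (auto simp: keys_avoid e'_def lookup_minus lookup_single when_def)
    moreover have "keys e' \<subseteq> keys e"
      by (simp only: e'_def keys_exp_diff)
    moreover have "keys e \<subseteq> insert 0 (insert (m + 1) {1..m})"
      using p(1) e unfolding index_split[symmetric] by (auto simp: reduced_def red_exps_def)
    ultimately have "keys e' \<subseteq> {1..m}" by auto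
    then have q: "single e' (lookup p e) \<in> mpolys {1..m}" (is "?q \<in> _")
      by (auto simp: mpolys_def split: if_splits)
    have "pconst (lookup p e) * monom_value gen e = iota ?q * gen 0"
      by (subst ee) (simp add: iota_def ring_map.eval_single[OF pconst_hom] monom_value_add)
    also have "\<dots> = smult (Fract ?q 1 * Fract 1 M) PZ"
      unfolding iota_y[OF q] gen_x by simp
    finally have eq: "pconst (lookup p e) * monom_value gen e = smult (Fract ?q 1 * Fract 1 M) PZ" .
    have "Fract M 1 * (Fract ?q 1 * Fract 1 M) = Fract ?q 1"
      using M_nonzero by (simp add: eq_fract)
    then show ?thesis
      unfolding eq using yringI[OF q] yring_zero d2 s_top by (auto simp: PZ_coeff fract_collapse)
  qed
  show "Fract M 1 * coeff f d \<in> yring"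
    unfolding p(2) iota_expansion coeff_sum sum_distrib_left using * by (intro yring_sum) blast
  show "coeff f (d - 1) \<in> yring"
    unfolding p(2) iota_expansion coeff_sum using * by (intro yring_sum) blast
qed

lemma iota_y_inj: "p \<in> mpolys {1..m} \<Longrightarrow> q \<in> mpolys {1..m} \<Longrightarrow> iota p = iota q \<Longrightarrow> p = q"
  by (simp add: iota_y eq_fract)

end

subsection \<open>Units and divisors of monomials\<close>

text \<open>A unit divides the monomial 1.\<close>

lemma mpoly_unit_Const:
  fixes p q :: "'a::field mpoly"
  assumes "p * q = 1"
  shows "\<exists>c. c \<noteq> 0 \<and> p = Const c"
proof -
  have "p * q = single 0 1" using assms by simp
  then obtain e a where ea: "a \<noteq> 0" "p = single e a"
    using monomial_factor[of p q 0 1] by auto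
  have nz: "p \<noteq> 0" "q \<noteq> 0" using assms by auto
  then have "lex_exp p + lex_exp q = 0" using lex_mult(1)[OF nz] assms by (simp add: lex_exp_def)
  moreover have "lex_exp p = e" using ea by (simp add: lex_exp_def)
  ultimately have "lookup e i = 0" for i
    by (metis add_eq_0_iff_both_eq_0 lookup_add lookup_zero)
  then have "e = 0" by (intro poly_mapping_eqI) simp
  then show ?thesis using ea by (auto simp: Const_def)
qed

subsection \<open>Automorphisms\<close>

context danielewski
begin

definition B_aut :: "('a mpoly fract poly \<Rightarrow> 'a mpoly fract poly) \<Rightarrow> bool" where
  "B_aut \<phi> \<longleftrightarrow> bij_betw \<phi> B B \<and> (\<forall>f\<in>B. \<forall>g\<in>B. \<phi> (f + g) = \<phi> f + \<phi> g) \<and>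
     (\<forall>f\<in>B. \<forall>g\<in>B. \<phi> (f * g) = \<phi> f * \<phi> g) \<and> (\<forall>c. \<phi> (pconst c) = pconst c)"

lemma B_aut_inv_into:
  assumes "B_aut \<phi>"
  shows "B_aut (inv_into B \<phi>)"
proof -
  have bij: "bij_betw \<phi> B B" using assms by (simp add: B_aut_def)
  then have inj: "inj_on \<phi> B" and im: "\<phi> ` B = B" by (auto simp: bij_betw_def)
  have 1: "inv_into B \<phi> (\<phi> f) = f" if "f \<in> B" for f using inj that by simp
  have 2: "\<phi> (inv_into B \<phi> f) = f" "inv_into B \<phi> f \<in> B" if "f \<in> B" for f
    using im that by (auto intro: f_inv_into_f inv_into_into)
  have "inv_into B \<phi> (f + g) = inv_into B \<phi> f + inv_into B \<phi> g" if "f \<in> B" "g \<in> B" for f g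
    using 1[of "inv_into B \<phi> f + inv_into B \<phi> g"] 2[OF that(1)] 2[OF that(2)] assms
    by (simp add: B_aut_def B_add)
  moreover have "inv_into B \<phi> (f * g) = inv_into B \<phi> f * inv_into B \<phi> g" if "f \<in> B" "g \<in> B" for f g
    using 1[of "inv_into B \<phi> f * inv_into B \<phi> g"] 2[OF that(1)] 2[OF that(2)] assms
    by (simp add: B_aut_def B_mult)
  moreover have "inv_into B \<phi> (pconst c) = pconst c" for c
    using 1[OF B_pconst[of c]] assms by (simp add: B_aut_def)
  ultimately show ?thesis using bij_betw_inv_into[OF bij] by (simp add: B_aut_def)
qed

end

text \<open>The inverse is a parameter so that everything proved for \<open>\<phi>\<close> is also available for \<open>\<psi>\<close>.\<close>

locale danielewski_aut = danielewski m d k s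
  for m d :: nat and k :: "nat \<Rightarrow> nat" and s :: "nat \<Rightarrow> 'a::field_char_0 mpoly" +
  fixes \<phi> \<psi> :: "'a mpoly fract poly \<Rightarrow> 'a mpoly fract poly"
  assumes phi: "B_aut \<phi>" and psi: "B_aut \<psi>"
    and phi_psi: "\<And>f. f \<in> B \<Longrightarrow> \<phi> (\<psi> f) = f"
    and psi_phi: "\<And>f. f \<in> B \<Longrightarrow> \<psi> (\<phi> f) = f"
begin

lemma phi_B: "f \<in> B \<Longrightarrow> \<phi> f \<in> B"
  using phi by (auto simp: B_aut_def bij_betw_def)

lemma phi_add: "f \<in> B \<Longrightarrow> g \<in> B \<Longrightarrow> \<phi> (f + g) = \<phi> f + \<phi> g"
  and phi_mult: "f \<in> B \<Longrightarrow> g \<in> B \<Longrightarrow> \<phi> (f * g) = \<phi> f * \<phi> g"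
  and phi_pconst: "\<phi> (pconst c) = pconst c"
  using phi by (auto simp: B_aut_def)

lemma phi_zero: "\<phi> 0 = 0"
  using phi_pconst[of 0] by (simp add: pconst_def ring_map.hom_zero[OF rat_const_hom])

lemma phi_one: "\<phi> 1 = 1"
  using phi_pconst[of 1] unfolding ring_map.hom_one[OF pconst_hom] .

lemma phi_eq_0: "f \<in> B \<Longrightarrow> \<phi> f = 0 \<Longrightarrow> f = 0"
  by (metis phi_zero psi_phi B_zero)

lemma phi_power: "f \<in> B \<Longrightarrow> \<phi> (f ^ n) = \<phi> f ^ n"
  by (induction n) (auto simp: phi_one phi_mult B_power)

lemma phi_sum: "(\<And>x. x \<in> A \<Longrightarrow> f x \<in> B) \<Longrightarrow> \<phi> (sum f A) = (\<Sum>x\<in>A. \<phi> (f x))"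
  by (induction A rule: infinite_finite_induct) (simp_all add: phi_zero phi_add B_sum)

lemma phi_prod: "(\<And>x. x \<in> A \<Longrightarrow> f x \<in> B) \<Longrightarrow> \<phi> (prod f A) = (\<Prod>x\<in>A. \<phi> (f x))"
  by (induction A rule: infinite_finite_induct) (simp_all add: phi_one phi_mult B_prod)

end

sublocale danielewski_aut \<subseteq> inverse: danielewski_aut m d k s \<psi> \<phi>
  by unfold_locales (simp_all add: phi psi phi_psi psi_phi)

context danielewski_aut
begin

text \<open>Conjugation by an automorphism preserves local nilpotency.\<close>

lemma conjugate_LND: "B_LND (\<lambda>f. \<psi> (dz (\<phi> f)))"
proof -
  have "B_derivation (\<lambda>f. \<psi> (dz (\<phi> f)))"
    unfolding B_derivation_def
    by (simp add: phi_B phi_add phi_mult phi_pconst inverse.phi_B inverse.phi_add inverse.phi_mult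
        inverse.phi_pconst dz_closed dz_add dz_mult dz_pconst B_mult B_pconst psi_phi)
  moreover have "((\<lambda>f. \<psi> (dz (\<phi> f))) ^^ n) f = \<psi> ((dz ^^ n) (\<phi> f)) \<and> (dz ^^ n) (\<phi> f) \<in> B"
    if "f \<in> B" for f n
    by (induction n) (auto simp: that phi_B psi_phi phi_psi dz_closed)
  then have "((\<lambda>f. \<psi> (dz (\<phi> f))) ^^ Suc (degree (\<phi> f))) f = 0" if "f \<in> B" for f
    using that dz_nilpotent[of "\<phi> f"] inverse.phi_zero by metis
  ultimately show ?thesis unfolding B_LND_def by blast
qed

text \<open>\<open>\<psi> \<circ> dz \<circ> \<phi>\<close> kills \<open>y\<^sub>i\<close>, so \<open>\<phi> y\<^sub>i\<close> lies in the kernel of \<open>dz\<close>.\<close>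

lemma phi_y_degree: "i \<in> {1..m} \<Longrightarrow> degree (\<phi> (gen i)) = 0"
proof -
  assume i: "i \<in> {1..m}"
  then have g: "gen i \<in> B" by (intro B_gen) auto
  have "\<psi> (dz (\<phi> (gen i))) = 0" by (rule LND_annihilates_y[OF conjugate_LND i])
  then have "dz (\<phi> (gen i)) = 0" using inverse.phi_eq_0 phi_B dz_closed g by blast
  then show ?thesis by (simp add: dz_eq_0_iff)
qed

lemma phi_yring_degree:
  assumes "p \<in> mpolys {1..m}"
  shows "degree (\<phi> (iota p)) = 0"
proof -
  note sub = iota_y_B
  show ?thesis
    using assms
  proof (induction rule: mpolys_induct)
    case (Const a)
    then show ?case by (simp add: phi_pconst) (simp add: pconst_def)
  next
    case (Var i)
    then show ?case using phi_y_degree by simp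
  next
    case (add p q)
    then have "degree (\<phi> (iota p) + \<phi> (iota q)) \<le> 0" by (intro degree_add_le) auto
    then show ?case using add by (simp add: iota.hom_add phi_add sub)
  next
    case (mult p q)
    then have "degree (\<phi> (iota p) * \<phi> (iota q)) \<le> 0"
      using degree_mult_le[of "\<phi> (iota p)" "\<phi> (iota q)"] by simp
    then show ?case using mult by (simp add: iota.hom_mult phi_mult sub)
  qed
qed

text \<open>The action of \<open>\<phi>\<close> on \<open>K[y]\<close>, as a map of polynomials.\<close>

definition yact :: "'a mpoly \<Rightarrow> 'a mpoly" where
  "yact p = (SOME q. q \<in> mpolys {1..m} \<and> \<phi> (iota p) = iota q)"

lemma yact:
  assumes "p \<in> mpolys {1..m}"
  shows "yact p \<in> mpolys {1..m}" "iota (yact p) = \<phi> (iota p)"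
proof -
  have "\<exists>q. q \<in> mpolys {1..m} \<and> \<phi> (iota p) = iota q"
    using B_degree_0[OF phi_B[OF iota_y_B[OF assms]] phi_yring_degree[OF assms]] by blast
  then show "yact p \<in> mpolys {1..m}" "iota (yact p) = \<phi> (iota p)"
    unfolding yact_def by (rule someI2_ex; simp)+
qed

lemma yact_eqI: "p \<in> mpolys {1..m} \<Longrightarrow> q \<in> mpolys {1..m} \<Longrightarrow> \<phi> (iota p) = iota q \<Longrightarrow> yact p = q"
  by (rule iota_y_inj[OF yact(1)]) (simp_all add: yact(2) del: One_nat_def)

lemma yact_mult: "p \<in> mpolys {1..m} \<Longrightarrow> q \<in> mpolys {1..m} \<Longrightarrow> yact (p * q) = yact p * yact q"
  by (intro yact_eqI mult_in_mpolys yact) (simp_all add: iota.hom_mult yact phi_mult iota_y_B)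

lemma yact_Const: "yact (Const c) = Const c"
  by (intro yact_eqI) (simp_all add: phi_pconst)

lemma yact_power: "p \<in> mpolys {1..m} \<Longrightarrow> yact (p ^ n) = yact p ^ n"
  by (intro yact_eqI power_in_mpolys yact) (simp_all add: iota.hom_power yact phi_power iota_y_B)

lemma yact_prod: "(\<And>x. x \<in> A \<Longrightarrow> f x \<in> mpolys {1..m}) \<Longrightarrow> yact (prod f A) = (\<Prod>x\<in>A. yact (f x))"
  by (intro yact_eqI prod_in_mpolys yact) (simp_all add: iota.hom_prod yact phi_prod iota_y_B)

lemma yact_eq_0: "p \<in> mpolys {1..m} \<Longrightarrow> yact p = 0 \<Longrightarrow> p = 0"
  using yact(2)[of p] phi_eq_0[OF iota_y_B, of p] iota_y_inj[of p 0] by (simp add: iota.hom_zero)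

end

lemma coeff_linear_times:
  "coeff ([:a, b:] * q) (Suc n) = a * coeff q (Suc n) + b * coeff q n"
  by simp

lemma degree_linear_power: "degree ([:a, b:] ^ n) \<le> n"
proof -
  have "degree ([:a, b:] ^ n) \<le> degree [:a, b:] * n" by (rule degree_power_le)
  also have "\<dots> \<le> 1 * n" by (intro mult_le_mono1) auto
  finally show ?thesis by simp
qed

lemma coeff_linear_power_top:
  fixes a b :: "'b::comm_ring_1"
  shows "coeff ([:a, b:] ^ n) n = b ^ n"
proof (induction n)
  case (Suc n)
  have "coeff ([:a, b:] ^ n) (Suc n) = 0"
    using degree_linear_power[of a b n] by (intro coeff_eq_0) simp
  then show ?case using Suc by (simp only: power_Suc coeff_linear_times) simp
qed simp

lemma coeff_linear_power_second:
  fixes a b :: "'b::comm_ring_1"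
  shows "coeff ([:a, b:] ^ Suc n) n = of_nat (Suc n) * a * b ^ n"
proof (induction n)
  case (Suc n)
  have "coeff ([:a, b:] ^ Suc (Suc n)) (Suc n) =
      a * coeff ([:a, b:] ^ Suc n) (Suc n) + b * coeff ([:a, b:] ^ Suc n) n"
    by (simp only: power_Suc[of _ "Suc n"] coeff_linear_times)
  then show ?case unfolding coeff_linear_power_top Suc by (simp add: algebra_simps)
qed simp

lemma single_exp_eqD:
  assumes "single e a = single e' b" "a \<noteq> 0"
  shows "e = e'"
proof -
  have "lookup (single e' b) e = a" using assms(1) by (metis lookup_single_eq)
  then show ?thesis using assms(2) by (auto simp: lookup_single when_def split: if_splits)
qed

lemma Fract_1_eq_iff [simp]: "Fract (p :: 'a::idom) 1 = Fract q 1 \<longleftrightarrow> p = q"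
  by (simp add: eq_fract)

context danielewski
begin

text \<open>Both sides are derivations with the same values at the \<open>y\<^sub>i\<close> and \<open>z\<close>; the value at \<open>x\<close> follows from
  \<open>x M = P\<close>.\<close>

lemma derivation_formula:
  assumes D: "B_derivation D" and y: "\<And>i. i \<in> {1..m} \<Longrightarrow> D (gen i) = 0" and f: "f \<in> B"
  shows "D f = D (gen (m + 1)) * pderiv f"
proof -
  let ?h = "D (gen (m + 1))"
  have const: "D (pconst c) = ?h * pderiv (pconst c)" for c
    using B_derivation_const[OF D] by (simp add: pconst_def)
  note sub = iota_yz_B
  have 1: "D (iota p) = ?h * pderiv (iota p)" if "p \<in> mpolys {1..m + 1}" for p
    using that
  proof (induction rule: mpolys_induct)
    case (Const a)
    then show ?case by (simp only: iota_Const const)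
  next
    case (Var i)
    show ?case
    proof (cases "i = m + 1")
      case True
      then show ?thesis by (simp add: gen_z pderiv_pCons)
    next
      case False
      then have i: "i \<in> {1..m}" using Var by auto
      then show ?thesis using y[OF i] by (simp add: gen_y)
    qed
  next
    case (add p q)
    then show ?case by (simp add: iota.hom_add B_derivation_simps(2)[OF D] sub pderiv_add algebra_simps)
  next
    case (mult p q)
    then show ?case by (simp add: iota.hom_mult B_derivation_simps(4)[OF D] sub pderiv_mult algebra_simps)
  qed
  have "iota M \<in> B" by (intro iota_in_B M_in')
  moreover have "M \<in> mpolys {1..m + 1}" by (rule mpolys_mono[OF _ M_in]) auto
  then have DM: "D (iota M) = 0" using 1[of M] by (simp add: iota_M)
  moreover have "D (iota P) = ?h * pderiv (iota P)" by (rule 1[OF P_in])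
  ultimately have "D (gen 0) * iota M = ?h * pderiv (gen 0 * iota M)"
    using B_derivation_simps(4)[OF D B_gen[of 0], of "iota M"] by (simp add: x_times_M)
  also have "pderiv (gen 0 * iota M) = pderiv (gen 0) * iota M"
    by (simp add: iota_M pderiv_smult)
  finally have x: "D (gen 0) = ?h * pderiv (gen 0)"
    using iota_M_nonzero by (metis mult.assoc mult_right_cancel)
  have "D (iota p) = ?h * pderiv (iota p)" if "p \<in> mpolys {..<m + 2}" for p
    using that
  proof (induction rule: mpolys_induct)
    case (Const a)
    then show ?case by (simp only: iota_Const const)
  next
    case (Var i)
    show ?case
    proof (cases "i = 0")
      case True
      then show ?thesis using x by simp
    next
      case False
      then have "(Var i :: 'a mpoly) \<in> mpolys {1..m + 1}" using Var by auto
      then show ?thesis by (rule 1)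
    qed
  next
    case (add p q)
    then show ?case
      by (simp only: iota.hom_add B_derivation_simps(2)[OF D] iota_in_B pderiv_add distrib_left)
  next
    case (mult p q)
    then show ?case
      by (simp only: iota.hom_mult B_derivation_simps(4)[OF D] iota_in_B pderiv_mult) (simp only: algebra_simps)
  qed
  then show ?thesis using f by (auto simp: B_def)
qed

end

context danielewski_aut
begin

text \<open>The derivation \<open>\<phi> \<circ> dz \<circ> \<psi>\<close> is a multiple of \<open>d/dz\<close> and sends \<open>\<phi> z\<close> to \<open>\<phi> M\<close>, a nonzero element of degree 0.\<close>

lemma phi_z_degree: "degree (\<phi> (gen (m + 1))) = 1"
proof -
  let ?z = "gen (m + 1)"
  have z: "?z \<in> B" by (intro B_gen) simp
  define D where "D f = \<phi> (dz (\<psi> f))" for f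
  have LND: "B_LND D" unfolding D_def by (rule inverse.conjugate_LND)
  then have der: "B_derivation D" by (simp add: B_LND_def)
  have "D (\<phi> ?z) = D ?z * pderiv (\<phi> ?z)"
    by (rule derivation_formula[OF der _ phi_B[OF z]]) (rule LND_annihilates_y[OF LND])
  moreover have "D (\<phi> ?z) = iota (yact M)"
    using psi_phi[OF z] dz_z by (simp only: D_def yact(2)[OF M_in])
  ultimately have eq: "D ?z * pderiv (\<phi> ?z) = iota (yact M)" by simp
  have "yact M \<noteq> 0" using yact_eq_0[OF M_in] M_nonzero by blast
  then have "iota (yact M) \<noteq> 0" by (simp add: iota_y[OF yact(1)[OF M_in]] lex.Fract_eq_0_iff)
  then have nz: "D ?z \<noteq> 0" "pderiv (\<phi> ?z) \<noteq> 0" unfolding eq[symmetric] by auto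
  have "degree (D ?z) + degree (pderiv (\<phi> ?z)) = 0"
    using degree_mult_eq[OF nz] unfolding eq by (simp add: iota_y[OF yact(1)[OF M_in]])
  then have "degree (\<phi> ?z) - 1 = 0" by (simp add: degree_pderiv)
  moreover have "degree (\<phi> ?z) \<noteq> 0" using nz(2) pderiv_eq_0_iff by blast
  ultimately show ?thesis by simp
qed

lemma phi_z_linear:
  "\<exists>a\<in>mpolys {1..m}. \<exists>b\<in>mpolys {1..m}. \<phi> (gen (m + 1)) = iota a * gen (m + 1) + iota b"
proof -
  let ?z = "gen (m + 1)"
  have z: "?z \<in> B" by (intro B_gen) simp
  obtain p where p: "p \<in> mpolys {1..m + 1}" "\<phi> ?z = iota p"
    using B_degree_less[OF phi_B[OF z]] phi_z_degree d2 by auto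
  obtain b where b: "b \<in> mpolys {1..m}" "coeff (\<phi> ?z) 0 = Fract b 1"
    using coeff_in_yring[OF p(1), of 0] p(2) by (auto simp: yring_def)
  obtain a where a: "a \<in> mpolys {1..m}" "coeff (\<phi> ?z) 1 = Fract a 1"
    using coeff_in_yring[OF p(1), of 1] p(2) by (auto simp: yring_def)
  have "\<phi> ?z = [:coeff (\<phi> ?z) 0, coeff (\<phi> ?z) 1:]"
    using phi_z_degree by (intro poly_eqI) (auto simp: coeff_pCons coeff_eq_0 split: nat.split)
  then have "\<phi> ?z = [:Fract b 1, Fract a 1:]" unfolding a(2) b(2) .
  moreover have "iota a * gen (m + 1) + iota b = [:Fract b 1, Fract a 1:]"
    by (simp add: iota_y[OF a(1)] iota_y[OF b(1)] gen_z)
  ultimately show ?thesis using a(1) b(1) by metis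
qed

end

context danielewski_aut
begin

text \<open>The leading coefficients of \<open>\<phi> z\<close> and \<open>\<psi> z\<close> are inverse to each other up to the action on \<open>K[y]\<close>, so they
  are units.\<close>

lemma phi_z:
  "\<exists>t b. t \<noteq> 0 \<and> b \<in> mpolys {1..m} \<and> \<phi> (gen (m + 1)) = pconst t * gen (m + 1) + iota b"
proof -
  let ?z = "gen (m + 1)"
  have z: "?z \<in> B" by (intro B_gen) simp
  obtain a b where a: "a \<in> mpolys {1..m}" "b \<in> mpolys {1..m}" "\<phi> ?z = iota a * ?z + iota b"
    using phi_z_linear by blast
  obtain a' b' where a': "a' \<in> mpolys {1..m}" "b' \<in> mpolys {1..m}" "\<psi> ?z = iota a' * ?z + iota b'"
    using inverse.phi_z_linear by blast
  have "?z = \<phi> (\<psi> ?z)" using phi_psi[OF z] by simp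
  also have "\<dots> = iota (yact a') * (iota a * ?z + iota b) + iota (yact b')"
    by (simp only: a'(3) phi_add phi_mult B_mult iota_y_B[OF a'(1)] iota_y_B[OF a'(2)] z
        yact(2)[OF a'(1)] yact(2)[OF a'(2)] a(3))
  finally have "Fract (a * yact a') 1 = (1 :: 'a mpoly fract)"
    by (simp add: iota_y[OF yact(1)[OF a'(1)]] iota_y[OF yact(1)[OF a'(2)]] iota_y[OF a(1)] iota_y[OF a(2)] gen_z)
  then have "a * yact a' = 1" by (simp add: One_fract_def)
  then obtain t where "t \<noteq> 0" "a = Const t" using mpoly_unit_Const by blast
  then show ?thesis using a by (metis iota_Const)
qed

lemma phi_P:
  assumes t: "t \<noteq> 0" "b \<in> mpolys {1..m}" "\<phi> (gen (m + 1)) = pconst t * gen (m + 1) + iota b"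
  shows "coeff (\<phi> (iota P)) d = rat_const (t ^ d)"
    "coeff (\<phi> (iota P)) (d - 1) = of_nat d * Fract b 1 * rat_const (t ^ (d - 1))"
    "degree (\<phi> (iota P)) \<le> d"
proof -
  let ?L = "[:Fract b 1, rat_const t:]"
  have z: "gen (m + 1) \<in> B" by (intro B_gen) simp
  have L: "\<phi> (gen (m + 1)) = ?L" unfolding t(3) by (simp add: pconst_def gen_z iota_y[OF t(2)])
  define S where "S = (\<Sum>j<d. smult (Fract (yact (s j)) 1) (?L ^ j))"
  have sB: "iota (s j) \<in> B" if "j < d" for j by (rule iota_y_B[OF s_in[OF that]])
  have "iota P = gen (m + 1) ^ d + (\<Sum>j<d. iota (s j) * gen (m + 1) ^ j)"
    by (simp add: dan_poly_def iota.hom_add iota.hom_sum iota.hom_mult iota.hom_power)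
  then have "\<phi> (iota P) = ?L ^ d + (\<Sum>j<d. \<phi> (iota (s j)) * ?L ^ j)"
  proof -
    assume eq: "iota P = gen (m + 1) ^ d + (\<Sum>j<d. iota (s j) * gen (m + 1) ^ j)"
    have *: "iota (s j) * gen (m + 1) ^ j \<in> B" if "j \<in> {..<d}" for j
      using sB that z by (intro B_mult B_power) auto
    have "\<phi> (iota P) = \<phi> (gen (m + 1) ^ d) + \<phi> (\<Sum>j<d. iota (s j) * gen (m + 1) ^ j)"
      unfolding eq by (intro phi_add B_power z B_sum *)
    also have "\<phi> (\<Sum>j<d. iota (s j) * gen (m + 1) ^ j) = (\<Sum>j<d. \<phi> (iota (s j) * gen (m + 1) ^ j))"
      by (rule phi_sum) (rule *)
    also have "\<dots> = (\<Sum>j<d. \<phi> (iota (s j)) * ?L ^ j)"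
      using sB z by (intro sum.cong refl) (simp add: phi_mult B_power phi_power L[unfolded Suc_eq_plus1[symmetric]])
    finally show ?thesis by (simp only: phi_power[OF z] L)
  qed
  also have "(\<Sum>j<d. \<phi> (iota (s j)) * ?L ^ j) = S"
    unfolding S_def
  proof (intro sum.cong refl)
    fix j assume "j \<in> {..<d}"
    then have "s j \<in> mpolys {1..m}" by (intro s_in) simp
    then have "\<phi> (iota (s j)) = [:Fract (yact (s j)) 1:]" using yact iota_y by metis
    then show "\<phi> (iota (s j)) * ?L ^ j = smult (Fract (yact (s j)) 1) (?L ^ j)" by simp
  qed
  finally have eq: "\<phi> (iota P) = ?L ^ d + S" .
  have degS: "degree (smult c (?L ^ j)) \<le> j" for c j
    using degree_smult_le[of c "?L ^ j"] degree_linear_power[of "Fract b 1" "rat_const t" j] by linarith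
  have Sd: "coeff S n = 0" if "n \<ge> d" for n
    unfolding S_def coeff_sum
  proof (rule sum.neutral, intro ballI)
    fix j assume "j \<in> {..<d}"
    then show "coeff (smult (Fract (yact (s j)) 1) (?L ^ j)) n = 0"
      using degS[of "Fract (yact (s j)) 1" j] that by (intro coeff_eq_0) simp
  qed
  have "yact (s (d - 1)) = 0"
    using yact_Const[of 0] s_top by (simp add: ring_map.hom_zero[OF Const_hom])
  then have Sd1: "coeff S (d - 1) = 0"
    unfolding S_def coeff_sum
  proof (intro sum.neutral ballI)
    fix j assume j: "j \<in> {..<d}" and s0: "yact (s (d - 1)) = 0"
    show "coeff (smult (Fract (yact (s j)) 1) (?L ^ j)) (d - 1) = 0"
    proof (cases "j = d - 1")
      case True
      then show ?thesis using s0 by (simp add: fract_collapse)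
    next
      case False
      then show ?thesis using j degS[of "Fract (yact (s j)) 1" j] by (intro coeff_eq_0) auto
    qed
  qed
  show "coeff (\<phi> (iota P)) d = rat_const (t ^ d)"
    unfolding eq coeff_add coeff_linear_power_top
    by (simp add: Sd ring_map.hom_power[OF rat_const_hom])
  obtain n where n: "d = Suc n" using d2 by (cases d) auto
  show "coeff (\<phi> (iota P)) (d - 1) = of_nat d * Fract b 1 * rat_const (t ^ (d - 1))"
    unfolding eq coeff_add Sd1 using coeff_linear_power_second[of "Fract b 1" "rat_const t" n]
    by (simp add: n ring_map.hom_power[OF rat_const_hom])
  have "degree S \<le> d" by (rule degree_le) (simp add: Sd)
  then show "degree (\<phi> (iota P)) \<le> d"
    unfolding eq by (intro degree_add_le degree_linear_power)
qed

lemma phi_x_coeff: "coeff (\<phi> (gen 0)) n * Fract (yact M) 1 = coeff (\<phi> (iota P)) n"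
proof -
  have MB: "iota M \<in> B" by (intro iota_in_B M_in')
  have "\<phi> (iota P) = \<phi> (gen 0 * iota M)" by (simp only: x_times_M)
  also have "\<dots> = \<phi> (gen 0) * iota (yact M)"
    using MB B_gen[of 0] by (simp add: phi_mult yact(2)[OF M_in])
  finally have "\<phi> (iota P) = \<phi> (gen 0) * iota (yact M)" .
  then show ?thesis by (simp add: iota_y[OF yact(1)[OF M_in]] mult.commute)
qed

lemma yact_M_nonzero: "yact M \<noteq> 0"
  using yact_eq_0[OF M_in] M_nonzero by blast

lemma phi_x_degree: "degree (\<phi> (gen 0)) \<le> d"
proof (rule degree_le, intro allI impI)
  fix n assume n: "d < n"
  obtain t b where "t \<noteq> 0" "b \<in> mpolys {1..m}" "\<phi> (gen (m + 1)) = pconst t * gen (m + 1) + iota b"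
    using phi_z by blast
  then have "degree (\<phi> (iota P)) < n" using phi_P(3) n le_less_trans by blast
  then have "coeff (\<phi> (gen 0)) n * Fract (yact M) 1 = 0" unfolding phi_x_coeff by (rule coeff_eq_0)
  then show "coeff (\<phi> (gen 0)) n = 0" using yact_M_nonzero by (simp add: lex.Fract_eq_0_iff)
qed

text \<open>Compare the coefficients of \<open>z\<^sup>d\<close> in \<open>\<phi> x \<cdot> \<phi> M = \<phi> P\<close>; that of \<open>\<phi> x\<close> becomes a
  polynomial when multiplied by \<open>M\<close>.\<close>

lemma yact_M_dvd: "\<exists>q\<in>mpolys {1..m}. M = yact M * q"
proof -
  obtain t b where t: "t \<noteq> 0" "b \<in> mpolys {1..m}" "\<phi> (gen (m + 1)) = pconst t * gen (m + 1) + iota b"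
    using phi_z by blast
  have xB: "\<phi> (gen 0) \<in> B" by (intro phi_B B_gen) simp
  obtain \<alpha> where \<alpha>: "\<alpha> \<in> mpolys {1..m}" "Fract M 1 * coeff (\<phi> (gen 0)) d = Fract \<alpha> 1"
    using B_degree_d(1)[OF xB phi_x_degree] by (auto simp: yring_def)
  have "Fract M 1 * coeff (\<phi> (gen 0)) d * Fract (yact M) 1 = Fract M 1 * rat_const (t ^ d)"
    by (simp only: mult.assoc phi_x_coeff phi_P(1)[OF t])
  then have *: "\<alpha> * yact M = M * Const (t ^ d)" unfolding \<alpha>(2) by (simp add: rat_const_def)
  have "Const (t ^ d) * Const (inverse (t ^ d)) = (1 :: 'a mpoly)"
    using t(1) ring_map.hom_mult[OF Const_hom, of "t ^ d" "inverse (t ^ d)"]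
    by (simp add: ring_map.hom_one[OF Const_hom])
  then have "M = M * Const (t ^ d) * Const (inverse (t ^ d))" by (simp only: mult.assoc mult_1_right)
  then have "M = yact M * (\<alpha> * Const (inverse (t ^ d)))"
    unfolding *[symmetric] by (simp only: mult_ac)
  moreover have "\<alpha> * Const (inverse (t ^ d)) \<in> mpolys {1..m}" using \<alpha>(1) by (intro mult_in_mpolys) simp_all
  ultimately show ?thesis by blast
qed

lemma yact_inverse: "p \<in> mpolys {1..m} \<Longrightarrow> yact (inverse.yact p) = p"
  by (rule yact_eqI[OF inverse.yact(1)]) (simp_all add: inverse.yact(2) phi_psi iota_y_B del: One_nat_def)

end

context danielewski_aut
begin

text \<open>The images of \<open>M\<close> under \<open>\<phi>\<close> and under \<open>\<psi>\<close> both divide \<open>M\<close>.\<close>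

lemma yact_M: "\<exists>c. c \<noteq> 0 \<and> yact M = Const c * M"
proof -
  obtain q where q: "q \<in> mpolys {1..m}" "M = yact M * q" using yact_M_dvd by blast
  obtain q' where q': "q' \<in> mpolys {1..m}" "M = inverse.yact M * q'" using inverse.yact_M_dvd by blast
  have "yact M = yact (inverse.yact M * q')" using q'(2) by simp
  also have "\<dots> = M * yact q'"
    by (simp only: yact_mult[OF inverse.yact(1)[OF M_in] q'(1)] yact_inverse[OF M_in])
  finally have *: "yact M = M * yact q'" .
  then have "M * (yact q' * q) = M * 1" using q(2) by (simp add: mult.assoc)
  then have "yact q' * q = 1" using M_nonzero mult_left_cancel by blast
  then obtain c where "c \<noteq> 0" "yact q' = Const c" using mpoly_unit_Const by blast
  then show ?thesis using * by (metis mult.commute)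
qed

text \<open>The coefficient of \<open>z\<^bsup>d - 1\<^esup>\<close> in \<open>\<phi> P\<close> is \<open>d t\<^bsup>d - 1\<^esup> b\<close>, and in \<open>\<phi> x \<cdot> \<phi> M\<close> it is divisible by \<open>M\<close>.\<close>

lemma phi_z_shift:
  "\<exists>t r. t \<noteq> 0 \<and> r \<in> mpolys {1..m} \<and> \<phi> (gen (m + 1)) = pconst t * gen (m + 1) + iota (M * r)"
proof -
  obtain t b where t: "t \<noteq> 0" "b \<in> mpolys {1..m}" "\<phi> (gen (m + 1)) = pconst t * gen (m + 1) + iota b"
    using phi_z by blast
  obtain c where c: "c \<noteq> 0" "yact M = Const c * M" using yact_M by blast
  have xB: "\<phi> (gen 0) \<in> B" by (intro phi_B B_gen) simp
  obtain g where g: "g \<in> mpolys {1..m}" "coeff (\<phi> (gen 0)) (d - 1) = Fract g 1"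
    using B_degree_d(2)[OF xB phi_x_degree] by (auto simp: yring_def)
  define u where "u = of_nat d * t ^ (d - 1)"
  have u: "u \<noteq> 0" using t(1) d2 by (simp add: u_def)
  have "of_nat d = rat_const (of_nat d :: 'a)" by (simp add: ring_map.hom_of_nat[OF rat_const_hom])
  then have "Fract g 1 * Fract (Const c * M) 1 = Fract b 1 * rat_const u"
    using phi_x_coeff[of "d - 1"] phi_P(2)[OF t] g(2) c(2)
    by (simp add: u_def ring_map.hom_mult[OF rat_const_hom] mult_ac)
  then have eq: "g * (Const c * M) = b * Const u" by (simp add: rat_const_def)
  have uu: "Const u * Const (inverse u) = (1 :: 'a mpoly)"
    using u ring_map.hom_mult[OF Const_hom, of u "inverse u"]
    by (simp add: ring_map.hom_one[OF Const_hom])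
  have "b = b * (Const u * Const (inverse u))" by (simp only: uu mult_1_right)
  also have "\<dots> = M * (g * Const c * Const (inverse u))"
    by (simp only: mult.assoc[symmetric] eq[symmetric]) (simp only: mult_ac)
  finally have "b = M * (g * Const c * Const (inverse u))" .
  moreover have "g * Const c * Const (inverse u) \<in> mpolys {1..m}" using g(1) by (intro mult_in_mpolys) simp_all
  ultimately show ?thesis using t by metis
qed

text \<open>The image of \<open>y\<^sub>i\<close> divides the image of \<open>M\<close>, which is a monomial.\<close>

lemma yact_y_monomial:
  assumes i: "i \<in> {1..m}"
  shows "\<exists>e a. a \<noteq> 0 \<and> e \<noteq> 0 \<and> keys e \<subseteq> {1..m} \<and> yact (Var i) = single e a"
proof -
  have Vi: "(Var i :: 'a mpoly) \<in> mpolys {1..m}" using i by simp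
  obtain c where c: "c \<noteq> 0" "yact M = Const c * M" using yact_M by blast
  have "Const c * M = single kexp c"
    by (simp add: M_single Const_def mult_single)
  moreover have "yact M = yact (Var i) * (yact (Var i) ^ (k i - 1) * (\<Prod>j\<in>{1..m} - {i}. yact (Var j) ^ k j))"
  proof -
    have "yact M = (\<Prod>j=1..m. yact (Var j ^ k j))"
      unfolding dan_monom_def by (rule yact_prod) (auto intro: power_in_mpolys)
    also have "\<dots> = (\<Prod>j=1..m. yact (Var j) ^ k j)"
      by (rule prod.cong) (simp_all add: yact_power)
    also have "\<dots> = yact (Var i) ^ k i * (\<Prod>j\<in>{1..m} - {i}. yact (Var j) ^ k j)"
      using i by (simp add: prod.remove)
    also have "yact (Var i) ^ k i = yact (Var i) * yact (Var i) ^ (k i - 1)"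
      using k2[OF i] by (cases "k i") auto
    finally show ?thesis by (simp add: mult.assoc)
  qed
  ultimately obtain e a where ea: "a \<noteq> 0" "yact (Var i) = single e a"
    using monomial_factor[OF _ c(1)] c(2) by (metis (no_types))
  have "e \<noteq> 0"
  proof
    assume "e = 0"
    then have "yact (Var i) = Const a" using ea by (simp add: Const_def)
    then have "\<phi> (gen i) = pconst a" using yact(2)[OF Vi] by simp
    then have "\<psi> (\<phi> (gen i)) = pconst a" by (simp only: inverse.phi_pconst)
    then have "gen i = pconst a" using psi_phi[OF B_gen[of i]] i by simp
    then have "iota (Var i) = iota (Const a)" by simp
    then have "Var i = Const a" by (rule iota_y_inj[OF Vi Const_in_mpolys])
    then have "lookup (Var i) (single i 1) = lookup (Const a) (single i 1)"
      by simp
    then show False by (simp add: Var_def Const_def lookup_single when_def split: if_splits)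
  qed
  moreover have "keys e \<subseteq> {1..m}"
    using yact(1)[OF Vi] ea by (auto simp: mpolys_def)
  ultimately show ?thesis using ea by blast
qed

lemma yact_single:
  assumes "keys e \<subseteq> {1..m}" and f: "\<And>j. j \<in> {1..m} \<Longrightarrow> yact (Var j) = single (f j) (g j)"
  shows "yact (single e a) =
    single (\<Sum>j=1..m. \<Sum>_<lookup e j. f j) (a * (\<Prod>j=1..m. g j ^ lookup e j))"
proof -
  have single_power: "single x c ^ n = single (\<Sum>_<n. x) (c ^ n)"
    for x :: "nat \<Rightarrow>\<^sub>0 nat" and c :: 'a and n
    by (induction n) (auto simp: mult_single add.commute simp del: sum_constant)
  have single_prod: "(\<Prod>j\<in>S. single (x j) (c j)) = single (sum x S) (prod c S)"
    if "finite S" for x :: "nat \<Rightarrow> nat \<Rightarrow>\<^sub>0 nat" and c :: "nat \<Rightarrow> 'a" and S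
    using that by (induction S) (auto simp: mult_single)
  have "single e a = Const a * (\<Prod>j=1..m. Var j ^ lookup e j)"
    unfolding single_eq_Const_mult by (subst monom_value_superset[OF _ assms(1)]) simp_all
  then have "yact (single e a) = Const a * (\<Prod>j=1..m. yact (Var j) ^ lookup e j)"
  proof -
    assume eq: "single e a = Const a * (\<Prod>j=1..m. Var j ^ lookup e j)"
    have *: "Var j ^ lookup e j \<in> mpolys {1..m}" if "j \<in> {1..m}" for j
      using that by (intro power_in_mpolys) simp
    have "yact (single e a) = yact (Const a) * yact (\<Prod>j=1..m. Var j ^ lookup e j)"
      unfolding eq by (intro yact_mult prod_in_mpolys * Const_in_mpolys)
    also have "yact (\<Prod>j=1..m. Var j ^ lookup e j) = (\<Prod>j=1..m. yact (Var j ^ lookup e j))"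
      by (rule yact_prod) (rule *)
    also have "\<dots> = (\<Prod>j=1..m. yact (Var j) ^ lookup e j)"
      by (rule prod.cong) (simp_all add: yact_power)
    finally show ?thesis by (simp only: yact_Const)
  qed
  also have "\<dots> = Const a * (\<Prod>j=1..m. single (f j) (g j) ^ lookup e j)"
    by (simp add: f)
  also have "\<dots> = single (\<Sum>j=1..m. \<Sum>_<lookup e j. f j) (a * (\<Prod>j=1..m. g j ^ lookup e j))"
    by (simp add: single_power single_prod Const_def mult_single)
  finally show ?thesis .
qed

end

context danielewski_aut
begin

text \<open>Writing \<open>y\<^sub>i\<close> as the image under \<open>\<psi>\<close> of the monomial \<open>\<phi> y\<^sub>i\<close> makes it a product of nonconstant monomials, one for each
  factor of \<open>\<phi> y\<^sub>i\<close>; comparing total degrees, there is just one factor.\<close>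

lemma yact_y:
  assumes i: "i \<in> {1..m}"
  shows "\<exists>j a. j \<in> {1..m} \<and> a \<noteq> 0 \<and> yact (Var i) = Const a * Var j"
proof -
  have Vi: "(Var i :: 'a mpoly) \<in> mpolys {1..m}" using i by simp
  obtain e a where e: "a \<noteq> 0" "keys e \<subseteq> {1..m}" "yact (Var i) = single e a"
    using yact_y_monomial[OF i] by blast
  have "\<forall>j\<in>{1..m}. \<exists>f g. f \<noteq> 0 \<and> keys f \<subseteq> {1..m} \<and> inverse.yact (Var j) = single f g"
    using inverse.yact_y_monomial by blast
  then obtain f g where fg: "\<And>j. j \<in> {1..m} \<Longrightarrow> f j \<noteq> 0" "\<And>j. j \<in> {1..m} \<Longrightarrow> keys (f j) \<subseteq> {1..m}"
    "\<And>j. j \<in> {1..m} \<Longrightarrow> inverse.yact (Var j) = single (f j) (g j)"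
    by metis
  define total where "total x = (\<Sum>l=1..m. lookup x l)" for x :: "nat \<Rightarrow>\<^sub>0 nat"
  have total_pos: "total x \<ge> 1" if x: "x \<noteq> 0" "keys x \<subseteq> {1..m}" for x
  proof -
    obtain l where "l \<in> keys x" using x(1) by (metis keys_eq_empty ex_in_conv)
    then have "l \<in> {1..m}" "lookup x l \<noteq> 0" using x(2) by (blast, simp add: in_keys_iff)
    then have "0 < lookup x l" "lookup x l \<le> total x"
      unfolding total_def by (auto intro: member_le_sum)
    then show ?thesis by linarith
  qed
  have total_sum: "total (\<Sum>j\<in>S. x j) = (\<Sum>j\<in>S. total (x j))" for S :: "nat set" and x
    unfolding total_def lookup_sum by (rule sum.swap)
  have "Var i = inverse.yact (yact (Var i))" by (rule inverse.yact_inverse[OF Vi, symmetric])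
  also have "\<dots> = single (\<Sum>j=1..m. \<Sum>_<lookup e j. f j)
      (a * (\<Prod>j=1..m. g j ^ lookup e j))"
    unfolding e(3) by (rule inverse.yact_single[OF e(2) fg(3)])
  finally have "single (single i 1) (1::'a) =
      single (\<Sum>j=1..m. \<Sum>_<lookup e j. f j) (a * (\<Prod>j=1..m. g j ^ lookup e j))"
    by (simp only: Var_def)
  then have "single i 1 = (\<Sum>j=1..m. \<Sum>_<lookup e j. f j)"
    by (rule single_exp_eqD) simp
  then have "total (single i 1) = (\<Sum>j=1..m. lookup e j * total (f j))"
    by (simp only: total_sum) simp
  moreover have "total (single i 1) = 1"
    using i by (simp add: total_def lookup_single when_def)
  ultimately have "(\<Sum>j=1..m. lookup e j * total (f j)) = Suc 0" by simp
  then obtain j where j: "j \<in> {1..m}" "lookup e j * total (f j) = Suc 0"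
    "\<forall>l\<in>{1..m}. j \<noteq> l \<longrightarrow> lookup e l * total (f l) = 0"
    using sum_eq_Suc0_iff[of "{1..m}"] by auto
  have ej: "lookup e j = 1" using j(2) by simp
  have el: "lookup e l = 0" if "l \<noteq> j" for l
  proof (cases "l \<in> {1..m}")
    case True
    then have "total (f l) \<ge> 1" by (intro total_pos fg)
    then show ?thesis using j(3) True that by auto
  next
    case False
    then have "l \<notin> keys e" using e(2) by blast
    then show ?thesis by (simp add: in_keys_iff)
  qed
  have "e = single j 1"
    by (rule poly_mapping_eqI) (use ej el in \<open>auto simp: lookup_single when_def\<close>)
  then have "yact (Var i) = Const a * Var j" unfolding e(3) by (simp add: Const_def Var_def mult_single)
  then show ?thesis using j(1) e(1) by blast
qed

theorem automorphism_shape: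
  "\<exists>\<sigma> t r. \<sigma> permutes {1..m} \<and> (\<Prod>i=1..m. Var (\<sigma> i) ^ k i) = M \<and>
     (\<forall>i\<in>{1..m + 1}. t i \<noteq> 0) \<and> r \<in> mpolys {1..m} \<and>
     (\<forall>i\<in>{1..m}. \<phi> (gen i) = pconst (t i) * gen (\<sigma> i)) \<and>
     \<phi> (gen (m + 1)) = pconst (t (m + 1)) * gen (m + 1) + iota (M * r)"
proof -
  obtain t0 r where r: "t0 \<noteq> 0" "r \<in> mpolys {1..m}" "\<phi> (gen (m + 1)) = pconst t0 * gen (m + 1) + iota (M * r)"
    using phi_z_shift by blast
  have "\<forall>i\<in>{1..m}. \<exists>j a. j \<in> {1..m} \<and> a \<noteq> 0 \<and> yact (Var i) = Const a * Var j" using yact_y by blast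
  then obtain f a where fa: "\<And>i. i \<in> {1..m} \<Longrightarrow> f i \<in> {1..m}" "\<And>i. i \<in> {1..m} \<Longrightarrow> a i \<noteq> 0"
    "\<And>i. i \<in> {1..m} \<Longrightarrow> yact (Var i) = Const (a i) * Var (f i)" by metis
  define \<sigma> where "\<sigma> i = (if i \<in> {1..m} then f i else i)" for i
  define t where "t i = (if i \<in> {1..m} then a i else t0)" for i
  have inj: "inj_on f {1..m}"
  proof (rule inj_onI)
    fix i j assume ij: "i \<in> {1..m}" "j \<in> {1..m}" "f i = f j"
    have "yact (Const (a j) * Var i) = yact (Const (a i) * Var j)"
      using ij fa(3)[of i] fa(3)[of j] by (simp add: yact_mult yact_Const mult_ac)
    then have "inverse.yact (yact (Const (a j) * Var i)) = inverse.yact (yact (Const (a i) * Var j))"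
      by (simp only:)
    moreover have "Const (a j) * Var i \<in> mpolys {1..m}" "Const (a i) * Var j \<in> mpolys {1..m}"
      using ij by (auto intro!: mult_in_mpolys)
    ultimately have "Const (a j) * Var i = Const (a i) * Var j"
      by (simp only: inverse.yact_inverse)
    then have "single (single i (1::nat)) (a j) = single (single j 1) (a i)"
      by (simp add: Const_def Var_def mult_single del: One_nat_def)
    then have "single i (1::nat) = single j 1"
      using fa(2)[OF ij(2)] by (rule single_exp_eqD)
    then show "i = j" by (rule single_exp_eqD) simp
  qed
  have "f ` {1..m} = {1..m}"
    by (rule endo_inj_surj) (use fa(1) inj in blast)+
  then have "bij_betw \<sigma> {1..m} {1..m}"
    using inj by (subst bij_betw_cong[of _ \<sigma> f]) (simp_all add: bij_betw_def \<sigma>_def)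
  then have \<sigma>: "\<sigma> permutes {1..m}" by (rule bij_imp_permutes) (auto simp: \<sigma>_def)
  obtain c where c: "c \<noteq> 0" "yact M = Const c * M" using yact_M by blast
  have "yact M = (\<Prod>j=1..m. yact (Var j) ^ k j)"
  proof -
    have "yact M = (\<Prod>j=1..m. yact (Var j ^ k j))"
      unfolding dan_monom_def by (rule yact_prod) (auto intro: power_in_mpolys)
    then show ?thesis by (simp add: yact_power)
  qed
  also have "\<dots> = (\<Prod>j=1..m. Const (a j) ^ k j) * (\<Prod>j=1..m. Var (\<sigma> j) ^ k j)"
    unfolding prod.distrib[symmetric] by (rule prod.cong) (auto simp: fa(3) \<sigma>_def power_mult_distrib)
  also have "(\<Prod>j=1..m. Const (a j) ^ k j) = Const (\<Prod>j=1..m. a j ^ k j)"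
    by (simp add: ring_map.hom_prod[OF Const_hom] ring_map.hom_power[OF Const_hom])
  also have "(\<Prod>j=1..m. Var (\<sigma> j) ^ k j) = single (\<Sum>j=1..m. single (\<sigma> j) (k j)) (1::'a)"
  proof -
    have "(\<Prod>i\<in>S. Var (\<sigma> i) ^ k i) = single (\<Sum>i\<in>S. single (\<sigma> i) (k i)) (1::'a)"
      if "finite S" for S :: "nat set"
      using that by (induction S) (auto simp: Var_power mult_single)
    then show ?thesis by simp
  qed
  finally have eq: "single (\<Sum>j=1..m. single (\<sigma> j) (k j)) (\<Prod>j=1..m. a j ^ k j) =
      single kexp c" (is "single ?e _ = _")
    using c(2) by (simp add: M_single Const_def mult_single)
  then have "?e = kexp" using c(1) by (metis single_exp_eqD)
  then have "(\<Prod>j=1..m. Var (\<sigma> j) ^ k j) = M"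
    unfolding \<open>(\<Prod>j=1..m. Var (\<sigma> j) ^ k j) = _\<close> M_single by simp
  moreover have "\<phi> (gen i) = pconst (t i) * gen (\<sigma> i)" if "i \<in> {1..m}" for i
    using yact(2)[of "Var i"] fa(3)[OF that] that by (simp add: iota.hom_mult t_def \<sigma>_def)
  ultimately show ?thesis
    using \<sigma> r fa(2) by (intro exI[of _ \<sigma>] exI[of _ t] exI[of _ r]) (auto simp: t_def)
qed

end

section \<open>Semidirect products\<close>

lemma AutoGroup_carrierD:
  assumes "h \<in> carrier (AutoGroup N)"
  shows "n \<in> carrier N \<Longrightarrow> h n \<in> carrier N"
    "n \<in> carrier N \<Longrightarrow> n' \<in> carrier N \<Longrightarrow> h (n \<otimes>\<^bsub>N\<^esub> n') = h n \<otimes>\<^bsub>N\<^esub> h n'"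
  using assms by (auto simp: AutoGroup_def auto_def hom_def)

lemma AutoGroup_mult:
  "h \<in> carrier (AutoGroup N) \<Longrightarrow> h' \<in> carrier (AutoGroup N) \<Longrightarrow> n \<in> carrier N \<Longrightarrow>
    (h \<otimes>\<^bsub>AutoGroup N\<^esub> h') n = h (h' n)"
  by (simp add: AutoGroup_def auto_def BijGroup_def compose_def)

lemma AutoGroup_one: "n \<in> carrier N \<Longrightarrow> \<one>\<^bsub>AutoGroup N\<^esub> n = n"
  by (simp add: AutoGroup_def BijGroup_def)

lemma semidirect_group:
  assumes H: "group H" and N: "group N" and \<theta>: "\<theta> \<in> hom H (AutoGroup N)"
  shows "group (semidirect H N \<theta>)"
proof -
  interpret H: group H by (rule H)
  interpret N: group N by (rule N)
  have A: "group (AutoGroup N)" by (rule N.AutoGroup)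
  have c: "\<theta> h \<in> carrier (AutoGroup N)" if "h \<in> carrier H" for h
    using \<theta> that by (auto simp: hom_def)
  have cl: "\<theta> h n \<in> carrier N" if "h \<in> carrier H" "n \<in> carrier N" for h n
    using AutoGroup_carrierD(1)[OF c] that by blast
  have m: "\<theta> (h \<otimes>\<^bsub>H\<^esub> h') n = \<theta> h (\<theta> h' n)" if "h \<in> carrier H" "h' \<in> carrier H" "n \<in> carrier N" for h h' n
    using \<theta> that c by (simp add: hom_mult[OF \<theta>] AutoGroup_mult)
  have one: "\<theta> \<one>\<^bsub>H\<^esub> n = n" if "n \<in> carrier N" for n
    using hom_one[OF \<theta> H A] that by (simp add: AutoGroup_one)
  have inv: "\<theta> (inv\<^bsub>H\<^esub> h) (\<theta> h n) = n" if "h \<in> carrier H" "n \<in> carrier N" for h n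
    using m[of "inv\<^bsub>H\<^esub> h" h n] that one by simp
  have mm: "\<theta> h (n \<otimes>\<^bsub>N\<^esub> n') = \<theta> h n \<otimes>\<^bsub>N\<^esub> \<theta> h n'"
    if "h \<in> carrier H" "n \<in> carrier N" "n' \<in> carrier N" for h n n'
    using AutoGroup_carrierD(2)[OF c] that by blast
  show ?thesis
  proof (rule groupI)
    fix x y z
    assume x: "x \<in> carrier (semidirect H N \<theta>)" and y: "y \<in> carrier (semidirect H N \<theta>)"
      and z: "z \<in> carrier (semidirect H N \<theta>)"
    then show "(x \<otimes>\<^bsub>semidirect H N \<theta>\<^esub> y) \<otimes>\<^bsub>semidirect H N \<theta>\<^esub> z =
        x \<otimes>\<^bsub>semidirect H N \<theta>\<^esub> (y \<otimes>\<^bsub>semidirect H N \<theta>\<^esub> z)"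
      by (auto simp: semidirect_def H.m_assoc N.m_assoc cl mm m H.inv_mult_group)
  next
    fix x assume x: "x \<in> carrier (semidirect H N \<theta>)"
    then obtain h n where hn: "x = (h, n)" "h \<in> carrier H" "n \<in> carrier N" by (auto simp: semidirect_def)
    show "\<exists>y\<in>carrier (semidirect H N \<theta>). y \<otimes>\<^bsub>semidirect H N \<theta>\<^esub> x = \<one>\<^bsub>semidirect H N \<theta>\<^esub>"
      by (rule bexI[of _ "(inv\<^bsub>H\<^esub> h, \<theta> h (inv\<^bsub>N\<^esub> n))"]) (use hn in \<open>simp_all add: semidirect_def cl inv\<close>)
  next
    fix x assume x: "x \<in> carrier (semidirect H N \<theta>)"
    then show "\<one>\<^bsub>semidirect H N \<theta>\<^esub> \<otimes>\<^bsub>semidirect H N \<theta>\<^esub> x = x"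
    proof -
      have "\<theta> h \<one>\<^bsub>N\<^esub> = \<one>\<^bsub>N\<^esub>" if "h \<in> carrier H" for h
        using mm[OF that N.one_closed N.one_closed] cl[OF that N.one_closed] by simp
      then show ?thesis using x by (auto simp: semidirect_def)
    qed
  qed (auto simp: semidirect_def cl)
qed

text \<open>The action of \<open>g\<close> on \<open>N\<close> is conjugation by \<open>\<rho> g\<close> in \<open>W\<close>, carried back along the injection \<open>\<mu>\<close>.\<close>

lemma semidirect_iso:
  assumes G: "group G" and N: "group N" and W: "group W"
    and \<rho>: "\<rho> \<in> hom G W" and \<mu>: "\<mu> \<in> hom N W" and inj: "inj_on \<mu> (carrier N)"
    and normal: "\<And>g n. g \<in> carrier G \<Longrightarrow> n \<in> carrier N \<Longrightarrow>
      \<exists>n'\<in>carrier N. \<rho> g \<otimes>\<^bsub>W\<^esub> \<mu> n = \<mu> n' \<otimes>\<^bsub>W\<^esub> \<rho> g"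
    and bij: "bij_betw (\<lambda>(g, n). \<rho> g \<otimes>\<^bsub>W\<^esub> \<mu> n) (carrier G \<times> carrier N) (carrier W)"
  shows "\<exists>\<theta>. \<theta> \<in> hom G (AutoGroup N) \<and>
    (\<lambda>(g, n). \<rho> g \<otimes>\<^bsub>W\<^esub> \<mu> n) \<in> iso (semidirect G N \<theta>) W"
proof -
  interpret G: group G by (rule G)
  interpret N: group N by (rule N)
  interpret W: group W by (rule W)
  have rc [simp]: "\<rho> g \<in> carrier W" if "g \<in> carrier G" for g using \<rho> that by (auto simp: hom_def)
  have mc [simp]: "\<mu> n \<in> carrier W" if "n \<in> carrier N" for n using \<mu> that by (auto simp: hom_def)
  have rm: "\<rho> (g \<otimes>\<^bsub>G\<^esub> h) = \<rho> g \<otimes>\<^bsub>W\<^esub> \<rho> h" if "g \<in> carrier G" "h \<in> carrier G" for g h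
    using hom_mult[OF \<rho>] that by blast
  have mm: "\<mu> (a \<otimes>\<^bsub>N\<^esub> b) = \<mu> a \<otimes>\<^bsub>W\<^esub> \<mu> b" if "a \<in> carrier N" "b \<in> carrier N" for a b
    using hom_mult[OF \<mu>] that by blast
  have r1: "\<rho> \<one>\<^bsub>G\<^esub> = \<one>\<^bsub>W\<^esub>" by (rule hom_one[OF \<rho> G W])
  define t where "t g n = (SOME n'. n' \<in> carrier N \<and> \<rho> g \<otimes>\<^bsub>W\<^esub> \<mu> n = \<mu> n' \<otimes>\<^bsub>W\<^esub> \<rho> g)" for g n
  have t: "t g n \<in> carrier N \<and> \<rho> g \<otimes>\<^bsub>W\<^esub> \<mu> n = \<mu> (t g n) \<otimes>\<^bsub>W\<^esub> \<rho> g"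
    if "g \<in> carrier G" "n \<in> carrier N" for g n
    unfolding t_def by (rule someI_ex) (use normal[OF that] in blast)
  have t_eqI: "t g n = n'" if "g \<in> carrier G" "n \<in> carrier N" "n' \<in> carrier N"
    "\<rho> g \<otimes>\<^bsub>W\<^esub> \<mu> n = \<mu> n' \<otimes>\<^bsub>W\<^esub> \<rho> g" for g n n'
  proof -
    have "\<mu> (t g n) \<otimes>\<^bsub>W\<^esub> \<rho> g = \<mu> n' \<otimes>\<^bsub>W\<^esub> \<rho> g" using t[OF that(1,2)] that(4) by simp
    then have "\<mu> (t g n) = \<mu> n'" using that t[OF that(1,2)] by simp
    then show ?thesis using inj_onD[OF inj] t[OF that(1,2)] that(3) by blast
  qed
  have t_mult: "t (g \<otimes>\<^bsub>G\<^esub> h) n = t g (t h n)" if "g \<in> carrier G" "h \<in> carrier G" "n \<in> carrier N" for g h n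
  proof (rule t_eqI)
    note th = t[OF that(2,3)]
    note tg = t[OF that(1) th[THEN conjunct1]]
    have "\<rho> (g \<otimes>\<^bsub>G\<^esub> h) \<otimes>\<^bsub>W\<^esub> \<mu> n = \<rho> g \<otimes>\<^bsub>W\<^esub> (\<rho> h \<otimes>\<^bsub>W\<^esub> \<mu> n)"
      using that by (simp add: rm W.m_assoc)
    also have "\<dots> = \<rho> g \<otimes>\<^bsub>W\<^esub> \<mu> (t h n) \<otimes>\<^bsub>W\<^esub> \<rho> h"
      using that th by (simp add: W.m_assoc)
    also have "\<dots> = \<mu> (t g (t h n)) \<otimes>\<^bsub>W\<^esub> \<rho> (g \<otimes>\<^bsub>G\<^esub> h)"
      using that tg by (simp add: rm W.m_assoc)
    finally show "\<rho> (g \<otimes>\<^bsub>G\<^esub> h) \<otimes>\<^bsub>W\<^esub> \<mu> n = \<mu> (t g (t h n)) \<otimes>\<^bsub>W\<^esub> \<rho> (g \<otimes>\<^bsub>G\<^esub> h)" .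
    show "t g (t h n) \<in> carrier N" using tg by blast
  qed (use that in auto)
  have t_one: "t \<one>\<^bsub>G\<^esub> n = n" if "n \<in> carrier N" for n
    by (rule t_eqI) (use that r1 in auto)
  have t_hom: "t g (a \<otimes>\<^bsub>N\<^esub> b) = t g a \<otimes>\<^bsub>N\<^esub> t g b"
    if "g \<in> carrier G" "a \<in> carrier N" "b \<in> carrier N" for g a b
  proof (rule t_eqI)
    note ta = t[OF that(1,2)] and tb = t[OF that(1,3)]
    have "\<rho> g \<otimes>\<^bsub>W\<^esub> \<mu> (a \<otimes>\<^bsub>N\<^esub> b) = (\<rho> g \<otimes>\<^bsub>W\<^esub> \<mu> a) \<otimes>\<^bsub>W\<^esub> \<mu> b"
      using that by (simp add: mm W.m_assoc)
    also have "\<dots> = \<mu> (t g a) \<otimes>\<^bsub>W\<^esub> (\<rho> g \<otimes>\<^bsub>W\<^esub> \<mu> b)"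
      using that ta by (simp add: W.m_assoc)
    also have "\<dots> = \<mu> (t g a \<otimes>\<^bsub>N\<^esub> t g b) \<otimes>\<^bsub>W\<^esub> \<rho> g"
      using that ta tb by (simp add: mm W.m_assoc)
    finally show "\<rho> g \<otimes>\<^bsub>W\<^esub> \<mu> (a \<otimes>\<^bsub>N\<^esub> b) = \<mu> (t g a \<otimes>\<^bsub>N\<^esub> t g b) \<otimes>\<^bsub>W\<^esub> \<rho> g" .
  qed (use that t in auto)
  define \<theta> where "\<theta> g = (\<lambda>n\<in>carrier N. t g n)" for g
  have tinv: "t (inv\<^bsub>G\<^esub> g) (t g n) = n" "t g (t (inv\<^bsub>G\<^esub> g) n) = n"
    if "g \<in> carrier G" "n \<in> carrier N" for g n
    using t_mult[of "inv\<^bsub>G\<^esub> g" g n] t_mult[of g "inv\<^bsub>G\<^esub> g" n] that t_one by auto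
  have "bij_betw (\<theta> g) (carrier N) (carrier N)" if "g \<in> carrier G" for g
    by (rule bij_betwI[where g = "t (inv\<^bsub>G\<^esub> g)"]) (use that t tinv in \<open>auto simp: \<theta>_def\<close>)
  then have \<theta>c: "\<theta> g \<in> carrier (AutoGroup N)" if "g \<in> carrier G" for g
    using that t t_hom by (auto simp: AutoGroup_def auto_def Bij_def hom_def \<theta>_def)
  have \<theta>: "\<theta> \<in> hom G (AutoGroup N)"
  proof (rule homI)
    fix g h assume gh: "g \<in> carrier G" "h \<in> carrier G"
    have "\<theta> g \<otimes>\<^bsub>AutoGroup N\<^esub> \<theta> h = compose (carrier N) (\<theta> g) (\<theta> h)"
      using \<theta>c[OF gh(1)] \<theta>c[OF gh(2)] by (simp add: AutoGroup_def auto_def BijGroup_def)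
    also have "\<dots> = \<theta> (g \<otimes>\<^bsub>G\<^esub> h)"
      using gh t by (auto simp: compose_def \<theta>_def t_mult)
    finally show "\<theta> (g \<otimes>\<^bsub>G\<^esub> h) = \<theta> g \<otimes>\<^bsub>AutoGroup N\<^esub> \<theta> h" by simp
  qed (rule \<theta>c)
  have "(\<lambda>(g, n). \<rho> g \<otimes>\<^bsub>W\<^esub> \<mu> n) \<in> hom (semidirect G N \<theta>) W"
  proof (rule homI)
    fix x y assume "x \<in> carrier (semidirect G N \<theta>)" "y \<in> carrier (semidirect G N \<theta>)"
    then obtain g n h n' where xy: "x = (g, n)" "y = (h, n')" "g \<in> carrier G" "h \<in> carrier G"
      "n \<in> carrier N" "n' \<in> carrier N" by (auto simp: semidirect_def)
    let ?n = "t (inv\<^bsub>G\<^esub> h) n"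
    have nc: "?n \<in> carrier N" using t[of "inv\<^bsub>G\<^esub> h" n] xy by simp
    have "\<mu> n \<otimes>\<^bsub>W\<^esub> \<rho> h = \<rho> h \<otimes>\<^bsub>W\<^esub> \<mu> ?n"
      using t[OF xy(4) nc] tinv[OF xy(4,5)] by simp
    then have "\<rho> g \<otimes>\<^bsub>W\<^esub> (\<mu> n \<otimes>\<^bsub>W\<^esub> \<rho> h) \<otimes>\<^bsub>W\<^esub> \<mu> n' = \<rho> g \<otimes>\<^bsub>W\<^esub> (\<rho> h \<otimes>\<^bsub>W\<^esub> \<mu> ?n) \<otimes>\<^bsub>W\<^esub> \<mu> n'" by simp
    then show "(case x \<otimes>\<^bsub>semidirect G N \<theta>\<^esub> y of (g, n) \<Rightarrow> \<rho> g \<otimes>\<^bsub>W\<^esub> \<mu> n) =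
        (case x of (g, n) \<Rightarrow> \<rho> g \<otimes>\<^bsub>W\<^esub> \<mu> n) \<otimes>\<^bsub>W\<^esub> (case y of (g, n) \<Rightarrow> \<rho> g \<otimes>\<^bsub>W\<^esub> \<mu> n)"
      using xy nc by (simp add: semidirect_def \<theta>_def rm mm W.m_assoc)
  qed (auto simp: semidirect_def)
  then show ?thesis using \<theta> bij by (auto simp: iso_def semidirect_def)
qed

section \<open>Automorphisms of affine varieties\<close>

lemma coord_algebra_simps:
  "carrier (coord_algebra n V) = poly_fun V ` mpolys {..<n}"
  "f \<otimes>\<^bsub>coord_algebra n V\<^esub> g = (\<lambda>v\<in>V. f v * g v)"
  "f \<oplus>\<^bsub>coord_algebra n V\<^esub> g = (\<lambda>v\<in>V. f v + g v)"
  "\<one>\<^bsub>coord_algebra n V\<^esub> = (\<lambda>v\<in>V. 1)" "\<zero>\<^bsub>coord_algebra n V\<^esub> = (\<lambda>v\<in>V. 0)"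
  "c \<odot>\<^bsub>coord_algebra n V\<^esub> f = (\<lambda>v\<in>V. c * f v)"
  by (simp_all add: coord_algebra_def)

lemma poly_fun_in: "p \<in> mpolys {..<n} \<Longrightarrow> poly_fun V p \<in> carrier (coord_algebra n V)"
  by (simp add: coord_algebra_simps)

lemma poly_fun_apply [simp]: "v \<in> V \<Longrightarrow> poly_fun V p v = mpoly_eval (\<lambda>c. c) v p"
  by (simp add: poly_fun_def)

lemma poly_fun_hom:
  "poly_fun V (p + q) = poly_fun V p \<oplus>\<^bsub>coord_algebra n V\<^esub> poly_fun V q"
  "poly_fun V (p * q) = poly_fun V p \<otimes>\<^bsub>coord_algebra n V\<^esub> poly_fun V q"
  "poly_fun V 1 = \<one>\<^bsub>coord_algebra n V\<^esub>" "poly_fun V 0 = \<zero>\<^bsub>coord_algebra n V\<^esub>"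
  "poly_fun V (Const c * p) = c \<odot>\<^bsub>coord_algebra n V\<^esub> poly_fun V p"
  by (auto simp: coord_algebra_simps poly_fun_def ring_map.eval_add[OF id_hom]
      ring_map.eval_mult[OF id_hom] ring_map.eval_one[OF id_hom] ring_map.eval_zero[OF id_hom]
      ring_map.eval_Const[OF id_hom])

lemma coord_algebra_extensional: "f \<in> carrier (coord_algebra n V) \<Longrightarrow> f \<in> extensional V"
  by (auto simp: coord_algebra_simps poly_fun_def)

lemma regular_comp:
  assumes a: "regular_self_map n V a" and f: "f \<in> carrier (coord_algebra n V)"
  shows "(\<lambda>v\<in>V. f (a v)) \<in> carrier (coord_algebra n V)"
proof -
  obtain p where p: "p \<in> mpolys {..<n}" "f = poly_fun V p" using f by (auto simp: coord_algebra_simps)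
  have "\<forall>i\<in>{..<n}. \<exists>q\<in>mpolys {..<n}. (\<lambda>v\<in>V. a v i) = poly_fun V q"
    using a by (auto simp: regular_self_map_def coord_algebra_simps)
  then obtain q where q: "\<And>i. i < n \<Longrightarrow> q i \<in> mpolys {..<n}"
    "\<And>i. i < n \<Longrightarrow> (\<lambda>v\<in>V. a v i) = poly_fun V (q i)" by (metis lessThan_iff)
  have aV: "a v \<in> V" if "v \<in> V" for v using a that by (auto simp: regular_self_map_def)
  have ai: "a v i = mpoly_eval (\<lambda>c. c) v (q i)" if "v \<in> V" "i < n" for v i
    using fun_cong[OF q(2)[OF that(2)], of v] that by simp
  have "(\<lambda>v\<in>V. f (a v)) = poly_fun V (mpoly_eval Const q p)"
  proof
    fix v
    show "(\<lambda>v\<in>V. f (a v)) v = poly_fun V (mpoly_eval Const q p) v"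
    proof (cases "v \<in> V")
      case True
      have "f (a v) = mpoly_eval (\<lambda>c. c) (a v) p" using aV[OF True] p by simp
      also have "\<dots> = mpoly_eval (\<lambda>c. c) (\<lambda>i. mpoly_eval (\<lambda>c. c) v (q i)) p"
        by (rule mpoly_eval_cong[OF p(1)]) (use ai[OF True] in auto)
      also have "\<dots> = mpoly_eval (\<lambda>c. c) v (mpoly_eval Const q p)"
        by (rule mpoly_eval_subst[OF id_hom, symmetric])
      finally show ?thesis using True by simp
    qed (simp add: poly_fun_def)
  qed
  moreover have "mpoly_eval Const q p \<in> mpolys {..<n}"
    by (rule mpoly_eval_in_mpolys[OF p(1)]) (use q in auto)
  ultimately show ?thesis by (simp add: poly_fun_in)
qed

lemma regular_compose:
  assumes "regular_self_map n V a" "regular_self_map n V b"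
  shows "regular_self_map n V (compose V a b)"
proof -
  have b: "b \<in> V \<rightarrow> V" using assms by (auto simp: regular_self_map_def)
  have "(\<lambda>v\<in>V. compose V a b v i) \<in> carrier (coord_algebra n V)" if "i < n" for i
  proof -
    have "(\<lambda>v\<in>V. (\<lambda>v\<in>V. a v i) (b v)) \<in> carrier (coord_algebra n V)"
      by (rule regular_comp[OF assms(2), of "\<lambda>v\<in>V. a v i"])
         (use assms(1) that in \<open>unfold regular_self_map_def, blast\<close>)
    moreover have "(\<lambda>v\<in>V. compose V a b v i) = (\<lambda>v\<in>V. (\<lambda>v\<in>V. a v i) (b v))"
      using b by (intro restrict_ext) (auto simp: compose_def)
    ultimately show ?thesis by simp
  qed
  moreover have "compose V a b \<in> V \<rightarrow>\<^sub>E V"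
    using assms by (auto simp: regular_self_map_def compose_def)
  ultimately show ?thesis by (simp add: regular_self_map_def)
qed

lemma variety_Aut_carrier:
  "carrier (variety_Aut n V) =
    {a \<in> Bij V. regular_self_map n V a \<and> regular_self_map n V (inv\<^bsub>BijGroup V\<^esub> a)}"
  by (auto simp: variety_Aut_def inv_BijGroup)

lemma regular_id:
  assumes "V \<subseteq> extensional {..<n}"
  shows "regular_self_map n V (\<lambda>v\<in>V. v)"
proof -
  have "(\<lambda>v\<in>V. (\<lambda>v\<in>V. v) v i) = poly_fun V (Var i)" for i
    by (auto simp: poly_fun_def ring_map.eval_Var[OF id_hom])
  then show ?thesis by (auto simp: regular_self_map_def intro!: poly_fun_in)
qed

lemma BijGroup_simps:
  "carrier (BijGroup V) = Bij V" "\<one>\<^bsub>BijGroup V\<^esub> = (\<lambda>v\<in>V. v)"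
  "a \<in> Bij V \<Longrightarrow> b \<in> Bij V \<Longrightarrow> a \<otimes>\<^bsub>BijGroup V\<^esub> b = compose V a b"
  by (simp_all add: BijGroup_def)

lemma variety_Aut_subgroup:
  assumes "V \<subseteq> extensional {..<n}"
  shows "subgroup (carrier (variety_Aut n V)) (BijGroup V)"
proof -
  interpret group "BijGroup V" by (rule group_BijGroup)
  show ?thesis
  proof (rule subgroupI)
    have "inv\<^bsub>BijGroup V\<^esub> (\<lambda>v\<in>V. v) = (\<lambda>v\<in>V. v)"
      using inv_one by (simp add: BijGroup_simps)
    then have "(\<lambda>v\<in>V. v) \<in> carrier (variety_Aut n V)"
      using regular_id[OF assms] by (simp add: variety_Aut_carrier id_Bij)
    then show "carrier (variety_Aut n V) \<noteq> {}" by auto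
  next
    fix a assume "a \<in> carrier (variety_Aut n V)"
    then show "inv\<^bsub>BijGroup V\<^esub> a \<in> carrier (variety_Aut n V)"
      using inv_closed[of a] inv_inv[of a] by (auto simp: variety_Aut_carrier BijGroup_simps)
  next
    fix a b assume ab: "a \<in> carrier (variety_Aut n V)" "b \<in> carrier (variety_Aut n V)"
    then have B: "a \<in> carrier (BijGroup V)" "b \<in> carrier (BijGroup V)"
      by (auto simp: variety_Aut_carrier BijGroup_simps)
    have "inv\<^bsub>BijGroup V\<^esub> (a \<otimes>\<^bsub>BijGroup V\<^esub> b) = compose V (inv\<^bsub>BijGroup V\<^esub> b) (inv\<^bsub>BijGroup V\<^esub> a)"
      using inv_mult_group[OF B] inv_closed[OF B(1)] inv_closed[OF B(2)] by (simp add: BijGroup_simps)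
    moreover have "a \<otimes>\<^bsub>BijGroup V\<^esub> b = compose V a b" using B by (simp add: BijGroup_simps)
    moreover have "a \<otimes>\<^bsub>BijGroup V\<^esub> b \<in> Bij V" using m_closed[OF B] by (simp add: BijGroup_simps)
    ultimately show "a \<otimes>\<^bsub>BijGroup V\<^esub> b \<in> carrier (variety_Aut n V)"
      using ab by (simp add: variety_Aut_carrier regular_compose)
  qed (auto simp: variety_Aut_carrier BijGroup_simps)
qed

lemma variety_Aut_eq: "variety_Aut n V = (BijGroup V)\<lparr>carrier := carrier (variety_Aut n V)\<rparr>"
  by (simp add: variety_Aut_def)

lemma variety_Aut_group:
  assumes "V \<subseteq> extensional {..<n}"
  shows "group (variety_Aut n V)"
  using subgroup.subgroup_is_group[OF variety_Aut_subgroup[OF assms] group_BijGroup]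
  by (simp only: variety_Aut_eq[symmetric])

lemma induced_aut_closed:
  assumes "a \<in> carrier (variety_Aut n V)" "f \<in> carrier (coord_algebra n V)"
  shows "induced_aut V a f \<in> carrier (coord_algebra n V)"
proof -
  have a: "a \<in> Bij V" "regular_self_map n V (\<lambda>v\<in>V. inv_into V a v)"
    using assms(1) by (auto simp: variety_Aut_def)
  have "induced_aut V a f = (\<lambda>v\<in>V. f ((\<lambda>v\<in>V. inv_into V a v) v))"
    by (auto simp: induced_aut_def)
  then show ?thesis using regular_comp[OF a(2) assms(2)] by simp
qed

lemma induced_aut_mult:
  assumes ab: "a \<in> carrier (variety_Aut n V)" "b \<in> carrier (variety_Aut n V)"
  shows "induced_aut V (a \<otimes>\<^bsub>variety_Aut n V\<^esub> b) f = induced_aut V a (induced_aut V b f)"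
proof -
  interpret group "BijGroup V" by (rule group_BijGroup)
  have B: "a \<in> Bij V" "b \<in> Bij V" using ab by (auto simp: variety_Aut_carrier)
  have m: "a \<otimes>\<^bsub>variety_Aut n V\<^esub> b = a \<otimes>\<^bsub>BijGroup V\<^esub> b" by (simp add: variety_Aut_def)
  have inv: "(inv\<^bsub>BijGroup V\<^esub> c) v = inv_into V c v" if "c \<in> Bij V" "v \<in> V" for c v
    using that by (simp add: inv_BijGroup)
  have "inv_into V (a \<otimes>\<^bsub>BijGroup V\<^esub> b) v = inv_into V b (inv_into V a v)" if v: "v \<in> V" for v
  proof -
    have "a \<otimes>\<^bsub>BijGroup V\<^esub> b \<in> Bij V" using m_closed[of a b] B by (simp add: BijGroup_simps)
    then have "inv_into V (a \<otimes>\<^bsub>BijGroup V\<^esub> b) v = (inv\<^bsub>BijGroup V\<^esub> (a \<otimes>\<^bsub>BijGroup V\<^esub> b)) v"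
      using inv v by simp
    also have "\<dots> = compose V (inv\<^bsub>BijGroup V\<^esub> b) (inv\<^bsub>BijGroup V\<^esub> a) v"
      using inv_mult_group[of a b] inv_closed[of a] inv_closed[of b] B by (simp add: BijGroup_simps)
    also have "\<dots> = inv_into V b (inv_into V a v)"
      using v B Bij_inv_into_mem[OF B(1) v] by (simp add: compose_def inv)
    finally show ?thesis .
  qed
  then show ?thesis
    unfolding m induced_aut_def by (intro restrict_ext) (simp add: Bij_inv_into_mem[OF B(1)])
qed

lemma induced_aut_inj:
  assumes V: "V \<subseteq> extensional {..<n}"
    and ab: "a \<in> carrier (variety_Aut n V)" "b \<in> carrier (variety_Aut n V)"
    and eq: "\<And>f. f \<in> carrier (coord_algebra n V) \<Longrightarrow> induced_aut V a f = induced_aut V b f"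
  shows "a = b"
proof -
  interpret group "BijGroup V" by (rule group_BijGroup)
  have B: "a \<in> Bij V" "b \<in> Bij V" using ab by (auto simp: variety_Aut_carrier)
  have "inv_into V a v = inv_into V b v" if v: "v \<in> V" for v
  proof -
    have in_V: "inv_into V a v \<in> V" "inv_into V b v \<in> V"
      using Bij_inv_into_mem[OF _ v] B by auto
    show ?thesis
    proof (rule extensionalityI)
      show "inv_into V a v \<in> extensional {..<n}" "inv_into V b v \<in> extensional {..<n}"
        using in_V V by auto
      fix i assume "i \<in> {..<n}"
      then have "poly_fun V (Var i) \<in> carrier (coord_algebra n V)" by (intro poly_fun_in) simp
      then have "induced_aut V a (poly_fun V (Var i)) v = induced_aut V b (poly_fun V (Var i)) v"
        using eq by simp
      then show "inv_into V a v i = inv_into V b v i"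
        using v in_V by (simp add: induced_aut_def ring_map.eval_Var[OF id_hom])
    qed
  qed
  then have eq: "inv\<^bsub>BijGroup V\<^esub> a = inv\<^bsub>BijGroup V\<^esub> b"
    unfolding inv_BijGroup[OF B(1)] inv_BijGroup[OF B(2)] by (rule restrict_ext)
  have "a = inv\<^bsub>BijGroup V\<^esub> (inv\<^bsub>BijGroup V\<^esub> a)"
    using B by (intro inv_inv[symmetric]) (simp add: BijGroup_simps)
  also have "\<dots> = inv\<^bsub>BijGroup V\<^esub> (inv\<^bsub>BijGroup V\<^esub> b)" by (rule arg_cong[OF eq])
  also have "\<dots> = b" using B by (intro inv_inv) (simp add: BijGroup_simps)
  finally show ?thesis .
qed

text \<open>Homomorphisms are required to respect the operations on polynomials that represent functions.\<close>

definition alg_hom :: "nat \<Rightarrow> (nat \<Rightarrow> 'a::field) set \<Rightarrow> (((nat \<Rightarrow> 'a) \<Rightarrow> 'a) \<Rightarrow> ((nat \<Rightarrow> 'a) \<Rightarrow> 'a)) \<Rightarrow> bool" where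
  "alg_hom n V \<psi> \<longleftrightarrow> (\<forall>f\<in>carrier (coord_algebra n V). \<psi> f \<in> carrier (coord_algebra n V)) \<and>
     (\<forall>p\<in>mpolys {..<n}. \<forall>q\<in>mpolys {..<n}. \<forall>v\<in>V.
        \<psi> (poly_fun V (p + q)) v = \<psi> (poly_fun V p) v + \<psi> (poly_fun V q) v \<and>
        \<psi> (poly_fun V (p * q)) v = \<psi> (poly_fun V p) v * \<psi> (poly_fun V q) v) \<and>
     (\<forall>c. \<forall>v\<in>V. \<psi> (poly_fun V (Const c)) v = c)"

text \<open>An algebra endomorphism comes from the map of points whose coordinates are the images of the
  coordinate functions.\<close>

definition point_map :: "nat \<Rightarrow> (nat \<Rightarrow> 'a::field) set \<Rightarrow> (((nat \<Rightarrow> 'a) \<Rightarrow> 'a) \<Rightarrow> ((nat \<Rightarrow> 'a) \<Rightarrow> 'a)) \<Rightarrow>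
    (nat \<Rightarrow> 'a) \<Rightarrow> nat \<Rightarrow> 'a" where
  "point_map n V \<psi> = (\<lambda>v\<in>V. \<lambda>i\<in>{..<n}. \<psi> (poly_fun V (Var i)) v)"

locale affine_variety =
  fixes n :: nat and I :: "'a::field mpoly set" and V :: "(nat \<Rightarrow> 'a) set"
  assumes I: "I \<subseteq> mpolys {..<n}"
    and V_eq: "V = {v \<in> {..<n} \<rightarrow>\<^sub>E UNIV. \<forall>p\<in>I. mpoly_eval (\<lambda>c. c) v p = 0}"
begin

lemma V_ext: "V \<subseteq> extensional {..<n}"
  by (auto simp: V_eq PiE_def)

lemma point_map_eval:
  assumes \<psi>: "alg_hom n V \<psi>" and p: "p \<in> mpolys {..<n}" and v: "v \<in> V"
  shows "mpoly_eval (\<lambda>c. c) (point_map n V \<psi> v) p = \<psi> (poly_fun V p) v"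
  using p
proof (induction rule: mpolys_induct)
  case (Const a)
  then show ?case using \<psi> v by (simp add: alg_hom_def ring_map.eval_Const[OF id_hom])
next
  case (Var i)
  then show ?case using v by (simp add: point_map_def ring_map.eval_Var[OF id_hom])
next
  case (add p q)
  then show ?case using \<psi> v by (simp add: alg_hom_def ring_map.eval_add[OF id_hom])
next
  case (mult p q)
  then show ?case using \<psi> v by (simp add: alg_hom_def ring_map.eval_mult[OF id_hom])
qed

text \<open>The equations of \<open>V\<close> are represented by the zero function, which an endomorphism preserves.\<close>

lemma point_map_in_V:
  assumes \<psi>: "alg_hom n V \<psi>" and v: "v \<in> V"
  shows "point_map n V \<psi> v \<in> V"
proof -
  have "mpoly_eval (\<lambda>c. c) (point_map n V \<psi> v) p = 0" if p: "p \<in> I" for p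
  proof -
    have "poly_fun V p = poly_fun V (Const 0)"
      using p by (auto simp: poly_fun_def V_eq ring_map.eval_Const[OF id_hom])
    then have "\<psi> (poly_fun V p) v = 0" using \<psi> v by (simp add: alg_hom_def)
    then show ?thesis using point_map_eval[OF \<psi> _ v] p I by auto
  qed
  moreover have "point_map n V \<psi> v \<in> {..<n} \<rightarrow>\<^sub>E UNIV" using v by (auto simp: point_map_def)
  ultimately have "point_map n V \<psi> v \<in> {v \<in> {..<n} \<rightarrow>\<^sub>E UNIV. \<forall>p\<in>I. mpoly_eval (\<lambda>c. c) v p = 0}"
    by blast
  then show ?thesis unfolding V_eq[symmetric] .
qed

lemma point_map_apply:
  assumes \<psi>: "alg_hom n V \<psi>" and f: "f \<in> carrier (coord_algebra n V)" and v: "v \<in> V"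
  shows "f (point_map n V \<psi> v) = \<psi> f v"
proof -
  obtain p where "p \<in> mpolys {..<n}" "f = poly_fun V p" using f by (auto simp: coord_algebra_simps)
  then show ?thesis using point_map_eval[OF \<psi> _ v] point_map_in_V[OF \<psi> v] by simp
qed

lemma point_map_regular:
  assumes \<psi>: "alg_hom n V \<psi>"
  shows "regular_self_map n V (point_map n V \<psi>)"
proof -
  have "(\<lambda>v\<in>V. point_map n V \<psi> v i) \<in> carrier (coord_algebra n V)" if i: "i < n" for i
  proof -
    have X: "poly_fun V (Var i) \<in> carrier (coord_algebra n V)" using i by (intro poly_fun_in) simp
    then have "\<psi> (poly_fun V (Var i)) \<in> carrier (coord_algebra n V)" using \<psi> by (simp add: alg_hom_def)
    moreover have "(\<lambda>v\<in>V. point_map n V \<psi> v i) = \<psi> (poly_fun V (Var i))"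
      using i coord_algebra_extensional[OF calculation]
      by (auto simp: point_map_def extensional_def)
    ultimately show ?thesis by simp
  qed
  moreover have "point_map n V \<psi> \<in> V \<rightarrow>\<^sub>E V"
    using point_map_in_V[OF \<psi>] by (auto simp: point_map_def)
  ultimately show ?thesis by (simp add: regular_self_map_def)
qed

lemma point_map_inverse:
  assumes \<psi>: "alg_hom n V \<psi>" and \<chi>: "alg_hom n V \<chi>"
    and inv: "\<And>f. f \<in> carrier (coord_algebra n V) \<Longrightarrow> \<chi> (\<psi> f) = f" and v: "v \<in> V"
  shows "point_map n V \<psi> (point_map n V \<chi> v) = v"
proof (rule extensionalityI)
  have w: "point_map n V \<chi> v \<in> V" by (rule point_map_in_V[OF \<chi> v])
  show "v \<in> extensional {..<n}" "point_map n V \<psi> (point_map n V \<chi> v) \<in> extensional {..<n}"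
    using V_ext v point_map_in_V[OF \<psi> w] by auto
  fix i assume i: "i \<in> {..<n}"
  have X: "poly_fun V (Var i) \<in> carrier (coord_algebra n V)" using i by (intro poly_fun_in) simp
  then have "\<psi> (poly_fun V (Var i)) \<in> carrier (coord_algebra n V)" using \<psi> by (simp add: alg_hom_def)
  then have "\<psi> (poly_fun V (Var i)) (point_map n V \<chi> v) = \<chi> (\<psi> (poly_fun V (Var i))) v"
    by (rule point_map_apply[OF \<chi> _ v])
  then show "point_map n V \<psi> (point_map n V \<chi> v) i = v i"
    using i w v inv[OF X] by (simp add: point_map_def ring_map.eval_Var[OF id_hom])
qed

text \<open>Since \<open>induced_aut\<close> composes with the inverse, \<open>\<psi>\<close> is induced by the point map of its inverse \<open>\<chi>\<close>.\<close>

theorem algebra_automorphism_induced: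
  assumes \<psi>: "alg_hom n V \<psi>" and \<chi>: "alg_hom n V \<chi>"
    and inv: "\<And>f. f \<in> carrier (coord_algebra n V) \<Longrightarrow> \<chi> (\<psi> f) = f"
      "\<And>f. f \<in> carrier (coord_algebra n V) \<Longrightarrow> \<psi> (\<chi> f) = f"
  shows "\<exists>a\<in>carrier (variety_Aut n V). \<forall>f\<in>carrier (coord_algebra n V). induced_aut V a f = \<psi> f"
proof -
  let ?a = "point_map n V \<chi>" and ?b = "point_map n V \<psi>"
  have ab: "?a (?b v) = v" "?b (?a v) = v" if "v \<in> V" for v
    using point_map_inverse[OF \<chi> \<psi>] point_map_inverse[OF \<psi> \<chi>] inv that by blast+
  have bij: "bij_betw ?a V V"
    by (rule bij_betwI[where g = ?b]) (use ab point_map_in_V \<psi> \<chi> in auto)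
  have B: "?a \<in> Bij V" using bij by (auto simp: Bij_def point_map_def)
  have ia: "inv_into V ?a v = ?b v" if "v \<in> V" for v
    by (rule inv_into_f_eq) (use bij that ab point_map_in_V[OF \<psi> that] in \<open>auto simp: bij_betw_def\<close>)
  have "(\<lambda>v\<in>V. inv_into V ?a v) = ?b"
    using ia by (auto simp: point_map_def)
  then have "?a \<in> carrier (variety_Aut n V)"
    using B point_map_regular[OF \<psi>] point_map_regular[OF \<chi>] by (simp add: variety_Aut_def)
  moreover have "induced_aut V ?a f = \<psi> f" if f: "f \<in> carrier (coord_algebra n V)" for f
  proof (rule extensionalityI)
    show "induced_aut V ?a f \<in> extensional V" by (simp add: induced_aut_def)
    show "\<psi> f \<in> extensional V" using \<psi> f by (auto simp: alg_hom_def intro: coord_algebra_extensional)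
  qed (simp add: induced_aut_def ia point_map_apply[OF \<psi> f])
  ultimately show ?thesis by blast
qed

end

section \<open>Functions on the variety\<close>

context danielewski
begin

(* Structures carry their dimension as m + 2; rewriting it to a successor would make equal structures look different. *)
declare add_2_eq_Suc' [simp del]

abbreviation V :: "(nat \<Rightarrow> 'a) set" where "V \<equiv> dan_variety m k P"
abbreviation A :: "('a, (nat \<Rightarrow> 'a) \<Rightarrow> 'a) module" where "A \<equiv> dan_algebra m k P"
abbreviation W :: "((nat \<Rightarrow> 'a) \<Rightarrow> nat \<Rightarrow> 'a) monoid" where "W \<equiv> variety_Aut (m + 2) V"
abbreviation ev :: "(nat \<Rightarrow> 'a) \<Rightarrow> 'a mpoly \<Rightarrow> 'a" where "ev \<equiv> mpoly_eval (\<lambda>c. c)"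

lemmas ev_simps = ring_map.eval_add[OF id_hom] ring_map.eval_mult[OF id_hom] ring_map.eval_diff[OF id_hom]
  ring_map.eval_Var[OF id_hom] ring_map.eval_Const[OF id_hom] ring_map.eval_power[OF id_hom]
  ring_map.eval_prod[OF id_hom] ring_map.eval_zero[OF id_hom] ring_map.eval_one[OF id_hom]

lemma ev_M: "ev v M = (\<Prod>i=1..m. v i ^ k i)"
  by (simp add: dan_monom_def ev_simps)

sublocale aff: affine_variety "m + 2" "{Var 0 * M - P}" V
proof
  show "{Var 0 * M - P} \<subseteq> mpolys {..<m + 2}"
    using diff_in_mpolys[OF mult_in_mpolys[OF _ M_in'] P_in', of "Var 0"] by simp
  show "V = {v \<in> {..<m + 2} \<rightarrow>\<^sub>E UNIV. \<forall>p\<in>{Var 0 * M - P}. ev v p = 0}"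
    by (simp add: dan_variety_def ev_simps ev_M)
qed

lemma relation_on_V: "v \<in> V \<Longrightarrow> ev v (Var 0 * M - P) = 0"
  using aff.V_eq by blast

text \<open>Modulo the defining relation, a power of \<open>M\<close> absorbs every power of \<open>x\<close>.\<close>

lemma clear_denominators:
  "p \<in> mpolys {..<m + 2} \<Longrightarrow>
    \<exists>N q r. q \<in> mpolys {1..m + 1} \<and> M ^ N * p - q = r * (Var 0 * M - P)"
proof (induction rule: mpolys_induct)
  case (Const a)
  show ?case by (intro exI[of _ 0] exI[of _ "Const a"] exI[of _ 0]) simp
next
  case (Var i)
  show ?case
  proof (cases "i = 0")
    case True
    show ?thesis
      by (intro exI[of _ 1] exI[of _ P] exI[of _ 1] conjI P_in) (simp add: True mult.commute)
  next
    case False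
    then show ?thesis using Var by (intro exI[of _ 0] exI[of _ "Var i"] exI[of _ 0]) auto
  qed
next
  case (add p p')
  have Mp: "M ^ N \<in> mpolys {1..m + 1}" for N
    by (intro power_in_mpolys mpolys_mono[OF _ M_in]) auto
  obtain N q r where 1: "q \<in> mpolys {1..m + 1}" "M ^ N * p - q = r * (Var 0 * M - P)" using add by blast
  obtain N' q' r' where 2: "q' \<in> mpolys {1..m + 1}" "M ^ N' * p' - q' = r' * (Var 0 * M - P)" using add by blast
  have "M ^ (N + N') * (p + p') - (M ^ N' * q + M ^ N * q') =
      M ^ N' * (M ^ N * p - q) + M ^ N * (M ^ N' * p' - q')"
    by (simp add: power_add algebra_simps)
  also have "\<dots> = (M ^ N' * r + M ^ N * r') * (Var 0 * M - P)"
    unfolding 1(2) 2(2) by (simp only: distrib_right mult.assoc)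
  finally show ?case using 1(1) 2(1) Mp by (blast intro: add_in_mpolys mult_in_mpolys)
next
  case (mult p p')
  obtain N q r where 1: "q \<in> mpolys {1..m + 1}" "M ^ N * p - q = r * (Var 0 * M - P)" using mult by blast
  obtain N' q' r' where 2: "q' \<in> mpolys {1..m + 1}" "M ^ N' * p' - q' = r' * (Var 0 * M - P)" using mult by blast
  have "M ^ (N + N') * (p * p') - q * q' = (M ^ N * p) * (M ^ N' * p' - q') + q' * (M ^ N * p - q)"
    by (simp add: power_add algebra_simps)
  also have "\<dots> = (M ^ N * p * r' + q' * r) * (Var 0 * M - P)"
    unfolding 1(2) 2(2) by (simp only: distrib_right mult.assoc)
  finally show ?case using 1(1) 2(1) by (blast intro: mult_in_mpolys)
qed

text \<open>Both polynomials have the same reduced form, and reduction does not change the function on \<open>V\<close>.\<close>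

lemma poly_fun_eqI_iota:
  assumes "p \<in> mpolys {..<m + 2}" "q \<in> mpolys {..<m + 2}" "iota p = iota q"
  shows "poly_fun V p = poly_fun V q"
proof -
  obtain p' r where p': "p' \<in> reduced" "p - p' = r * (Var 0 * M - P)" using reduce_ex[OF assms(1)] by blast
  obtain q' r' where q': "q' \<in> reduced" "q - q' = r' * (Var 0 * M - P)" using reduce_ex[OF assms(2)] by blast
  have "iota (p - p') = 0" "iota (q - q') = 0"
    unfolding p'(2) q'(2) by (simp_all only: iota.hom_mult iota_relation mult_zero_right)
  then have "iota p' = iota q'" using assms(3) by (simp add: iota.hom_diff)
  then have eq: "p' = q'" using iota_inj_on_reduced p'(1) q'(1) by (auto simp: inj_on_def)
  have "ev v p = ev v q" if v: "v \<in> V" for v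
  proof -
    have "ev v (p - p') = 0" "ev v (q - q') = 0"
      unfolding p'(2) q'(2) by (simp_all only: ev_simps(2) relation_on_V[OF v] mult_zero_right)
    then show ?thesis using eq by (simp add: ev_simps)
  qed
  then show ?thesis by (auto simp: poly_fun_def)
qed

text \<open>After clearing denominators, the difference is a polynomial in \<open>y\<close> and \<open>z\<close> that vanishes wherever \<open>M\<close> does not,
  hence is 0.\<close>

lemma iota_eqI_poly_fun:
  assumes "p \<in> mpolys {..<m + 2}" "q \<in> mpolys {..<m + 2}" "poly_fun V p = poly_fun V q"
  shows "iota p = iota q"
proof -
  have "p - q \<in> mpolys {..<m + 2}" using assms by (intro diff_in_mpolys)
  then obtain N g r where g: "g \<in> mpolys {1..m + 1}" "M ^ N * (p - q) - g = r * (Var 0 * M - P)"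
    using clear_denominators by blast
  have "g * M = 0"
  proof (rule ccontr)
    assume "g * M \<noteq> 0"
    then obtain v where "ev v (g * M) \<noteq> 0" using mpoly_nonvanishing_point by blast
    then have v: "ev v g \<noteq> 0" "ev v M \<noteq> 0" by (auto simp: ev_simps)
    \<comment> \<open>Over a point with \<open>M \<noteq> 0\<close> the value of \<open>x\<close> is determined by the equation.\<close>
    define w where "w = (\<lambda>i\<in>{..<m + 2}. if i = 0 then ev v P / ev v M else v i)"
    have wv: "ev w f = ev v f" if "f \<in> mpolys {1..m + 1}" for f
      by (rule mpoly_eval_cong[OF that]) (auto simp: w_def)
    have M1: "M \<in> mpolys {1..m + 1}" by (rule mpolys_mono[OF _ M_in]) auto
    have "ev w (Var 0 * M - P) = 0"
      using v by (simp add: ev_simps wv[OF M1] wv[OF P_in]) (simp add: w_def)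
    moreover have "w \<in> {..<m + 2} \<rightarrow>\<^sub>E UNIV" by (auto simp: w_def)
    ultimately have wV: "w \<in> V" by (simp add: dan_variety_def ev_simps ev_M)
    have "ev w p = ev w q" using fun_cong[OF assms(3), of w] wV by simp
    moreover have "ev w (M ^ N * (p - q) - g) = 0"
      unfolding g(2) by (simp only: ev_simps(2) relation_on_V[OF wV] mult_zero_right)
    ultimately have "ev w g = 0" by (simp add: ev_simps)
    then show False using v(1) wv[OF g(1)] by simp
  qed
  then have "g = 0" using M_nonzero by simp
  then have "M ^ N * (p - q) = r * (Var 0 * M - P)" using g(2) by simp
  then have "iota M ^ N * (iota p - iota q) = 0"
    by (metis iota.hom_mult iota.hom_power iota.hom_diff iota_relation mult_zero_right)
  then show ?thesis using iota_M_nonzero by simp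
qed

text \<open>The isomorphism of the algebra of functions with \<open>B\<close>.\<close>

definition J :: "((nat \<Rightarrow> 'a) \<Rightarrow> 'a) \<Rightarrow> 'a mpoly fract poly" where
  "J f = iota (SOME p. p \<in> mpolys {..<m + 2} \<and> f = poly_fun V p)"

definition Jinv :: "'a mpoly fract poly \<Rightarrow> ((nat \<Rightarrow> 'a) \<Rightarrow> 'a)" where
  "Jinv f = poly_fun V (SOME p. p \<in> mpolys {..<m + 2} \<and> f = iota p)"

lemma J_poly_fun: "p \<in> mpolys {..<m + 2} \<Longrightarrow> J (poly_fun V p) = iota p"
proof -
  assume p: "p \<in> mpolys {..<m + 2}"
  define q where "q = (SOME q. q \<in> mpolys {..<m + 2} \<and> poly_fun V p = poly_fun V q)"
  have "q \<in> mpolys {..<m + 2} \<and> poly_fun V p = poly_fun V q"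
    unfolding q_def by (rule someI[of _ p]) (use p in simp)
  then show ?thesis unfolding J_def q_def[symmetric] using iota_eqI_poly_fun[OF p] by metis
qed

lemma Jinv_iota: "p \<in> mpolys {..<m + 2} \<Longrightarrow> Jinv (iota p) = poly_fun V p"
proof -
  assume p: "p \<in> mpolys {..<m + 2}"
  define q where "q = (SOME q. q \<in> mpolys {..<m + 2} \<and> iota p = iota q)"
  have "q \<in> mpolys {..<m + 2} \<and> iota p = iota q"
    unfolding q_def by (rule someI[of _ p]) (use p in simp)
  then show ?thesis unfolding Jinv_def q_def[symmetric] using poly_fun_eqI_iota[OF p] by metis
qed

lemma A_cases:
  assumes "f \<in> carrier A"
  obtains p where "p \<in> mpolys {..<m + 2}" "f = poly_fun V p"
  using assms by (auto simp: coord_algebra_simps)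

lemma B_cases:
  assumes "f \<in> B"
  obtains p where "p \<in> mpolys {..<m + 2}" "f = iota p"
  using assms by (auto simp: B_def)

lemma J_closed: "f \<in> carrier A \<Longrightarrow> J f \<in> B"
  by (elim A_cases) (simp add: J_poly_fun iota_in_B)

lemma Jinv_closed: "f \<in> B \<Longrightarrow> Jinv f \<in> carrier A"
  by (elim B_cases) (simp add: Jinv_iota poly_fun_in)

lemma J_Jinv: "f \<in> B \<Longrightarrow> J (Jinv f) = f"
  by (elim B_cases) (simp add: Jinv_iota J_poly_fun)

lemma Jinv_J: "f \<in> carrier A \<Longrightarrow> Jinv (J f) = f"
  by (elim A_cases) (simp add: Jinv_iota J_poly_fun)

lemma J_inj: "f \<in> carrier A \<Longrightarrow> g \<in> carrier A \<Longrightarrow> J f = J g \<Longrightarrow> f = g"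
  by (metis Jinv_J)

lemma J_add: "f \<in> carrier A \<Longrightarrow> g \<in> carrier A \<Longrightarrow> J (f \<oplus>\<^bsub>A\<^esub> g) = J f + J g"
  by (elim A_cases) (simp only: poly_fun_hom(1)[symmetric] J_poly_fun add_in_mpolys iota.hom_add)

lemma J_mult: "f \<in> carrier A \<Longrightarrow> g \<in> carrier A \<Longrightarrow> J (f \<otimes>\<^bsub>A\<^esub> g) = J f * J g"
  by (elim A_cases) (simp only: poly_fun_hom(2)[symmetric] J_poly_fun mult_in_mpolys iota.hom_mult)

lemma J_smult: "f \<in> carrier A \<Longrightarrow> J (c \<odot>\<^bsub>A\<^esub> f) = pconst c * J f"
  by (elim A_cases)
     (simp only: poly_fun_hom(5)[symmetric] J_poly_fun mult_in_mpolys Const_in_mpolys iota.hom_mult iota_Const)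

lemma J_zero: "J \<zero>\<^bsub>A\<^esub> = 0"
  by (simp only: poly_fun_hom(4)[symmetric] J_poly_fun zero_in_mpolys iota.hom_zero)

lemma A_closed:
  "f \<in> carrier A \<Longrightarrow> g \<in> carrier A \<Longrightarrow> f \<oplus>\<^bsub>A\<^esub> g \<in> carrier A"
  "f \<in> carrier A \<Longrightarrow> g \<in> carrier A \<Longrightarrow> f \<otimes>\<^bsub>A\<^esub> g \<in> carrier A"
  "f \<in> carrier A \<Longrightarrow> c \<odot>\<^bsub>A\<^esub> f \<in> carrier A"
  "\<zero>\<^bsub>A\<^esub> \<in> carrier A"
  by (elim A_cases; simp only: poly_fun_hom[symmetric] poly_fun_in add_in_mpolys mult_in_mpolys
        Const_in_mpolys zero_in_mpolys)+
     (simp only: poly_fun_hom(4)[symmetric] poly_fun_in zero_in_mpolys)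

subsection \<open>Automorphisms of the algebra and of the variety\<close>

lemma alg_hom_lift:
  assumes "B_aut \<phi>"
  shows "alg_hom (m + 2) V (\<lambda>f. Jinv (\<phi> (J f)))"
proof -
  have B: "\<phi> f \<in> B" if "f \<in> B" for f using assms that by (auto simp: B_aut_def bij_betw_def)
  have fun_eq: "Jinv (\<phi> (J (poly_fun V p))) = poly_fun V p'"
    if "p \<in> mpolys {..<m + 2}" "p' \<in> mpolys {..<m + 2}" "\<phi> (iota p) = iota p'" for p p'
    using that by (simp add: J_poly_fun Jinv_iota)
  have "Jinv (\<phi> (J (poly_fun V (p + q)))) v = Jinv (\<phi> (J (poly_fun V p))) v + Jinv (\<phi> (J (poly_fun V q))) v \<and>
    Jinv (\<phi> (J (poly_fun V (p * q)))) v = Jinv (\<phi> (J (poly_fun V p))) v * Jinv (\<phi> (J (poly_fun V q))) v"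
    if pq: "p \<in> mpolys {..<m + 2}" "q \<in> mpolys {..<m + 2}" and v: "v \<in> V" for p q v
  proof -
    obtain p' where p': "p' \<in> mpolys {..<m + 2}" "\<phi> (iota p) = iota p'"
      using B_cases[OF B[OF iota_in_B[OF pq(1)]]] by blast
    obtain q' where q': "q' \<in> mpolys {..<m + 2}" "\<phi> (iota q) = iota q'"
      using B_cases[OF B[OF iota_in_B[OF pq(2)]]] by blast
    have "\<phi> (iota (p + q)) = iota (p' + q')" "\<phi> (iota (p * q)) = iota (p' * q')"
      using assms p' q' pq by (simp_all add: B_aut_def iota.hom_add iota.hom_mult iota_in_B)
    then show ?thesis
      using pq p' q' v
      by (simp only: fun_eq[of p p'] fun_eq[of q q'] fun_eq[of "p + q" "p' + q'"] fun_eq[of "p * q" "p' * q'"]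
          add_in_mpolys mult_in_mpolys poly_fun_apply ev_simps)
  qed
  moreover have "Jinv (\<phi> (J (poly_fun V (Const c)))) v = c" if "v \<in> V" for c v
    using that assms fun_eq[of "Const c" "Const c"] by (simp add: B_aut_def ev_simps)
  ultimately show ?thesis
    unfolding alg_hom_def by (intro conjI ballI allI Jinv_closed B J_closed) blast+
qed

lemma B_aut_realized:
  assumes "B_aut \<phi>"
  shows "\<exists>a\<in>carrier W. \<forall>f\<in>carrier A. induced_aut V a f = Jinv (\<phi> (J f))"
proof (rule aff.algebra_automorphism_induced)
  let ?\<psi> = "inv_into B \<phi>"
  have bij: "bij_betw \<phi> B B" using assms by (simp add: B_aut_def)
  then have 1: "?\<psi> (\<phi> f) = f" "\<phi> (?\<psi> f) = f" "?\<psi> f \<in> B" "\<phi> f \<in> B" if "f \<in> B" for f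
    using that by (auto simp: bij_betw_def f_inv_into_f inv_into_into)
  show "alg_hom (m + 2) V (\<lambda>f. Jinv (\<phi> (J f)))" by (rule alg_hom_lift[OF assms])
  show "alg_hom (m + 2) V (\<lambda>f. Jinv (?\<psi> (J f)))" by (rule alg_hom_lift[OF B_aut_inv_into[OF assms]])
  show "Jinv (?\<psi> (J (Jinv (\<phi> (J f))))) = f" "Jinv (\<phi> (J (Jinv (?\<psi> (J f))))) = f" if "f \<in> carrier A" for f
    using that by (simp_all add: J_Jinv 1 J_closed Jinv_J)
qed

text \<open>The automorphism of the variety that induces \<open>\<phi>\<close>.\<close>

definition realize :: "('a mpoly fract poly \<Rightarrow> 'a mpoly fract poly) \<Rightarrow> ((nat \<Rightarrow> 'a) \<Rightarrow> nat \<Rightarrow> 'a)" where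
  "realize \<phi> = (SOME a. a \<in> carrier W \<and>
     (\<forall>f\<in>carrier A. induced_aut V a f = Jinv (\<phi> (J f))))"

lemma realize:
  assumes "B_aut \<phi>"
  shows "realize \<phi> \<in> carrier W"
    "f \<in> carrier A \<Longrightarrow> J (induced_aut V (realize \<phi>) f) = \<phi> (J f)"
proof -
  have *: "realize \<phi> \<in> carrier W \<and>
      (\<forall>f\<in>carrier A. induced_aut V (realize \<phi>) f = Jinv (\<phi> (J f)))"
  proof -
    have "\<exists>a. a \<in> carrier W \<and> (\<forall>f\<in>carrier A. induced_aut V a f = Jinv (\<phi> (J f)))"
      using B_aut_realized[OF assms] by blast
    from someI_ex[OF this] show ?thesis unfolding realize_def .
  qed
  then show "realize \<phi> \<in> carrier W" by blast
  show "J (induced_aut V (realize \<phi>) f) = \<phi> (J f)" if "f \<in> carrier A"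
    using * that assms J_closed[OF that] by (simp add: J_Jinv B_aut_def bij_betw_def) (metis J_Jinv imageI)
qed

lemma Aut_eqI:
  assumes "a \<in> carrier W" "b \<in> carrier W"
    and "\<And>f. f \<in> carrier A \<Longrightarrow> J (induced_aut V a f) = J (induced_aut V b f)"
  shows "a = b"
  by (rule induced_aut_inj[OF aff.V_ext assms(1,2)]) (use assms in \<open>auto intro!: J_inj induced_aut_closed\<close>)

lemma realize_comp:
  assumes "B_aut \<phi>" "B_aut \<psi>" "B_aut \<chi>" "\<And>f. f \<in> B \<Longrightarrow> \<chi> f = \<phi> (\<psi> f)"
  shows "realize \<chi> = realize \<phi> \<otimes>\<^bsub>W\<^esub> realize \<psi>"
proof (rule Aut_eqI)
  interpret group "W" by (rule variety_Aut_group[OF aff.V_ext])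
  show "realize \<chi> \<in> carrier W" by (rule realize assms)+
  show "realize \<phi> \<otimes>\<^bsub>W\<^esub> realize \<psi> \<in> carrier W"
    by (intro m_closed realize assms)
  fix f assume f: "f \<in> carrier A"
  then have "induced_aut V (realize \<psi>) f \<in> carrier A"
    by (intro induced_aut_closed realize assms)
  then show "J (induced_aut V (realize \<chi>) f) =
      J (induced_aut V (realize \<phi> \<otimes>\<^bsub>W\<^esub> realize \<psi>) f)"
    using f assms by (simp add: induced_aut_mult realize J_closed)
qed

lemma induced_B_aut:
  assumes a: "a \<in> carrier W"
  shows "B_aut (\<lambda>f. J (induced_aut V a (Jinv f)))"
proof -
  interpret group "W" by (rule variety_Aut_group[OF aff.V_ext])
  let ?b = "inv\<^bsub>W\<^esub> a"
  have b: "?b \<in> carrier W" using a by simp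
  have id: "induced_aut V \<one>\<^bsub>W\<^esub> f = f" if f: "f \<in> carrier A" for f
  proof (rule extensionalityI)
    show "induced_aut V \<one>\<^bsub>W\<^esub> f \<in> extensional V" by (simp add: induced_aut_def)
    show "f \<in> extensional V" by (rule coord_algebra_extensional[OF f])
    fix v assume v: "v \<in> V"
    have "inv_into V (\<lambda>v\<in>V. v) v = v" by (rule inv_into_f_eq) (use v in \<open>auto simp: inj_on_def\<close>)
    then show "induced_aut V \<one>\<^bsub>W\<^esub> f v = f v"
      using v by (simp add: induced_aut_def variety_Aut_def BijGroup_def)
  qed
  have ab: "induced_aut V a (induced_aut V ?b f) = f" "induced_aut V ?b (induced_aut V a f) = f"
    if "f \<in> carrier A" for f
    by (simp_all only: induced_aut_mult[OF a b, symmetric] induced_aut_mult[OF b a, symmetric]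
        r_inv[OF a] l_inv[OF a] id[OF that])
  have cl: "induced_aut V c f \<in> carrier A" if "c \<in> carrier W" "f \<in> carrier A" for c f
    using that by (rule induced_aut_closed)
  have inV: "inv_into V a v \<in> V" if "v \<in> V" for v
    using a that by (intro Bij_inv_into_mem) (auto simp: variety_Aut_def)
  have hom: "induced_aut V a (f \<oplus>\<^bsub>A\<^esub> g) = induced_aut V a f \<oplus>\<^bsub>A\<^esub> induced_aut V a g"
    "induced_aut V a (f \<otimes>\<^bsub>A\<^esub> g) = induced_aut V a f \<otimes>\<^bsub>A\<^esub> induced_aut V a g" for f g
    by (auto simp: induced_aut_def coord_algebra_simps inV intro!: restrict_ext)
  have Jinv_hom: "Jinv (f + g) = Jinv f \<oplus>\<^bsub>A\<^esub> Jinv g" "Jinv (f * g) = Jinv f \<otimes>\<^bsub>A\<^esub> Jinv g"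
    if "f \<in> B" "g \<in> B" for f g
    using that by (auto intro!: J_inj A_closed Jinv_closed B_add B_mult simp: J_add J_mult J_Jinv B_add B_mult Jinv_closed)
  have "bij_betw (\<lambda>f. J (induced_aut V a (Jinv f))) B B"
    by (rule bij_betwI[where g = "\<lambda>f. J (induced_aut V ?b (Jinv f))"])
       (use a b in \<open>auto simp: Jinv_J J_Jinv Jinv_closed J_closed cl ab\<close>)
  moreover have "J (induced_aut V a (Jinv (pconst c))) = pconst c" for c
  proof -
    have "induced_aut V a (poly_fun V (Const c)) = poly_fun V (Const c)"
      by (auto simp: induced_aut_def poly_fun_def ev_simps inV)
    then show ?thesis using Jinv_iota[of "Const c"] J_poly_fun[of "Const c"] by simp
  qed
  ultimately show ?thesis
    using a by (simp add: B_aut_def Jinv_hom hom J_add J_mult cl Jinv_closed)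
qed

subsection \<open>The embedding into the rational functions\<close>

text \<open>Reading the variable of the polynomial ring as a rational function turns \<open>B\<close> into the image of the
  embedding \<open>dan_embedding\<close>.\<close>

definition zeta :: "'a mpoly fract poly \<Rightarrow> 'a mpoly fract" where
  "zeta f = poly f (rat_var (m + 1))"

lemma zeta_hom: "ring_map zeta"
  by standard (auto simp: zeta_def)

lemma zeta_yz: "p \<in> mpolys {1..m + 1} \<Longrightarrow> zeta (iota p) = Fract p 1"
proof (rule mpoly_eval_hom_unique[where h = "\<lambda>p. zeta (iota p)" and h' = "\<lambda>p. Fract p 1" and S = "{1..m + 1}"])
  show "ring_map (\<lambda>p. zeta (iota p))"
    by (rule ring_map_comp[OF zeta_hom]) unfold_locales
  show "ring_map (\<lambda>p :: 'a mpoly. Fract p 1)" by (rule Fract_1_hom)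
  show "zeta (iota (Const a)) = Fract (Const a) 1" for a
    by (simp add: zeta_def pconst_def rat_const_def)
  show "zeta (iota (Var i)) = Fract (Var i) 1" if "i \<in> {1..m + 1}" for i
    using that by (cases "i = m + 1") (auto simp: zeta_def gen_z gen_y rat_var_def)
qed

lemma zeta_x: "zeta (gen 0) = Fract P M"
proof -
  have "zeta (gen 0) = Fract 1 M * zeta (iota P)"
    by (simp add: gen_x zeta_def iota_P)
  then show ?thesis by (simp add: zeta_yz[OF P_in])
qed

lemma zeta_iota:
  "p \<in> mpolys {..<m + 2} \<Longrightarrow> zeta (iota p) = mpoly_eval rat_const (rat_var(0 := Fract P M)) p"
proof (rule mpoly_eval_hom_unique[where h = "\<lambda>p. zeta (iota p)" and S = "{..<m + 2}"
      and h' = "mpoly_eval rat_const (rat_var(0 := Fract P M))"])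
  show "ring_map (\<lambda>p. zeta (iota p))"
    by (rule ring_map_comp[OF zeta_hom]) unfold_locales
  show "ring_map (mpoly_eval rat_const (rat_var(0 := Fract P M)))"
    by (rule ring_map.eval_ring_map[OF rat_const_hom])
  show "zeta (iota (Const a)) = mpoly_eval rat_const (rat_var(0 := Fract P M)) (Const a)" for a
    by (simp add: zeta_def pconst_def ring_map.eval_Const[OF rat_const_hom])
  show "zeta (iota (Var i)) = mpoly_eval rat_const (rat_var(0 := Fract P M)) (Var i)"
    if "i \<in> {..<m + 2}" for i
  proof (cases "i = 0")
    case True
    then show ?thesis by (simp add: zeta_x ring_map.eval_Var[OF rat_const_hom])
  next
    case False
    then have "(Var i :: 'a mpoly) \<in> mpolys {1..m + 1}" using that by auto
    then show ?thesis using False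
      by (simp only: zeta_yz ring_map.eval_Var[OF rat_const_hom]) (simp add: rat_var_def)
  qed
qed

lemma zeta_clear:
  assumes "f \<in> B"
  shows "\<exists>N. \<exists>q\<in>mpolys {1..m + 1}. iota M ^ N * f = iota q"
proof -
  obtain p where p: "p \<in> mpolys {..<m + 2}" "f = iota p" using B_cases[OF assms] by blast
  obtain N q r where q: "q \<in> mpolys {1..m + 1}" "M ^ N * p - q = r * (Var 0 * M - P)"
    using clear_denominators[OF p(1)] by blast
  have "iota (M ^ N * p - q) = 0" unfolding q(2) by (simp only: iota.hom_mult iota_relation mult_zero_right)
  then have "iota M ^ N * f = iota q" by (simp add: iota.hom_diff iota.hom_mult iota.hom_power p(2))
  then show ?thesis using q(1) by blast
qed

text \<open>A nonzero polynomial over \<open>F\<close> may vanish at \<open>z\<close>; but a power of \<open>M\<close> brings an element of \<open>B\<close> into \<open>K[y, z]\<close>, where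
  nothing is lost.\<close>

lemma zeta_eq_0:
  assumes "f \<in> B" "zeta f = 0"
  shows "f = 0"
proof -
  obtain N q where q: "q \<in> mpolys {1..m + 1}" "iota M ^ N * f = iota q" using zeta_clear[OF assms(1)] by blast
  have "zeta (iota q) = 0" unfolding q(2)[symmetric] using assms(2) by (simp add: zeta_def)
  then have "q = 0" by (simp add: zeta_yz[OF q(1)] lex.Fract_eq_0_iff)
  then have "iota M ^ N * f = 0" using q(2) by (simp add: iota.hom_zero)
  then show ?thesis using iota_M_nonzero by simp
qed

lemma zeta_inj: "f \<in> B \<Longrightarrow> g \<in> B \<Longrightarrow> zeta f = zeta g \<Longrightarrow> f = g"
  using zeta_eq_0[of "f - g"] by (simp add: B_diff ring_map.hom_diff[OF zeta_hom])

lemma dan_embedding_eq: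
  assumes "f \<in> carrier A"
  shows "dan_embedding m k P f = zeta (J f)"
proof -
  obtain p where p: "p \<in> mpolys {..<m + 2}" "f = poly_fun V p" using A_cases[OF assms] by blast
  show ?thesis
    unfolding dan_embedding_def
  proof (rule the_equality)
    show "\<exists>p\<in>mpolys {..<m + 2}. f = poly_fun V p \<and> zeta (J f) = mpoly_eval rat_const (rat_var(0 := Fract P M)) p"
      using p by (intro bexI[of _ p]) (simp_all add: J_poly_fun zeta_iota)
    fix r assume "\<exists>p\<in>mpolys {..<m + 2}. f = poly_fun V p \<and> r = mpoly_eval rat_const (rat_var(0 := Fract P M)) p"
    then show "r = zeta (J f)" by (auto simp: J_poly_fun zeta_iota)
  qed
qed

end

section \<open>The big unipotent subgroup\<close>

lemma smult_sum_right: "smult a (sum f S) = (\<Sum>x\<in>S. smult a (f x))"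
  by (induction S rule: infinite_finite_induct) (auto simp: smult_add_right)

lemma pderiv_iter_pCons:
  "(pderiv ^^ n) (pCons a p) = (if n = 0 then pCons a p else
     pCons 0 ((pderiv ^^ n) p) + smult (of_nat n) ((pderiv ^^ (n - 1)) (p :: 'b::field_char_0 poly)))"
proof (induction n)
  case (Suc n)
  show ?case
  proof (cases n)
    case 0
    then show ?thesis by (simp add: pderiv_pCons)
  next
    case (Suc n')
    then show ?thesis using Suc.IH
      by (simp add: pderiv_pCons pderiv_add pderiv_smult smult_add_left algebra_simps numeral_poly)
  qed
qed simp

text \<open>The Taylor expansion of \<open>f (z + h)\<close>.\<close>

lemma taylor_pcompose:
  fixes f :: "'b::field_char_0 poly"
  assumes "degree f \<le> N"
  shows "pcompose f [:h, 1:] = (\<Sum>n\<le>N. smult (h ^ n / fact n) ((pderiv ^^ n) f))"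
  using assms
proof (induction f arbitrary: N)
  case 0
  have "(pderiv ^^ n) 0 = (0 :: 'b poly)" for n by (induction n) auto
  then show ?case by simp
next
  case (pCons a p)
  show ?case
  proof (cases "p = 0")
    case True
    have "(pderiv ^^ n) [:a:] = (if n = 0 then [:a:] else 0)" for n
    proof (cases n)
      case (Suc n')
      have "(pderiv ^^ n') 0 = (0 :: 'b poly)" by (induction n') auto
      then show ?thesis using Suc by (simp add: funpow_swap1)
    qed simp
    then have "(\<Sum>n\<le>N. smult (h ^ n / fact n) ((pderiv ^^ n) [:a:])) = (\<Sum>n\<le>N. if n = 0 then [:a:] else 0)"
      by (intro sum.cong) auto
    then show ?thesis using True by simp
  next
    case False
    then obtain K where K: "N = Suc K" "degree p \<le> K"
      using pCons.prems by (cases N) auto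
    let ?c = "\<lambda>n. h ^ n / fact n :: 'b" and ?p = "\<lambda>n. (pderiv ^^ n) p"
    have c: "smult (?c (Suc n)) (smult (of_nat (Suc n)) q) = smult h (smult (?c n) q)" for n and q :: "'b poly"
    proof -
      have "of_nat (Suc n) \<noteq> (0 :: 'b)" by (simp only: of_nat_eq_0_iff)
      then have "?c (Suc n) * of_nat (Suc n) = h * ?c n" by (simp add: fact_Suc del: of_nat_Suc)
      then show ?thesis by (simp only: smult_smult)
    qed
    have "(\<Sum>n\<le>N. smult (?c n) ((pderiv ^^ n) (pCons a p))) =
        pCons a p + (\<Sum>n\<le>K. smult (?c (Suc n)) (pCons 0 (?p (Suc n)) + smult (of_nat (Suc n)) (?p n)))"
      unfolding K(1) sum.atMost_Suc_shift by (simp only: pderiv_iter_pCons) simp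
    also have "\<dots> = [:a:] + ((pCons 0 (smult (?c 0) (?p 0)) + (\<Sum>n\<le>K. pCons 0 (smult (?c (Suc n)) (?p (Suc n))))) +
        smult h (\<Sum>n\<le>K. smult (?c n) (?p n)))"
      by (simp only: smult_add_right sum.distrib c smult_sum_right) simp
    also have "pCons 0 (smult (?c 0) (?p 0)) + (\<Sum>n\<le>K. pCons 0 (smult (?c (Suc n)) (?p (Suc n)))) =
        (\<Sum>n\<le>N. pCons 0 (smult (?c n) (?p n)))"
      unfolding K(1) sum.atMost_Suc_shift ..
    also have "\<dots> = [:0, 1:] * (\<Sum>n\<le>N. smult (?c n) (?p n))"
      by (simp add: sum_distrib_left)
    also have "(\<Sum>n\<le>N. smult (?c n) (?p n)) = pcompose p [:h, 1:]"
      by (rule pCons.IH[symmetric]) (use K in simp)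
    also have "(\<Sum>n\<le>K. smult (?c n) (?p n)) = pcompose p [:h, 1:]"
      by (rule pCons.IH[symmetric]) (rule K(2))
    finally show ?thesis by (simp add: pcompose_pCons algebra_simps)
  qed
qed

context danielewski
begin

subsection \<open>The canonical derivation on the coordinate algebra\<close>

text \<open>The derivation \<open>M d/dz\<close>, carried over to the functions on the variety.\<close>

definition D0 :: "((nat \<Rightarrow> 'a) \<Rightarrow> 'a) \<Rightarrow> ((nat \<Rightarrow> 'a) \<Rightarrow> 'a)" where
  "D0 = (\<lambda>a\<in>carrier A. Jinv (dz (J a)))"

lemma D0_closed: "a \<in> carrier A \<Longrightarrow> D0 a \<in> carrier A"
  by (simp add: D0_def Jinv_closed dz_closed J_closed)

lemma J_D0: "a \<in> carrier A \<Longrightarrow> J (D0 a) = dz (J a)"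
  by (simp add: D0_def J_Jinv dz_closed J_closed)

lemma D0_LND: "LND A D0"
proof -
  have "D0 \<in> carrier A \<rightarrow>\<^sub>E carrier A" using D0_closed by (auto simp: D0_def)
  moreover have "D0 (a \<oplus>\<^bsub>A\<^esub> b) = D0 a \<oplus>\<^bsub>A\<^esub> D0 b" "D0 (c \<odot>\<^bsub>A\<^esub> a) = c \<odot>\<^bsub>A\<^esub> D0 a"
    "D0 (a \<otimes>\<^bsub>A\<^esub> b) = (D0 a \<otimes>\<^bsub>A\<^esub> b) \<oplus>\<^bsub>A\<^esub> (a \<otimes>\<^bsub>A\<^esub> D0 b)"
    if "a \<in> carrier A" "b \<in> carrier A" for a b c
    by (rule J_inj; simp add: that A_closed D0_closed J_D0 J_add J_mult J_smult dz_add dz_mult dz_pconst)+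
  ultimately have der: "derivation A D0" using A_closed unfolding derivation_def by blast
  have iter: "(D0 ^^ n) a \<in> carrier A \<and> J ((D0 ^^ n) a) = (dz ^^ n) (J a)" if "a \<in> carrier A" for n a
    by (induction n) (auto simp: that D0_closed J_D0)
  have "\<exists>n. (D0 ^^ n) a = \<zero>\<^bsub>A\<^esub>" if a: "a \<in> carrier A" for a
  proof -
    have "J ((D0 ^^ Suc (degree (J a))) a) = J \<zero>\<^bsub>A\<^esub>"
      using iter[OF a] dz_nilpotent[of "J a"] J_zero by metis
    then show ?thesis using iter[OF a] A_closed(4) J_inj by blast
  qed
  then show ?thesis using der by (simp add: LND_def)
qed

lemma derivation_eqI:
  assumes "B_derivation D" "B_derivation D'" "\<And>i. i < m + 2 \<Longrightarrow> D (gen i) = D' (gen i)" "f \<in> B"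
  shows "D f = D' f"
proof -
  have "D (iota p) = D' (iota p)" if "p \<in> mpolys {..<m + 2}" for p
    using that
  proof (induction rule: mpolys_induct)
    case (Const a)
    then show ?case using assms by (simp add: B_derivation_const)
  next
    case (Var i)
    then show ?case using assms(3) by simp
  next
    case (add p q)
    then show ?case
      using assms by (simp add: iota.hom_add B_derivation_simps(2) iota_in_B)
  next
    case (mult p q)
    then show ?case
      using assms by (simp add: iota.hom_mult B_derivation_simps(4) iota_in_B)
  qed
  then show ?thesis using assms(4) by (auto simp: B_def)
qed

text \<open>A derivation is determined by its values at the coordinates.\<close>

lemma canonical_LND_eq: "canonical_LND m k P = D0"
  unfolding canonical_LND_def
proof (rule the_equality)
  have Vi: "(Var i :: 'a mpoly) \<in> mpolys {..<m + 2}" if "i < m + 2" for i using that by simp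
  have JV: "J (poly_fun V (Var i)) = gen i" if "i < m + 2" for i using J_poly_fun[OF Vi[OF that]] by simp
  have c: "poly_fun V (Var i) \<in> carrier A" if "i < m + 2" for i by (rule poly_fun_in[OF Vi[OF that]])
  have diff: "mpoly_diff (m + 1) P \<in> mpolys {..<m + 2}" by (rule mpoly_diff_in_mpolys[OF P_in'])
  have eq: "D0 (poly_fun V (Var i)) = poly_fun V q"
    if "i < m + 2" "q \<in> mpolys {..<m + 2}" "dz (gen i) = iota q" for i q
    by (rule J_inj) (simp_all add: D0_closed c poly_fun_in J_D0 JV J_poly_fun that)
  have y: "D0 (poly_fun V (Var i)) = \<zero>\<^bsub>A\<^esub>" if "i \<in> {1..m}" for i
    using eq[of i 0] that by (simp add: dz_y iota.hom_zero poly_fun_hom(4)[symmetric])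
  have z: "D0 (poly_fun V (Var (m + 1))) = poly_fun V M"
    using eq[of "m + 1" M] dz_z M_in' by simp
  have x: "D0 (poly_fun V (Var 0)) = poly_fun V (mpoly_diff (m + 1) P)"
    using eq[of 0 "mpoly_diff (m + 1) P"] dz_x diff by simp
  show "LND A D0 \<and> (\<forall>i\<in>{1..m}. D0 (poly_fun V (Var i)) = \<zero>\<^bsub>A\<^esub>) \<and>
      D0 (poly_fun V (Var (m + 1))) = poly_fun V M \<and>
      D0 (poly_fun V (Var 0)) = poly_fun V (mpoly_diff (m + 1) P)"
    using D0_LND y z x by blast
  fix D assume D: "LND A D \<and> (\<forall>i\<in>{1..m}. D (poly_fun V (Var i)) = \<zero>\<^bsub>A\<^esub>) \<and>
      D (poly_fun V (Var (m + 1))) = poly_fun V M \<and>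
      D (poly_fun V (Var 0)) = poly_fun V (mpoly_diff (m + 1) P)"
  then have der: "derivation A D" by (simp add: LND_def)
  then have Dc: "D a \<in> carrier A" if "a \<in> carrier A" for a using that by (auto simp: derivation_def)
  have Jinv_hom: "Jinv (f + g) = Jinv f \<oplus>\<^bsub>A\<^esub> Jinv g" "Jinv (f * g) = Jinv f \<otimes>\<^bsub>A\<^esub> Jinv g"
    "Jinv (pconst c * f) = c \<odot>\<^bsub>A\<^esub> Jinv f"
    if "f \<in> B" "g \<in> B" for f g c
    using that by (auto intro!: J_inj A_closed Jinv_closed B_add B_mult B_pconst
        simp: J_add J_mult J_smult J_Jinv B_add B_mult B_pconst Jinv_closed)
  have B_der: "B_derivation (\<lambda>f. J (D (Jinv f)))"
    using der unfolding B_derivation_def derivation_def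
    by (auto simp: Jinv_hom Dc Jinv_closed J_closed J_add J_mult J_smult J_Jinv A_closed)
  have agree: "J (D (Jinv (gen i))) = dz (gen i)" if i: "i < m + 2" for i
  proof -
    have Jg: "Jinv (gen i) = poly_fun V (Var i)" using Jinv_iota[OF Vi[OF i]] by simp
    consider "i = 0" | "i = m + 1" | "i \<in> {1..m}" using i by force
    then have "D (poly_fun V (Var i)) = D0 (poly_fun V (Var i))"
      by cases (use D x y z in auto)
    then show ?thesis using J_D0[OF c[OF i]] JV[OF i] Jg by simp
  qed
  show "D = D0"
  proof (rule extensionalityI)
    show "D \<in> extensional (carrier A)" using der by (auto simp: derivation_def PiE_def)
    show "D0 \<in> extensional (carrier A)" by (simp add: D0_def)
    fix a assume a: "a \<in> carrier A"
    have "J (D (Jinv (J a))) = dz (J a)"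
      by (rule derivation_eqI[OF B_der dz_derivation agree J_closed[OF a]])
    then show "D a = D0 a" using a by (intro J_inj) (simp_all add: Dc D0_closed Jinv_J J_D0)
  qed
qed

subsection \<open>Exponentials are translations of z\<close>

definition shift :: "'a mpoly \<Rightarrow> 'a mpoly fract poly \<Rightarrow> 'a mpoly fract poly" where
  "shift r f = pcompose f [:Fract (M * r) 1, 1:]"

lemma A_abelian_monoid: "abelian_monoid A"
proof (rule abelian_monoidI)
  fix a b c assume abc: "a \<in> carrier A" "b \<in> carrier A" "c \<in> carrier A"
  show "a \<oplus>\<^bsub>A\<^esub> b \<oplus>\<^bsub>A\<^esub> c = a \<oplus>\<^bsub>A\<^esub> (b \<oplus>\<^bsub>A\<^esub> c)"
    by (rule J_inj) (simp_all add: abc A_closed J_add add.assoc)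
qed (auto intro!: J_inj simp: A_closed J_add J_zero add.commute)

lemma J_finsum:
  assumes "finite S" "\<And>n. n \<in> S \<Longrightarrow> g n \<in> carrier A"
  shows "finsum A g S \<in> carrier A \<and> J (finsum A g S) = (\<Sum>n\<in>S. J (g n))"
proof -
  interpret abelian_monoid A by (rule A_abelian_monoid)
  show ?thesis
    using assms
  proof (induction S)
    case empty
    then show ?case by (simp add: J_zero)
  next
    case (insert x S)
    then have "finsum A g (insert x S) = g x \<oplus>\<^bsub>A\<^esub> finsum A g S"
      by (intro finsum_insert) auto
    then show ?case using insert by (simp add: A_closed J_add)
  qed
qed

text \<open>The automorphism \<open>z \<mapsto> z + M r\<close>, acting on functions.\<close>

definition U_elt :: "'a mpoly \<Rightarrow> ((nat \<Rightarrow> 'a) \<Rightarrow> 'a) \<Rightarrow> ((nat \<Rightarrow> 'a) \<Rightarrow> 'a)" where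
  "U_elt r = (\<lambda>a\<in>carrier A. Jinv (shift r (J a)))"

text \<open>The kernel element \<open>c\<close> corresponds to \<open>r \<in> K[y]\<close>, so that \<open>c D\<^sub>0\<close> is \<open>M r d/dz\<close>; its exponential series at \<open>f\<close> is
  the Taylor expansion of \<open>f (z + M r)\<close>.  In particular the translation preserves \<open>B\<close>.\<close>

lemma exp_shift:
  assumes r: "r \<in> mpolys {1..m}" and c: "c \<in> carrier A" "J c = iota r"
  shows "exp_LND A (\<lambda>a\<in>carrier A. c \<otimes>\<^bsub>A\<^esub> D0 a) = U_elt r"
    "a \<in> carrier A \<Longrightarrow> shift r (J a) \<in> B"
proof -
  let ?D = "\<lambda>a\<in>carrier A. c \<otimes>\<^bsub>A\<^esub> D0 a" and ?h = "Fract (M * r) 1 :: 'a mpoly fract"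
  have Mr: "iota M * iota r = [:?h:]" by (simp add: iota_y[OF M_in] iota_y[OF r])
  have D: "?D a \<in> carrier A" "J (?D a) = smult ?h (pderiv (J a))" if "a \<in> carrier A" for a
  proof -
    show "?D a \<in> carrier A" using that c by (simp add: A_closed D0_closed)
    have "J (?D a) = (iota M * iota r) * pderiv (J a)"
      using that c by (simp add: D0_closed J_mult J_D0 dz_def mult_ac)
    then show "J (?D a) = smult ?h (pderiv (J a))" unfolding Mr by simp
  qed
  have iter: "(?D ^^ n) a \<in> carrier A \<and> J ((?D ^^ n) a) = smult (?h ^ n) ((pderiv ^^ n) (J a))"
    if a: "a \<in> carrier A" for n a
  proof (induction n)
    case (Suc n)
    then show ?case using D[of "(?D ^^ n) a"] by (simp only: funpow.simps comp_apply) (simp add: pderiv_smult)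
  qed (simp add: a)
  have main: "exp_LND A ?D a \<in> carrier A \<and> J (exp_LND A ?D a) = shift r (J a)" if a: "a \<in> carrier A" for a
  proof -
    let ?S = "{n. (?D ^^ n) a \<noteq> \<zero>\<^bsub>A\<^esub>}" and ?N = "degree (J a)"
    have zero_iff: "(?D ^^ n) a = \<zero>\<^bsub>A\<^esub> \<longleftrightarrow> smult (?h ^ n) ((pderiv ^^ n) (J a)) = 0" for n
      using iter[OF a, of n] J_inj[OF _ A_closed(4), of "(?D ^^ n) a"] J_zero by metis
    have "degree ((pderiv ^^ n) (J a)) = ?N - n" for n
      by (induction n) (auto simp: degree_pderiv)
    then have "(pderiv ^^ Suc ?N) (J a) = 0" by (simp add: pderiv_eq_0_iff)
    then have big0: "(pderiv ^^ n) (J a) = 0" if "n > ?N" for n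
    proof -
      define j where "j = n - Suc ?N"
      have j: "n = j + Suc ?N" using that by (simp add: j_def)
      have "(pderiv ^^ j) 0 = (0 :: 'a mpoly fract poly)" by (induction j) auto
      then show ?thesis
        unfolding j funpow_add comp_apply \<open>(pderiv ^^ Suc ?N) (J a) = 0\<close> .
    qed
    have sub: "?S \<subseteq> {..?N}"
    proof
      fix n assume "n \<in> ?S"
      then have "smult (?h ^ n) ((pderiv ^^ n) (J a)) \<noteq> 0" using zero_iff by blast
      then have "(pderiv ^^ n) (J a) \<noteq> 0" by (metis smult_0_right)
      then show "n \<in> {..?N}" using big0[of n] by (metis atMost_iff not_le)
    qed
    then have fin: "finite ?S" by (rule finite_subset) simp
    have summand: "J ((1 / fact n) \<odot>\<^bsub>A\<^esub> (?D ^^ n) a) = smult (?h ^ n / fact n) ((pderiv ^^ n) (J a))" for n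
    proof -
      have "rat_const (1 / fact n) = (1 / fact n :: 'a mpoly fract)"
      proof -
        have "rat_const (1 / fact n) * (rat_const (fact n) :: 'a mpoly fract) = 1"
          using ring_map.hom_mult[OF rat_const_hom, of "1 / fact n" "fact n"]
          by (simp add: ring_map.hom_one[OF rat_const_hom])
        moreover have "rat_const (fact n) = (fact n :: 'a mpoly fract)"
          by (metis ring_map.hom_of_nat[OF rat_const_hom] of_nat_fact)
        ultimately show ?thesis by (simp add: field_simps)
      qed
      then show ?thesis using iter[OF a, of n] by (simp add: J_smult pconst_def)
    qed
    have fs: "finsum A (\<lambda>n. (1 / fact n) \<odot>\<^bsub>A\<^esub> (?D ^^ n) a) ?S \<in> carrier A \<and>
        J (finsum A (\<lambda>n. (1 / fact n) \<odot>\<^bsub>A\<^esub> (?D ^^ n) a) ?S) =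
          (\<Sum>n\<in>?S. J ((1 / fact n) \<odot>\<^bsub>A\<^esub> (?D ^^ n) a))"
      by (rule J_finsum[OF fin]) (use iter[OF a] A_closed(3) in blast)
    have "(\<Sum>n\<in>?S. J ((1 / fact n) \<odot>\<^bsub>A\<^esub> (?D ^^ n) a)) =
        (\<Sum>n\<in>?S. smult (?h ^ n / fact n) ((pderiv ^^ n) (J a)))" by (simp only: summand)
    also have "\<dots> = (\<Sum>n\<le>?N. smult (?h ^ n / fact n) ((pderiv ^^ n) (J a)))"
    proof (rule sum.mono_neutral_left[OF _ sub], simp, intro ballI)
      fix n assume "n \<in> {..?N} - ?S"
      then have "smult (?h ^ n) ((pderiv ^^ n) (J a)) = 0" using zero_iff by blast
      then show "smult (?h ^ n / fact n) ((pderiv ^^ n) (J a)) = 0" by auto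
    qed
    also have "\<dots> = shift r (J a)" unfolding shift_def by (rule taylor_pcompose[symmetric]) simp
    finally show ?thesis using fs a by (simp add: exp_LND_def)
  qed
  show "a \<in> carrier A \<Longrightarrow> shift r (J a) \<in> B" using main[of a] J_closed by metis
  show "exp_LND A ?D = U_elt r"
  proof (rule extensionalityI)
    show "exp_LND A ?D \<in> extensional (carrier A)" by (simp add: exp_LND_def)
    show "U_elt r \<in> extensional (carrier A)" by (simp add: U_elt_def)
    fix a assume a: "a \<in> carrier A"
    then show "exp_LND A ?D a = U_elt r a"
      using main[OF a] Jinv_J[of "exp_LND A ?D a"] by (simp add: U_elt_def)
  qed
qed

lemma shift_B:
  assumes "r \<in> mpolys {1..m}" "f \<in> B"
  shows "shift r f \<in> B"
  using exp_shift(2)[OF assms(1) Jinv_closed[OF iota_y_B[OF assms(1)]] J_Jinv[OF iota_y_B[OF assms(1)]]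
      Jinv_closed[OF assms(2)]] J_Jinv[OF assms(2)] by simp

lemma shift_shift: "shift r (shift r' f) = shift (r + r') f"
proof -
  have "shift r (shift r' f) = pcompose f (pcompose [:Fract (M * r') 1, 1:] [:Fract (M * r) 1, 1:])"
    by (simp only: shift_def pcompose_assoc)
  also have "pcompose [:Fract (M * r') 1, 1:] [:Fract (M * r) 1, 1:] = [:Fract (M * (r + r')) (1 :: 'a mpoly), 1:]"
    by (simp add: pcompose_pCons algebra_simps)
  finally show ?thesis by (simp only: shift_def)
qed

lemma shift_0: "shift 0 f = f"
  by (simp add: shift_def fract_collapse pcompose_idR)

lemma shift_z: "shift r (gen (m + 1)) = gen (m + 1) + [:Fract (M * r) 1:]"
  by (simp add: shift_def gen_z pcompose_pCons)

lemma shift_degree_0: "degree f = 0 \<Longrightarrow> shift r f = f"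
  unfolding shift_def by (metis degree_eq_zeroE pcompose_const)

lemma shift_B_aut: "r \<in> mpolys {1..m} \<Longrightarrow> B_aut (shift r)"
proof -
  assume r: "r \<in> mpolys {1..m}"
  have "shift r (shift (- r) f) = f" "shift (- r) (shift r f) = f" for f
    by (simp_all add: shift_shift shift_0)
  then have "bij_betw (shift r) B B"
    by (intro bij_betwI[where g = "shift (- r)"]) (use shift_B[OF r] shift_B[OF uminus_in_mpolys[OF r]] in auto)
  then show ?thesis
    by (simp add: B_aut_def) (simp add: shift_def pcompose_add pcompose_mult pconst_def pcompose_const)
qed

abbreviation U :: "(((nat \<Rightarrow> 'a) \<Rightarrow> 'a) \<Rightarrow> ((nat \<Rightarrow> 'a) \<Rightarrow> 'a)) monoid" where
  "U \<equiv> big_unipotent A (canonical_LND m k P)"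

lemma U_carrier: "carrier U = U_elt ` mpolys {1..m}"
proof -
  have "carrier U = {exp_LND A (\<lambda>a\<in>carrier A. f \<otimes>\<^bsub>A\<^esub> D0 a) | f. f \<in> derivation_Ker A D0}"
    by (simp add: big_unipotent_def canonical_LND_eq)
  also have "\<dots> = U_elt ` mpolys {1..m}"
  proof safe
    fix c assume "c \<in> derivation_Ker A D0"
    then have c: "c \<in> carrier A" "D0 c = \<zero>\<^bsub>A\<^esub>" by (auto simp: derivation_Ker_def)
    then have "dz (J c) = 0" using J_D0[OF c(1)] J_zero by simp
    then obtain r where "r \<in> mpolys {1..m}" "J c = iota r"
      using B_degree_0[OF J_closed[OF c(1)]] by (auto simp: dz_eq_0_iff)
    then show "exp_LND A (\<lambda>a\<in>carrier A. c \<otimes>\<^bsub>A\<^esub> D0 a) \<in> U_elt ` mpolys {1..m}"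
      using exp_shift(1) c(1) by blast
  next
    fix r :: "'a mpoly" assume r: "r \<in> mpolys {1..m}"
    let ?c = "Jinv (iota r)"
    have c: "?c \<in> carrier A" "J ?c = iota r" using iota_y_B[OF r] by (auto simp: Jinv_closed J_Jinv)
    have "J (D0 ?c) = J \<zero>\<^bsub>A\<^esub>"
      using c by (simp add: J_D0 J_zero dz_eq_0_iff iota_y[OF r])
    then have "D0 ?c = \<zero>\<^bsub>A\<^esub>" using c by (intro J_inj) (auto simp: D0_closed A_closed)
    then have "?c \<in> derivation_Ker A D0" using c by (simp add: derivation_Ker_def)
    then show "\<exists>f. U_elt r = exp_LND A (\<lambda>a\<in>carrier A. f \<otimes>\<^bsub>A\<^esub> D0 a) \<and> f \<in> derivation_Ker A D0"
      using exp_shift(1)[OF r c] by metis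
  qed
  finally show ?thesis .
qed

lemma U_elt_apply: "r \<in> mpolys {1..m} \<Longrightarrow> a \<in> carrier A \<Longrightarrow> U_elt r a \<in> carrier A \<and> J (U_elt r a) = shift r (J a)"
  by (simp add: U_elt_def Jinv_closed J_Jinv shift_B J_closed)

lemma U_elt_comp:
  assumes "r \<in> mpolys {1..m}" "r' \<in> mpolys {1..m}"
  shows "compose (carrier A) (U_elt r) (U_elt r') = U_elt (r + r')"
proof (rule extensionalityI)
  show "compose (carrier A) (U_elt r) (U_elt r') \<in> extensional (carrier A)" by (simp add: compose_def)
  show "U_elt (r + r') \<in> extensional (carrier A)" by (simp add: U_elt_def)
  fix a assume a: "a \<in> carrier A"
  then show "compose (carrier A) (U_elt r) (U_elt r') a = U_elt (r + r') a"
    using U_elt_apply[OF assms(2) a] U_elt_apply[OF assms(1), of "U_elt r' a"]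
      U_elt_apply[OF add_in_mpolys[OF assms] a]
    by (intro J_inj) (simp_all add: compose_def shift_shift)
qed

lemma U_elt_0: "U_elt 0 = (\<lambda>a\<in>carrier A. a)"
  by (auto simp: U_elt_def shift_0 Jinv_J)

lemma U_elt_Bij: "r \<in> mpolys {1..m} \<Longrightarrow> U_elt r \<in> Bij (carrier A)"
proof -
  assume r: "r \<in> mpolys {1..m}"
  have inv: "U_elt (- r) (U_elt r a) = a" "U_elt r (U_elt (- r) a) = a" if "a \<in> carrier A" for a
    using fun_cong[OF U_elt_comp[OF uminus_in_mpolys[OF r] r], of a]
      fun_cong[OF U_elt_comp[OF r uminus_in_mpolys[OF r]], of a] that
    by (simp_all add: compose_def U_elt_0)
  have "bij_betw (U_elt r) (carrier A) (carrier A)"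
    by (rule bij_betwI[where g = "U_elt (- r)"]) (use inv r in \<open>auto simp: U_elt_apply uminus_in_mpolys\<close>)
  then show ?thesis by (simp add: Bij_def U_elt_def)
qed

lemma U_mult:
  assumes "r \<in> mpolys {1..m}" "r' \<in> mpolys {1..m}"
  shows "U_elt r \<otimes>\<^bsub>U\<^esub> U_elt r' = U_elt (r + r')"
  using U_elt_Bij[OF assms(1)] U_elt_Bij[OF assms(2)] U_elt_comp[OF assms]
  by (simp add: big_unipotent_def BijGroup_def)

lemma U_one: "\<one>\<^bsub>U\<^esub> = U_elt 0"
  by (simp add: big_unipotent_def BijGroup_def U_elt_0)

lemma U_group: "group U"
proof (rule groupI)
  fix x assume "x \<in> carrier U"
  then obtain r where r: "r \<in> mpolys {1..m}" "x = U_elt r" by (auto simp: U_carrier)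
  then have "U_elt (- r) \<otimes>\<^bsub>U\<^esub> x = \<one>\<^bsub>U\<^esub>"
    by (simp add: U_mult uminus_in_mpolys U_one)
  then show "\<exists>y\<in>carrier U. y \<otimes>\<^bsub>U\<^esub> x = \<one>\<^bsub>U\<^esub>"
    using r by (auto simp: U_carrier uminus_in_mpolys)
qed (auto simp: U_carrier U_mult U_one add_in_mpolys add.assoc)

text \<open>Each element of the unipotent group is an automorphism of the algebra; this is the automorphism of the variety
  that induces it.\<close>

definition \<mu> :: "(((nat \<Rightarrow> 'a) \<Rightarrow> 'a) \<Rightarrow> ((nat \<Rightarrow> 'a) \<Rightarrow> 'a)) \<Rightarrow> ((nat \<Rightarrow> 'a) \<Rightarrow> nat \<Rightarrow> 'a)" where
  "\<mu> u = realize (\<lambda>f. J (u (Jinv f)))"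

lemma mu_U_elt:
  assumes r: "r \<in> mpolys {1..m}"
  shows "\<mu> (U_elt r) \<in> carrier W"
    "f \<in> carrier A \<Longrightarrow> J (induced_aut V (\<mu> (U_elt r)) f) = shift r (J f)"
proof -
  have eq: "J (U_elt r (Jinv f)) = shift r f" if "f \<in> B" for f
    using U_elt_apply[OF r Jinv_closed[OF that]] that by (simp add: J_Jinv)
  have "B_aut (\<lambda>f. J (U_elt r (Jinv f)))"
    using shift_B_aut[OF r] bij_betw_cong[of B "\<lambda>f. J (U_elt r (Jinv f))" "shift r" B] eq
    by (simp add: B_aut_def B_add B_mult B_pconst)
  note R = realize[OF this]
  show "\<mu> (U_elt r) \<in> carrier W" unfolding \<mu>_def by (rule R(1))
  show "J (induced_aut V (\<mu> (U_elt r)) f) = shift r (J f)" if "f \<in> carrier A"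
    unfolding \<mu>_def using R(2)[OF that] eq[OF J_closed[OF that]] by simp
qed

lemma mu_hom: "\<mu> \<in> hom U W"
proof (rule homI)
  show "\<mu> u \<in> carrier W" if "u \<in> carrier U" for u
    using that mu_U_elt(1) by (auto simp: U_carrier)
  fix u u' assume "u \<in> carrier U" "u' \<in> carrier U"
  then obtain r r' where r: "r \<in> mpolys {1..m}" "u = U_elt r" and r': "r' \<in> mpolys {1..m}" "u' = U_elt r'"
    by (auto simp: U_carrier)
  interpret group "W" by (rule variety_Aut_group[OF aff.V_ext])
  show "\<mu> (u \<otimes>\<^bsub>U\<^esub> u') = \<mu> u \<otimes>\<^bsub>W\<^esub> \<mu> u'"
    unfolding r(2) r'(2) U_mult[OF r(1) r'(1)]
  proof (rule Aut_eqI)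
    show "\<mu> (U_elt (r + r')) \<in> carrier W"
      by (intro mu_U_elt add_in_mpolys r r')
    show "\<mu> (U_elt r) \<otimes>\<^bsub>W\<^esub> \<mu> (U_elt r') \<in> carrier W"
      by (intro m_closed mu_U_elt r r')
    fix f assume f: "f \<in> carrier A"
    then have f': "induced_aut V (\<mu> (U_elt r')) f \<in> carrier A"
      by (intro induced_aut_closed mu_U_elt r')
    show "J (induced_aut V (\<mu> (U_elt (r + r'))) f) =
        J (induced_aut V (\<mu> (U_elt r) \<otimes>\<^bsub>W\<^esub> \<mu> (U_elt r')) f)"
      by (simp only: induced_aut_mult[OF mu_U_elt(1)[OF r(1)] mu_U_elt(1)[OF r'(1)]]
          mu_U_elt(2)[OF add_in_mpolys[OF r(1) r'(1)] f] mu_U_elt(2)[OF r(1) f'] mu_U_elt(2)[OF r'(1) f] shift_shift)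
  qed
qed

lemma shift_inj:
  assumes "shift r (gen (m + 1)) = shift r' (gen (m + 1))"
  shows "r = r'"
  using assms M_nonzero unfolding shift_z by simp

lemma mu_inj: "inj_on \<mu> (carrier U)"
proof (rule inj_onI)
  fix u u' assume "u \<in> carrier U" "u' \<in> carrier U" and eq: "\<mu> u = \<mu> u'"
  then obtain r r' where r: "r \<in> mpolys {1..m}" "u = U_elt r" and r': "r' \<in> mpolys {1..m}" "u' = U_elt r'"
    by (auto simp: U_carrier)
  have z: "gen (m + 1) \<in> B" by (intro B_gen) simp
  have "shift r (J (Jinv (gen (m + 1)))) = shift r' (J (Jinv (gen (m + 1))))"
    using mu_U_elt(2)[OF r(1) Jinv_closed[OF z]] mu_U_elt(2)[OF r'(1) Jinv_closed[OF z]] eq r(2) r'(2) by simp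
  then have "r = r'" unfolding J_Jinv[OF z] by (rule shift_inj)
  then show "u = u'" using r r' by simp
qed

end

section \<open>The monomial group and its action\<close>

lemma Units_field: "Units (ring_of_type_algebra :: 'a::field ring) = {x. x \<noteq> 0}"
  by (auto simp: Units_def ring_of_type_algebra_def intro: exI[of _ "inverse _"])
     (metis field_class.field_inverse mult.commute)

lemma torus_carrier:
  "t \<in> carrier (torus n :: (nat \<Rightarrow> 'a::field) monoid) \<longleftrightarrow> t \<in> extensional {1..n} \<and> (\<forall>i\<in>{1..n}. t i \<noteq> 0)"
  by (auto simp: torus_def units_of_def Units_field PiE_iff)

lemma torus_mult: "t \<otimes>\<^bsub>torus n\<^esub> t' = (\<lambda>i\<in>{1..n}. t i * t' i)"
  by (simp add: torus_def units_of_def ring_of_type_algebra_def)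

lemma torus_one: "\<one>\<^bsub>torus n\<^esub> = (\<lambda>i\<in>{1..n}. 1)"
  by (simp add: torus_def units_of_def ring_of_type_algebra_def)

lemma torus_group: "group (torus n :: (nat \<Rightarrow> 'a::field) monoid)"
proof -
  have "ring (ring_of_type_algebra :: 'a ring)"
    using field_from_type_algebra[where 'a = 'a] by (simp add: field_def domain_def cring_def)
  then have "group (units_of (ring_of_type_algebra :: 'a ring))"
    by (intro monoid.units_group) (simp add: ring_def)
  then show ?thesis unfolding torus_def by (intro product_group)
qed

lemma stabilizer_carrier:
  "\<sigma> \<in> carrier (monom_stabilizer TYPE('a::field) m k) \<longleftrightarrow>
    \<sigma> permutes {1..m} \<and> (\<Prod>i=1..m. Var (\<sigma> i) ^ k i :: 'a mpoly) = dan_monom m k"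
  by (auto simp: monom_stabilizer_def sym_group_def)

lemma stabilizer_subgroup:
  "subgroup (carrier (monom_stabilizer TYPE('a::field) m k)) (sym_group m)"
proof -
  interpret group "sym_group m" by (rule sym_group_is_group)
  define sub :: "(nat \<Rightarrow> nat) \<Rightarrow> 'a mpoly \<Rightarrow> 'a mpoly" where "sub \<sigma> = mpoly_eval Const (\<lambda>i. Var (\<sigma> i))" for \<sigma>
  have sub: "sub \<sigma> (\<Prod>i=1..m. Var (\<tau> i) ^ k i) = (\<Prod>i=1..m. Var (\<sigma> (\<tau> i)) ^ k i)" for \<sigma> \<tau>
    by (simp add: sub_def ring_map.eval_prod[OF Const_hom] ring_map.eval_power[OF Const_hom]
        ring_map.eval_Var[OF Const_hom])
  have subM: "sub \<sigma> (dan_monom m k) = (\<Prod>i=1..m. Var (\<sigma> i) ^ k i)" for \<sigma>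
    using sub[of \<sigma> id] by (simp add: dan_monom_def)
  show ?thesis
  proof (rule subgroupI)
    show "carrier (monom_stabilizer TYPE('a) m k) \<subseteq> carrier (sym_group m)"
      by (auto simp: monom_stabilizer_def)
    have "id \<in> carrier (monom_stabilizer TYPE('a) m k)"
      by (simp add: stabilizer_carrier permutes_id dan_monom_def)
    then show "carrier (monom_stabilizer TYPE('a) m k) \<noteq> {}" by blast
  next
    fix \<sigma> assume s: "\<sigma> \<in> carrier (monom_stabilizer TYPE('a) m k)"
    then have p: "\<sigma> permutes {1..m}" and e: "(\<Prod>i=1..m. Var (\<sigma> i) ^ k i :: 'a mpoly) = dan_monom m k"
      by (auto simp: stabilizer_carrier)
    have "(\<Prod>i=1..m. Var (inv' \<sigma> i) ^ k i) = sub (inv' \<sigma>) (\<Prod>i=1..m. Var (\<sigma> i) ^ k i)"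
      using e subM by simp
    also have "\<dots> = dan_monom m k"
      unfolding sub using permutes_inverses(2)[OF p] by (simp add: dan_monom_def)
    finally show "inv\<^bsub>sym_group m\<^esub> \<sigma> \<in> carrier (monom_stabilizer TYPE('a) m k)"
      using permutes_inv[OF p] p by (simp add: stabilizer_carrier sym_group_carrier)
  next
    fix \<sigma> \<tau> assume "\<sigma> \<in> carrier (monom_stabilizer TYPE('a) m k)" "\<tau> \<in> carrier (monom_stabilizer TYPE('a) m k)"
    then show "\<sigma> \<otimes>\<^bsub>sym_group m\<^esub> \<tau> \<in> carrier (monom_stabilizer TYPE('a) m k)"
      using sub[of \<sigma> \<tau>] subM[of \<sigma>] permutes_compose[of \<tau> "{1..m}" \<sigma>]
      by (simp add: stabilizer_carrier sym_group_mult)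
  qed
qed

lemma stabilizer_eq:
  "monom_stabilizer TYPE('a::field) m k = (sym_group m)\<lparr>carrier := carrier (monom_stabilizer TYPE('a) m k)\<rparr>"
  by (simp add: monom_stabilizer_def)

lemma stabilizer_group: "group (monom_stabilizer TYPE('a::field) m k)"
  using subgroup.subgroup_is_group[OF stabilizer_subgroup[where 'a = 'a] sym_group_is_group]
  by (simp only: stabilizer_eq[symmetric])

lemma stabilizer_mult: "\<sigma> \<otimes>\<^bsub>monom_stabilizer TYPE('a::field) m k\<^esub> \<tau> = \<sigma> \<circ> \<tau>"
  by (simp add: monom_stabilizer_def sym_group_mult)

lemma stabilizer_one: "\<one>\<^bsub>monom_stabilizer TYPE('a::field) m k\<^esub> = id"
  by (simp add: monom_stabilizer_def sym_group_one)

lemma stabilizer_inv: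
  assumes "\<sigma> \<in> carrier (monom_stabilizer TYPE('a::field) m k)"
  shows "inv\<^bsub>monom_stabilizer TYPE('a) m k\<^esub> \<sigma> = inv' \<sigma>"
proof -
  have "inv\<^bsub>monom_stabilizer TYPE('a) m k\<^esub> \<sigma> = inv\<^bsub>sym_group m\<^esub> \<sigma>"
    by (subst stabilizer_eq) (rule group.m_inv_consistent[OF sym_group_is_group stabilizer_subgroup assms])
  then show ?thesis using assms by (simp add: sym_group_carrier stabilizer_carrier)
qed

lemma permutes_extend: "\<sigma> permutes {1..m :: nat} \<Longrightarrow> \<sigma> permutes {1..m + 1}"
  by (rule permutes_subset) auto

lemma torus_perm_apply:
  "t \<in> carrier (torus n) \<Longrightarrow> i \<in> {1..n} \<Longrightarrow> torus_perm n \<sigma> t i = t (inv' \<sigma> i)"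
  by (simp add: torus_perm_def)

lemma torus_perm_closed:
  assumes "\<sigma> permutes {1..n}" "t \<in> carrier (torus n :: (nat \<Rightarrow> 'a::field) monoid)"
  shows "torus_perm n \<sigma> t \<in> carrier (torus n)"
  using assms permutes_in_image[OF permutes_inv[OF assms(1)]]
  by (auto simp: torus_carrier torus_perm_def)

lemma torus_perm_comp:
  assumes "\<sigma> permutes {1..n}" "\<tau> permutes {1..n}" "t \<in> carrier (torus n :: (nat \<Rightarrow> 'a::field) monoid)"
  shows "torus_perm n \<sigma> (torus_perm n \<tau> t) = torus_perm n (\<sigma> \<circ> \<tau>) t"
proof (rule extensionalityI)
  note c = torus_perm_closed[OF assms(2,3)]
  show "torus_perm n \<sigma> (torus_perm n \<tau> t) \<in> extensional {1..n}" "torus_perm n (\<sigma> \<circ> \<tau>) t \<in> extensional {1..n}"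
    using c assms(3) by (simp_all add: torus_perm_def)
  fix i assume i: "i \<in> {1..n}"
  have "inv' \<sigma> i \<in> {1..n}" using permutes_in_image[OF permutes_inv[OF assms(1)]] i by blast
  moreover have "inv' (\<sigma> \<circ> \<tau>) = inv' \<tau> \<circ> inv' \<sigma>"
    by (rule o_inv_distrib) (use permutes_bij assms in auto)
  ultimately show "torus_perm n \<sigma> (torus_perm n \<tau> t) i = torus_perm n (\<sigma> \<circ> \<tau>) t i"
    using i c assms(3) by (simp only: torus_perm_apply comp_apply)
qed

lemma torus_perm_id:
  "t \<in> carrier (torus n :: (nat \<Rightarrow> 'a::field) monoid) \<Longrightarrow> torus_perm n id t = t"
  by (rule extensionalityI[of _ "{1..n}"]) (auto simp: torus_perm_def torus_carrier)

lemma torus_perm_hom: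
  "torus_perm (m + 1) \<in> hom (monom_stabilizer TYPE('a::field) m k) (AutoGroup (torus (m + 1) :: (nat \<Rightarrow> 'a) monoid))"
proof (rule homI)
  let ?T = "torus (m + 1) :: (nat \<Rightarrow> 'a) monoid"
  have p: "\<sigma> permutes {1..m + 1}" if "\<sigma> \<in> carrier (monom_stabilizer TYPE('a) m k)" for \<sigma>
    using that by (intro permutes_extend) (simp add: stabilizer_carrier)
  show c: "torus_perm (m + 1) \<sigma> \<in> carrier (AutoGroup ?T)" if s: "\<sigma> \<in> carrier (monom_stabilizer TYPE('a) m k)" for \<sigma>
  proof -
    note ps = p[OF s] and pi = permutes_inv[OF p[OF s]]
    have "torus_perm (m + 1) \<sigma> (t \<otimes>\<^bsub>?T\<^esub> t') = torus_perm (m + 1) \<sigma> t \<otimes>\<^bsub>?T\<^esub> torus_perm (m + 1) \<sigma> t'"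
      if t: "t \<in> carrier ?T" "t' \<in> carrier ?T" for t t'
    proof (rule extensionalityI)
      interpret group ?T by (rule torus_group)
      have tt: "t \<otimes>\<^bsub>?T\<^esub> t' \<in> carrier ?T" by (rule m_closed[OF t])
      show "torus_perm (m + 1) \<sigma> (t \<otimes>\<^bsub>?T\<^esub> t') \<in> extensional {1..m + 1}"
        "torus_perm (m + 1) \<sigma> t \<otimes>\<^bsub>?T\<^esub> torus_perm (m + 1) \<sigma> t' \<in> extensional {1..m + 1}"
        using torus_perm_closed[OF ps tt] by (simp_all add: torus_carrier torus_mult)
      fix i assume i: "i \<in> {1..m + 1}"
      have "inv' \<sigma> i \<in> {1..m + 1}" using permutes_in_image[OF pi] i by blast
      then show "torus_perm (m + 1) \<sigma> (t \<otimes>\<^bsub>?T\<^esub> t') i = (torus_perm (m + 1) \<sigma> t \<otimes>\<^bsub>?T\<^esub> torus_perm (m + 1) \<sigma> t') i"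
        using i t tt by (simp only: torus_perm_apply) (simp only: torus_mult restrict_apply' torus_perm_apply)
    qed
    moreover have "bij_betw (torus_perm (m + 1) \<sigma>) (carrier ?T) (carrier ?T)"
    proof (rule bij_betwI[where g = "torus_perm (m + 1) (inv' \<sigma>)"])
      show "torus_perm (m + 1) (inv' \<sigma>) (torus_perm (m + 1) \<sigma> t) = t"
        "torus_perm (m + 1) \<sigma> (torus_perm (m + 1) (inv' \<sigma>) t) = t" if "t \<in> carrier ?T" for t
        using that permutes_inv_o[OF ps] by (simp_all only: torus_perm_comp[OF pi ps] torus_perm_comp[OF ps pi] torus_perm_id)
    qed (use torus_perm_closed[OF ps] torus_perm_closed[OF pi] in auto)
    moreover have "torus_perm (m + 1) \<sigma> \<in> extensional (carrier ?T)" by (simp add: torus_perm_def)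
    ultimately show ?thesis
      using torus_perm_closed[OF ps] by (auto simp: AutoGroup_def auto_def Bij_def hom_def)
  qed
  fix \<sigma> \<tau> assume s: "\<sigma> \<in> carrier (monom_stabilizer TYPE('a) m k)" "\<tau> \<in> carrier (monom_stabilizer TYPE('a) m k)"
  have "torus_perm (m + 1) \<sigma> \<otimes>\<^bsub>AutoGroup ?T\<^esub> torus_perm (m + 1) \<tau> =
      compose (carrier ?T) (torus_perm (m + 1) \<sigma>) (torus_perm (m + 1) \<tau>)"
    using c[OF s(1)] c[OF s(2)] by (simp add: AutoGroup_def auto_def BijGroup_def)
  also have "\<dots> = torus_perm (m + 1) (\<sigma> \<circ> \<tau>)"
  proof (rule extensionalityI)
    fix t assume "t \<in> carrier ?T"
    then show "compose (carrier ?T) (torus_perm (m + 1) \<sigma>) (torus_perm (m + 1) \<tau>) t = torus_perm (m + 1) (\<sigma> \<circ> \<tau>) t"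
      using torus_perm_comp[OF p[OF s(1)] p[OF s(2)]] by (simp add: compose_def)
  qed (simp_all add: compose_def torus_perm_def)
  finally show "torus_perm (m + 1) (\<sigma> \<otimes>\<^bsub>monom_stabilizer TYPE('a) m k\<^esub> \<tau>) =
      torus_perm (m + 1) \<sigma> \<otimes>\<^bsub>AutoGroup ?T\<^esub> torus_perm (m + 1) \<tau>"
    by (simp add: stabilizer_mult)
qed

lemma monomial_group_group: "group (monomial_group m k :: ((nat \<Rightarrow> nat) \<times> (nat \<Rightarrow> 'a::field)) monoid)"
  unfolding monomial_group_def
  by (rule semidirect_group[OF stabilizer_group torus_group torus_perm_hom])

lemma monomial_group_carrier:
  "(\<sigma>, t) \<in> carrier (monomial_group m k :: ((nat \<Rightarrow> nat) \<times> (nat \<Rightarrow> 'a::field)) monoid) \<longleftrightarrow>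
    \<sigma> permutes {1..m} \<and> (\<Prod>i=1..m. Var (\<sigma> i) ^ k i :: 'a mpoly) = dan_monom m k \<and>
    t \<in> extensional {1..m + 1} \<and> (\<forall>i\<in>{1..m + 1}. t i \<noteq> 0)"
  by (auto simp: monomial_group_def semidirect_def stabilizer_carrier torus_carrier)

lemma monomial_group_one:
  "\<one>\<^bsub>monomial_group m k :: ((nat \<Rightarrow> nat) \<times> (nat \<Rightarrow> 'a::field)) monoid\<^esub> = (id, \<lambda>i\<in>{1..m + 1}. 1)"
  by (simp add: monomial_group_def semidirect_def stabilizer_one torus_one)

lemma monomial_group_mult:
  fixes t t' :: "nat \<Rightarrow> 'a::field"
  assumes "(\<sigma>, t) \<in> carrier (monomial_group m k)" "(\<tau>, t') \<in> carrier (monomial_group m k)"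
  shows "(\<sigma>, t) \<otimes>\<^bsub>monomial_group m k\<^esub> (\<tau>, t') = (\<sigma> \<circ> \<tau>, \<lambda>i\<in>{1..m + 1}. t (\<tau> i) * t' i)"
proof -
  have \<tau>: "\<tau> permutes {1..m}" and \<tau>s: "\<tau> \<in> carrier (monom_stabilizer TYPE('a) m k)"
    and t: "t \<in> carrier (torus (m + 1))"
    using assms unfolding monomial_group_carrier stabilizer_carrier torus_carrier by blast+
  have "inv' (inv' \<tau>) = \<tau>" by (rule inv_inv_eq) (rule permutes_bij[OF \<tau>])
  then have "torus_perm (m + 1) (inv' \<tau>) t \<otimes>\<^bsub>torus (m + 1)\<^esub> t' = (\<lambda>i\<in>{1..m + 1}. t (\<tau> i) * t' i)"
    using t unfolding torus_mult by (intro restrict_ext) (simp only: torus_perm_apply)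
  then show ?thesis
    using \<tau>s by (simp add: monomial_group_def semidirect_def stabilizer_mult stabilizer_inv)
qed

subsection \<open>Substitution in rational functions\<close>

text \<open>The monomial action on polynomials, where no denominators have to be avoided.\<close>

definition msub :: "(nat \<Rightarrow> nat) \<Rightarrow> (nat \<Rightarrow> 'a::field) \<Rightarrow> 'a mpoly \<Rightarrow> 'a mpoly" where
  "msub \<sigma> t = mpoly_eval Const (\<lambda>i. Const (t i) * Var (\<sigma> i))"

lemma msub_hom: "ring_map (msub \<sigma> t)"
  unfolding msub_def by (rule ring_map.eval_ring_map[OF Const_hom])

lemma msub_Const [simp]: "msub \<sigma> t (Const c) = Const c"
  and msub_Var [simp]: "msub \<sigma> t (Var i) = Const (t i) * Var (\<sigma> i)"
  by (simp_all add: msub_def ring_map.eval_Const[OF Const_hom] ring_map.eval_Var[OF Const_hom])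

lemma msub_in:
  assumes "\<sigma> permutes S" "p \<in> mpolys S"
  shows "msub \<sigma> t p \<in> mpolys S"
  unfolding msub_def
  by (rule mpoly_eval_in_mpolys[OF assms(2)])
     (use permutes_in_image[OF assms(1)] in \<open>auto intro!: mult_in_mpolys\<close>)

lemma msub_comp:
  assumes "p \<in> mpolys S" "\<And>i. i \<in> S \<Longrightarrow> u i = t (\<tau> i) * t' i"
  shows "msub \<sigma> t (msub \<tau> t' p) = msub (\<sigma> \<circ> \<tau>) u p"
proof (rule mpoly_eval_hom_unique[OF _ _ assms(1)])
  show "ring_map (\<lambda>p. msub \<sigma> t (msub \<tau> t' p))" by (rule ring_map_comp[OF msub_hom msub_hom])
  show "ring_map (msub (\<sigma> \<circ> \<tau>) u)" by (rule msub_hom)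
  show "msub \<sigma> t (msub \<tau> t' (Var i)) = msub (\<sigma> \<circ> \<tau>) u (Var i)" if "i \<in> S" for i
    using assms(2)[OF that]
    by (simp add: ring_map.hom_mult[OF msub_hom] ring_map.hom_mult[OF Const_hom] mult_ac)
qed simp

lemma msub_id: "p \<in> mpolys S \<Longrightarrow> (\<And>i. i \<in> S \<Longrightarrow> t i = 1) \<Longrightarrow> msub id t p = p"
  by (rule mpoly_eval_hom_unique[OF msub_hom, where h' = "\<lambda>p. p" and S = S])
     (auto simp: ring_map.hom_one[OF Const_hom] intro: id_hom)

lemma msub_inverse:
  assumes "\<sigma> permutes S" "\<And>i. i \<in> S \<Longrightarrow> t i \<noteq> 0" "p \<in> mpolys S"
  shows "msub (inv' \<sigma>) (\<lambda>i. inverse (t (inv' \<sigma> i))) (msub \<sigma> t p) = p"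
proof -
  have "msub (inv' \<sigma>) (\<lambda>i. inverse (t (inv' \<sigma> i))) (msub \<sigma> t p) = msub (inv' \<sigma> \<circ> \<sigma>) (\<lambda>_. 1) p"
    by (rule msub_comp[OF assms(3)]) (use assms permutes_inverses(2)[OF assms(1)] in simp)
  also have "\<dots> = p" using permutes_inv_o(2)[OF assms(1)] assms(3) by (simp add: msub_id)
  finally show ?thesis .
qed

lemma msub_eq_0:
  assumes "\<sigma> permutes S" "\<And>i. i \<in> S \<Longrightarrow> t i \<noteq> 0" "p \<in> mpolys S" "msub \<sigma> t p = 0"
  shows "p = 0"
  using msub_inverse[of \<sigma> S t p, OF assms(1-3)] assms(4) by (simp add: ring_map.hom_zero[OF msub_hom])

text \<open>The substitution is injective on polynomials in the variables concerned, so denominators stay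
  nonzero and the value is the same for all admissible fractions.\<close>

lemma monomial_action_Fract:
  assumes \<sigma>: "\<sigma> permutes {1..m + 1}" and t: "\<And>i. i \<in> {1..m + 1} \<Longrightarrow> t i \<noteq> 0"
    and pq: "p \<in> mpolys {1..m + 1}" "q \<in> mpolys {1..m + 1}" "q \<noteq> 0"
  shows "monomial_action m (\<sigma>, t) (Fract p q) = Fract (msub \<sigma> t p) (msub \<sigma> t q)" "msub \<sigma> t q \<noteq> 0"
proof -
  let ?w = "\<lambda>i. rat_const (t i) * rat_var (\<sigma> i)"
  show nz: "msub \<sigma> t q \<noteq> 0" using msub_eq_0[of \<sigma> "{1..m + 1}" t q] \<sigma> t pq(2,3) by blast
  have ev: "mpoly_eval rat_const ?w f = Fract (msub \<sigma> t f) 1" for f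
  proof (rule mpoly_eval_hom_unique[where S = UNIV and h' = "\<lambda>f. Fract (msub \<sigma> t f) 1"])
    show "ring_map (mpoly_eval rat_const ?w)" by (rule ring_map.eval_ring_map[OF rat_const_hom])
    show "ring_map (\<lambda>f. Fract (msub \<sigma> t f) 1)" by (rule ring_map_comp[OF Fract_1_hom msub_hom])
    show "mpoly_eval rat_const ?w (Const a) = Fract (msub \<sigma> t (Const a)) 1" for a
      unfolding ring_map.eval_Const[OF rat_const_hom] by (simp add: rat_const_def)
    show "mpoly_eval rat_const ?w (Var i) = Fract (msub \<sigma> t (Var i)) 1" for i
      unfolding ring_map.eval_Var[OF rat_const_hom] by (simp add: rat_const_def rat_var_def)
  qed (simp add: mpolys_def)
  have "rat_subst ?w (Fract p q) = Fract (msub \<sigma> t p) (msub \<sigma> t q)"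
    unfolding rat_subst_def ev
  proof (rule the_equality)
    show "\<exists>p' q'. Fract p q = Fract p' q' \<and> Fract (msub \<sigma> t q') 1 \<noteq> 0 \<and>
        Fract (msub \<sigma> t p) (msub \<sigma> t q) = Fract (msub \<sigma> t p') 1 / Fract (msub \<sigma> t q') 1"
      using nz by (intro exI[of _ p] exI[of _ q]) (simp add: lex.Fract_eq_0_iff)
    fix c assume "\<exists>p' q'. Fract p q = Fract p' q' \<and> Fract (msub \<sigma> t q') 1 \<noteq> 0 \<and>
        c = Fract (msub \<sigma> t p') 1 / Fract (msub \<sigma> t q') 1"
    then obtain p' q' where c: "Fract p q = Fract p' q'" "Fract (msub \<sigma> t q') 1 \<noteq> 0"
      "c = Fract (msub \<sigma> t p') 1 / Fract (msub \<sigma> t q') 1" by blast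
    then have nz': "msub \<sigma> t q' \<noteq> 0" by (simp add: lex.Fract_eq_0_iff)
    then have "q' \<noteq> 0" using ring_map.hom_zero[OF msub_hom] by metis
    then have "p * q' = p' * q" using c(1) pq(3) by (simp add: eq_fract)
    then have "msub \<sigma> t p * msub \<sigma> t q' = msub \<sigma> t p' * msub \<sigma> t q"
      by (metis ring_map.hom_mult[OF msub_hom])
    then show "c = Fract (msub \<sigma> t p) (msub \<sigma> t q)" using c(3) nz nz' by (simp add: eq_fract)
  qed
  moreover have "Fract p q \<in> rat_funs {1..m + 1}" using pq by (auto simp: rat_funs_def)
  ultimately show "monomial_action m (\<sigma>, t) (Fract p q) = Fract (msub \<sigma> t p) (msub \<sigma> t q)"
    by (simp add: monomial_action_def)
qed

locale monomial_element =
  fixes m :: nat and \<sigma> :: "nat \<Rightarrow> nat" and t :: "nat \<Rightarrow> 'a::field"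
  assumes perm: "\<sigma> permutes {1..m + 1}" and t_nonzero: "\<And>i. i \<in> {1..m + 1} \<Longrightarrow> t i \<noteq> 0"
begin

lemma action_Fract:
  assumes "p \<in> mpolys {1..m + 1}" "q \<in> mpolys {1..m + 1}" "q \<noteq> 0"
  shows "monomial_action m (\<sigma>, t) (Fract p q) = Fract (msub \<sigma> t p) (msub \<sigma> t q)" "msub \<sigma> t q \<noteq> 0"
  using monomial_action_Fract[of \<sigma> m t p q] perm t_nonzero assms by blast+

lemma rat_funs_cases:
  assumes "r \<in> rat_funs {1..m + 1}"
  obtains p q where "p \<in> mpolys {1..m + 1}" "q \<in> mpolys {1..m + 1}" "q \<noteq> 0" "r = Fract p q"
  using assms by (auto simp: rat_funs_def)

lemma action_hom:
  assumes "r \<in> rat_funs {1..m + 1}" "r' \<in> rat_funs {1..m + 1}"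
  shows "monomial_action m (\<sigma>, t) (r + r') = monomial_action m (\<sigma>, t) r + monomial_action m (\<sigma>, t) r'"
    "monomial_action m (\<sigma>, t) (r * r') = monomial_action m (\<sigma>, t) r * monomial_action m (\<sigma>, t) r'"
proof -
  obtain p q where pq: "p \<in> mpolys {1..m + 1}" "q \<in> mpolys {1..m + 1}" "q \<noteq> 0" "r = Fract p q"
    using rat_funs_cases[OF assms(1)] by blast
  obtain p' q' where pq': "p' \<in> mpolys {1..m + 1}" "q' \<in> mpolys {1..m + 1}" "q' \<noteq> 0" "r' = Fract p' q'"
    using rat_funs_cases[OF assms(2)] by blast
  note a = action_Fract[OF pq(1-3)] and a' = action_Fract[OF pq'(1-3)]
  have c: "p * q' + p' * q \<in> mpolys {1..m + 1}" "p * p' \<in> mpolys {1..m + 1}" "q * q' \<in> mpolys {1..m + 1}" "q * q' \<noteq> 0"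
    using pq pq' by (auto intro!: add_in_mpolys mult_in_mpolys)
  have e: "r + r' = Fract (p * q' + p' * q) (q * q')" "r * r' = Fract (p * p') (q * q')"
    using pq pq' by simp_all
  show "monomial_action m (\<sigma>, t) (r + r') = monomial_action m (\<sigma>, t) r + monomial_action m (\<sigma>, t) r'"
    unfolding e unfolding action_Fract(1)[OF c(1,3,4)] unfolding pq(4) pq'(4) a(1) a'(1)
    using a(2) a'(2) by (simp add: ring_map.hom_add[OF msub_hom] ring_map.hom_mult[OF msub_hom])
  show "monomial_action m (\<sigma>, t) (r * r') = monomial_action m (\<sigma>, t) r * monomial_action m (\<sigma>, t) r'"
    unfolding e unfolding action_Fract(1)[OF c(2,3,4)] unfolding pq(4) pq'(4) a(1) a'(1)
    by (simp add: ring_map.hom_mult[OF msub_hom])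
qed

lemma action_inj:
  assumes "r \<in> rat_funs {1..m + 1}" "r' \<in> rat_funs {1..m + 1}"
    "monomial_action m (\<sigma>, t) r = monomial_action m (\<sigma>, t) r'"
  shows "r = r'"
proof -
  obtain p q where pq: "p \<in> mpolys {1..m + 1}" "q \<in> mpolys {1..m + 1}" "q \<noteq> 0" "r = Fract p q"
    using rat_funs_cases[OF assms(1)] by blast
  obtain p' q' where pq': "p' \<in> mpolys {1..m + 1}" "q' \<in> mpolys {1..m + 1}" "q' \<noteq> 0" "r' = Fract p' q'"
    using rat_funs_cases[OF assms(2)] by blast
  note a = action_Fract[OF pq(1-3)] and a' = action_Fract[OF pq'(1-3)]
  have "msub \<sigma> t p * msub \<sigma> t q' = msub \<sigma> t p' * msub \<sigma> t q"
    using assms(3) a a' by (simp add: pq(4) pq'(4) eq_fract)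
  then have "msub \<sigma> t (p * q' - p' * q) = 0"
    by (simp add: ring_map.hom_diff[OF msub_hom] ring_map.hom_mult[OF msub_hom])
  then have "p * q' - p' * q = 0"
    by (rule msub_eq_0[where t = t, OF perm t_nonzero, rotated 2])
       (use pq pq' in \<open>auto intro!: diff_in_mpolys mult_in_mpolys\<close>)
  then show ?thesis using pq pq' by (simp add: eq_fract)
qed

end

lemma monomial_element_group:
  assumes "(\<sigma>, t) \<in> carrier (monomial_group m k :: ((nat \<Rightarrow> nat) \<times> (nat \<Rightarrow> 'a::field)) monoid)"
  shows "monomial_element m \<sigma> t"
proof
  show "\<sigma> permutes {1..m + 1}" using assms by (intro permutes_extend) (simp only: monomial_group_carrier)
  show "t i \<noteq> 0" if "i \<in> {1..m + 1}" for i using assms that by (simp only: monomial_group_carrier) blast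
qed

lemma monomial_action_mult:
  fixes g h :: "(nat \<Rightarrow> nat) \<times> (nat \<Rightarrow> 'a::field)"
  assumes "g \<in> carrier (monomial_group m k)" "h \<in> carrier (monomial_group m k)" "r \<in> rat_funs {1..m + 1}"
  shows "monomial_action m (g \<otimes>\<^bsub>monomial_group m k\<^esub> h) r = monomial_action m g (monomial_action m h r)"
proof -
  obtain \<sigma> t \<tau> t' where gh: "g = (\<sigma>, t)" "h = (\<tau>, t')" by (cases g; cases h) auto
  let ?u = "\<lambda>i\<in>{1..m + 1}. t (\<tau> i) * t' i"
  interpret g: monomial_element m \<sigma> t using assms(1) gh by (auto intro: monomial_element_group)
  interpret h: monomial_element m \<tau> t' using assms(2) gh by (auto intro: monomial_element_group)
  interpret G: group "monomial_group m k :: ((nat \<Rightarrow> nat) \<times> (nat \<Rightarrow> 'a)) monoid" by (rule monomial_group_group)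
  have m: "g \<otimes>\<^bsub>monomial_group m k\<^esub> h = (\<sigma> \<circ> \<tau>, ?u)"
    unfolding gh by (rule monomial_group_mult) (use assms gh in auto)
  have "(\<sigma> \<circ> \<tau>, ?u) \<in> carrier (monomial_group m k)" using G.m_closed[OF assms(1,2)] m by simp
  then interpret gh: monomial_element m "\<sigma> \<circ> \<tau>" ?u by (rule monomial_element_group)
  obtain p q where pq: "p \<in> mpolys {1..m + 1}" "q \<in> mpolys {1..m + 1}" "q \<noteq> 0" "r = Fract p q"
    using g.rat_funs_cases[OF assms(3)] by blast
  have c: "msub \<sigma> t (msub \<tau> t' f) = msub (\<sigma> \<circ> \<tau>) ?u f" if "f \<in> mpolys {1..m + 1}" for f
    by (rule msub_comp[OF that]) simp
  show ?thesis
    unfolding m unfolding gh pq(4) h.action_Fract(1)[OF pq(1-3)] gh.action_Fract(1)[OF pq(1-3)]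
    by (subst g.action_Fract(1)[OF msub_in[OF h.perm pq(1)] msub_in[OF h.perm pq(2)] h.action_Fract(2)[OF pq(1-3)]])
       (simp only: c pq)
qed

lemma monomial_action_one:
  assumes "r \<in> rat_funs {1..m + 1}"
  shows "monomial_action m \<one>\<^bsub>monomial_group m k :: ((nat \<Rightarrow> nat) \<times> (nat \<Rightarrow> 'a::field)) monoid\<^esub> r = r"
proof -
  interpret G: group "monomial_group m k :: ((nat \<Rightarrow> nat) \<times> (nat \<Rightarrow> 'a)) monoid" by (rule monomial_group_group)
  let ?u = "\<lambda>i\<in>{1..m + 1}. 1 :: 'a"
  interpret monomial_element m id ?u
    using G.one_closed unfolding monomial_group_one by (rule monomial_element_group)
  obtain p q where pq: "p \<in> mpolys {1..m + 1}" "q \<in> mpolys {1..m + 1}" "q \<noteq> 0" "r = Fract p q"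
    using rat_funs_cases[OF assms] by blast
  have "msub id ?u f = f" if "f \<in> mpolys {1..m + 1}" for f
    by (rule msub_id[OF that]) simp
  then show ?thesis unfolding monomial_group_one pq(4) action_Fract(1)[OF pq(1-3)] using pq by simp
qed

section \<open>The canonical group\<close>

context danielewski
begin

abbreviation G :: "((nat \<Rightarrow> nat) \<times> (nat \<Rightarrow> 'a)) monoid" where "G \<equiv> canonical_group m k P"
abbreviation GM :: "((nat \<Rightarrow> nat) \<times> (nat \<Rightarrow> 'a)) monoid" where "GM \<equiv> monomial_group m k"

lemma embedding_image: "dan_embedding m k P ` carrier A = zeta ` B"
proof -
  have "dan_embedding m k P ` carrier A = zeta ` J ` carrier A"
    by (auto simp: dan_embedding_eq image_image)
  also have "J ` carrier A = B" using J_closed Jinv_closed J_Jinv by (metis image_eqI image_subsetI subsetI subset_antisym)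
  finally show ?thesis .
qed

lemma G_carrier: "carrier G = {g \<in> carrier GM. monomial_action m g ` zeta ` B = zeta ` B}"
  by (simp add: canonical_group_def embedding_image)

lemma zeta_rat_funs:
  assumes "f \<in> B"
  shows "zeta f \<in> rat_funs {1..m + 1}"
proof -
  obtain N q where q: "q \<in> mpolys {1..m + 1}" "iota M ^ N * f = iota q" using zeta_clear[OF assms] by blast
  have M1: "M ^ N \<in> mpolys {1..m + 1}" by (intro power_in_mpolys mpolys_mono[OF _ M_in]) auto
  have "zeta (iota (M ^ N)) * zeta f = zeta (iota q)"
    unfolding q(2)[symmetric] by (simp add: ring_map.hom_mult[OF zeta_hom] iota.hom_power)
  then have "Fract (M ^ N) 1 * zeta f = Fract q 1" by (simp only: zeta_yz[OF M1] zeta_yz[OF q(1)])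
  then have "Fract 1 (M ^ N) * (Fract (M ^ N) 1 * zeta f) = Fract 1 (M ^ N) * Fract q 1" by simp
  moreover have "Fract 1 (M ^ N) * (Fract (M ^ N) 1 * zeta f) = zeta f"
  proof -
    have "Fract 1 (M ^ N) * Fract (M ^ N) 1 = (1 :: 'a mpoly fract)"
      using M_nonzero by (simp add: One_fract_def eq_fract)
    then show ?thesis by (simp only: mult.assoc[symmetric] mult_1_left)
  qed
  ultimately have "zeta f = Fract q (M ^ N)" by simp
  moreover have "M ^ N \<noteq> 0" using M_nonzero by simp
  ultimately show ?thesis using q(1) M1 unfolding rat_funs_def by blast
qed

lemma G_subgroup: "subgroup (carrier G) GM"
proof -
  interpret GM: group GM by (rule monomial_group_group)
  have comp: "monomial_action m (g \<otimes>\<^bsub>GM\<^esub> h) ` zeta ` B = monomial_action m g ` monomial_action m h ` zeta ` B"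
    if "g \<in> carrier GM" "h \<in> carrier GM" for g h
    unfolding image_image using monomial_action_mult[OF that zeta_rat_funs] by (intro image_cong refl) simp
  have one: "monomial_action m \<one>\<^bsub>GM\<^esub> ` zeta ` B = zeta ` B"
    unfolding image_image using monomial_action_one[OF zeta_rat_funs] by (intro image_cong refl) simp
  show ?thesis
  proof (rule GM.subgroupI)
    show "carrier G \<subseteq> carrier GM" by (auto simp: G_carrier)
    have "\<one>\<^bsub>GM\<^esub> \<in> carrier G" using one by (simp add: G_carrier)
    then show "carrier G \<noteq> {}" by blast
    fix g assume "g \<in> carrier G"
    then have g: "g \<in> carrier GM" "monomial_action m g ` zeta ` B = zeta ` B" by (auto simp: G_carrier)
    have "monomial_action m (inv\<^bsub>GM\<^esub> g) ` zeta ` B = monomial_action m (inv\<^bsub>GM\<^esub> g) ` monomial_action m g ` zeta ` B"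
      by (simp only: g(2))
    also have "\<dots> = zeta ` B" using comp[of "inv\<^bsub>GM\<^esub> g" g] g(1) one by simp
    finally show "inv\<^bsub>GM\<^esub> g \<in> carrier G" using g(1) by (simp add: G_carrier)
    fix h assume "h \<in> carrier G"
    then show "g \<otimes>\<^bsub>GM\<^esub> h \<in> carrier G" using g comp[of g h] by (simp add: G_carrier)
  qed
qed

lemma G_group: "group G"
proof -
  have "G = GM\<lparr>carrier := carrier G\<rparr>" by (simp add: canonical_group_def)
  then show ?thesis using subgroup.subgroup_is_group[OF G_subgroup monomial_group_group] by simp
qed

lemma G_mult: "g \<otimes>\<^bsub>G\<^esub> h = g \<otimes>\<^bsub>GM\<^esub> h"
  by (simp add: canonical_group_def)

text \<open>The action of the canonical group, carried back to \<open>B\<close> along the embedding.\<close>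

definition gact :: "(nat \<Rightarrow> nat) \<times> (nat \<Rightarrow> 'a) \<Rightarrow> 'a mpoly fract poly \<Rightarrow> 'a mpoly fract poly" where
  "gact g f = inv_into B zeta (monomial_action m g (zeta f))"

lemma gact:
  assumes "g \<in> carrier G" "f \<in> B"
  shows "gact g f \<in> B" "zeta (gact g f) = monomial_action m g (zeta f)"
proof -
  have "monomial_action m g (zeta f) \<in> zeta ` B" using assms by (auto simp: G_carrier)
  then show "gact g f \<in> B" "zeta (gact g f) = monomial_action m g (zeta f)"
    unfolding gact_def by (auto intro: inv_into_into f_inv_into_f)
qed

lemma G_element: "(\<sigma>, t) \<in> carrier G \<Longrightarrow> monomial_element m \<sigma> t"
  by (rule monomial_element_group) (auto simp: G_carrier)

lemma action_yz:
  assumes "monomial_element m \<sigma> t" "p \<in> mpolys {1..m + 1}"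
  shows "monomial_action m (\<sigma>, t) (Fract p 1) = Fract (msub \<sigma> t p) 1"
proof -
  interpret monomial_element m \<sigma> t by (rule assms(1))
  show ?thesis using action_Fract(1)[OF assms(2), of 1] by (simp add: ring_map.hom_one[OF msub_hom])
qed

lemma gact_B_aut:
  assumes g: "g \<in> carrier G"
  shows "B_aut (gact g)"
proof -
  obtain \<sigma> t where st: "g = (\<sigma>, t)" by (cases g)
  interpret monomial_element m \<sigma> t using g st by (auto intro: G_element)
  have add: "gact g (f + f') = gact g f + gact g f'" and mult: "gact g (f * f') = gact g f * gact g f'"
    if "f \<in> B" "f' \<in> B" for f f'
    by (rule zeta_inj; use that in \<open>simp add: gact[OF g] B_add B_mult ring_map.hom_add[OF zeta_hom]
          ring_map.hom_mult[OF zeta_hom] action_hom[OF zeta_rat_funs zeta_rat_funs] st[symmetric]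
          action_hom[OF zeta_rat_funs zeta_rat_funs, folded st]\<close>)+
  have const: "gact g (pconst c) = pconst c" for c
  proof (rule zeta_inj)
    have "zeta (pconst c) = Fract (Const c) 1" by (simp add: zeta_def pconst_def rat_const_def)
    then show "zeta (gact g (pconst c)) = zeta (pconst c)"
      using gact(2)[OF g B_pconst] action_yz[OF monomial_element_axioms, of "Const c"] st by simp
  qed (auto intro: gact g B_pconst)
  have "inj_on (gact g) B"
  proof (rule inj_onI)
    fix f f' assume f: "f \<in> B" "f' \<in> B" "gact g f = gact g f'"
    then have "monomial_action m g (zeta f) = monomial_action m g (zeta f')" using gact(2)[OF g] by metis
    then have "zeta f = zeta f'" unfolding st by (rule action_inj[OF zeta_rat_funs zeta_rat_funs, rotated 2]) (use f in auto)
    then show "f = f'" using f by (intro zeta_inj)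
  qed
  moreover have "gact g ` B = B"
  proof
    show "gact g ` B \<subseteq> B" using gact(1)[OF g] by blast
    show "B \<subseteq> gact g ` B"
    proof
      fix f assume f: "f \<in> B"
      then have "zeta f \<in> monomial_action m g ` zeta ` B" using g by (auto simp: G_carrier)
      then obtain f' where f': "f' \<in> B" "zeta f = monomial_action m g (zeta f')" by blast
      then have "f = gact g f'" using f by (intro zeta_inj) (simp_all add: gact[OF g])
      then show "f \<in> gact g ` B" using f'(1) by blast
    qed
  qed
  ultimately show ?thesis using add mult const by (simp add: B_aut_def bij_betw_def)
qed

lemma gact_gen:
  assumes g: "(\<sigma>, t) \<in> carrier G" and i: "i \<in> {1..m + 1}"
  shows "gact (\<sigma>, t) (gen i) = pconst (t i) * gen (\<sigma> i)"
proof -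
  interpret monomial_element m \<sigma> t by (rule G_element[OF g])
  have Vi: "(Var i :: 'a mpoly) \<in> mpolys {1..m + 1}" using i by simp
  have si: "\<sigma> i \<in> {1..m + 1}" using permutes_in_image[OF perm] i by blast
  then have V': "Const (t i) * Var (\<sigma> i) \<in> mpolys {1..m + 1}" by (intro mult_in_mpolys) simp_all
  have B: "gen i \<in> B" "pconst (t i) * gen (\<sigma> i) \<in> B" using i si by (auto intro!: B_gen B_mult B_pconst)
  have "zeta (gact (\<sigma>, t) (gen i)) = Fract (Const (t i) * Var (\<sigma> i)) 1"
    using gact(2)[OF g B(1)] zeta_yz[OF Vi] action_yz[OF monomial_element_axioms Vi] by simp
  also have "\<dots> = zeta (pconst (t i) * gen (\<sigma> i))"
    using zeta_yz[OF V'] by (simp add: iota.hom_mult)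
  finally show ?thesis using gact(1)[OF g B(1)] B(2) by (intro zeta_inj)
qed

lemma gact_mult:
  assumes "g \<in> carrier G" "h \<in> carrier G" "f \<in> B"
  shows "gact (g \<otimes>\<^bsub>G\<^esub> h) f = gact g (gact h f)"
proof (rule zeta_inj)
  interpret group G by (rule G_group)
  show "gact (g \<otimes>\<^bsub>G\<^esub> h) f \<in> B" "gact g (gact h f) \<in> B" using assms by (auto intro!: gact m_closed)
  have "g \<in> carrier GM" "h \<in> carrier GM" using assms by (auto simp: G_carrier)
  then show "zeta (gact (g \<otimes>\<^bsub>G\<^esub> h) f) = zeta (gact g (gact h f))"
    using assms monomial_action_mult[OF _ _ zeta_rat_funs[OF assms(3)]]
    by (simp add: gact m_closed) (simp add: G_mult)
qed

text \<open>Such an automorphism agrees with the monomial action on \<open>K[y, z]\<close>, and then on \<open>B\<close>, because a power of \<open>M\<close> brings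
  every element of \<open>B\<close> into \<open>K[y, z]\<close>.\<close>

lemma G_memI:
  assumes \<phi>: "B_aut \<phi>" and g: "(\<sigma>, t) \<in> carrier GM"
    and gens: "\<And>i. i \<in> {1..m + 1} \<Longrightarrow> \<phi> (gen i) = pconst (t i) * gen (\<sigma> i)"
  shows "(\<sigma>, t) \<in> carrier G" "f \<in> B \<Longrightarrow> gact (\<sigma>, t) f = \<phi> f"
proof -
  interpret monomial_element m \<sigma> t by (rule monomial_element_group[OF g])
  have \<phi>B: "\<phi> f \<in> B" if "f \<in> B" for f using \<phi> that by (auto simp: B_aut_def bij_betw_def)
  have \<phi>m: "\<phi> (f * f') = \<phi> f * \<phi> f'" if "f \<in> B" "f' \<in> B" for f f' using \<phi> that by (auto simp: B_aut_def)
  note sub = iota_yz_B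
  have yz: "\<phi> (iota p) = iota (msub \<sigma> t p)" if "p \<in> mpolys {1..m + 1}" for p
    using that
  proof (induction rule: mpolys_induct)
    case (Const a)
    then show ?case using \<phi> by (simp add: B_aut_def)
  next
    case (Var i)
    then show ?case using gens by (simp add: iota.hom_mult)
  next
    case (add p q)
    then show ?case using \<phi> sub by (simp add: B_aut_def iota.hom_add ring_map.hom_add[OF msub_hom])
  next
    case (mult p q)
    then show ?case using \<phi> sub by (simp add: B_aut_def iota.hom_mult ring_map.hom_mult[OF msub_hom])
  qed
  have main: "zeta (\<phi> f) = monomial_action m (\<sigma>, t) (zeta f)" if f: "f \<in> B" for f
  proof -
    obtain N q where q: "q \<in> mpolys {1..m + 1}" "iota M ^ N * f = iota q" using zeta_clear[OF f] by blast
    have M1: "M ^ N \<in> mpolys {1..m + 1}" by (intro power_in_mpolys mpolys_mono[OF _ M_in]) auto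
    have q': "iota (M ^ N) * f = iota q" using q(2) by (simp add: iota.hom_power)
    have nz: "Fract (msub \<sigma> t (M ^ N)) 1 \<noteq> 0"
      using action_Fract(2)[OF M1 M1] M_nonzero by (simp add: lex.Fract_eq_0_iff)
    have "zeta (\<phi> (iota (M ^ N) * f)) = zeta (\<phi> (iota q))" by (simp only: q')
    then have "Fract (msub \<sigma> t (M ^ N)) 1 * zeta (\<phi> f) = Fract (msub \<sigma> t q) 1"
      using f by (simp only: \<phi>m[OF sub[OF M1] f] yz[OF M1] yz[OF q(1)] ring_map.hom_mult[OF zeta_hom]
          zeta_yz[OF msub_in[OF perm M1]] zeta_yz[OF msub_in[OF perm q(1)]])
    also have "\<dots> = monomial_action m (\<sigma>, t) (zeta (iota (M ^ N) * f))"
      unfolding q' by (simp only: zeta_yz[OF q(1)] action_yz[OF monomial_element_axioms q(1)])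
    also have "\<dots> = Fract (msub \<sigma> t (M ^ N)) 1 * monomial_action m (\<sigma>, t) (zeta f)"
      unfolding ring_map.hom_mult[OF zeta_hom] action_hom(2)[OF zeta_rat_funs[OF sub[OF M1]] zeta_rat_funs[OF f]]
      by (simp only: zeta_yz[OF M1] action_yz[OF monomial_element_axioms M1])
    finally show ?thesis using nz by (metis mult_left_cancel)
  qed
  have "monomial_action m (\<sigma>, t) ` zeta ` B = zeta ` \<phi> ` B"
    unfolding image_image using main by (intro image_cong refl) simp
  also have "\<phi> ` B = B" using \<phi> by (simp add: B_aut_def bij_betw_def)
  finally show G: "(\<sigma>, t) \<in> carrier G" using g by (simp add: G_carrier)
  show "gact (\<sigma>, t) f = \<phi> f" if "f \<in> B"
    using that by (intro zeta_inj) (simp_all add: gact[OF G] \<phi>B main)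
qed

definition \<rho> :: "(nat \<Rightarrow> nat) \<times> (nat \<Rightarrow> 'a) \<Rightarrow> ((nat \<Rightarrow> 'a) \<Rightarrow> nat \<Rightarrow> 'a)" where
  "\<rho> g = realize (gact g)"

lemma rho:
  assumes "g \<in> carrier G"
  shows "\<rho> g \<in> carrier W"
    "f \<in> carrier A \<Longrightarrow> J (induced_aut V (\<rho> g) f) = gact g (J f)"
  unfolding \<rho>_def using realize[OF gact_B_aut[OF assms]] by blast+

lemma rho_hom: "\<rho> \<in> hom G W"
proof (rule homI)
  fix g h assume gh: "g \<in> carrier G" "h \<in> carrier G"
  interpret group G by (rule G_group)
  show "\<rho> (g \<otimes>\<^bsub>G\<^esub> h) = \<rho> g \<otimes>\<^bsub>W\<^esub> \<rho> h"
    unfolding \<rho>_def by (rule realize_comp) (use gh in \<open>auto intro: gact_B_aut gact_mult\<close>)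
qed (rule rho)

end

section \<open>The automorphism group\<close>

context danielewski
begin

text \<open>The value at \<open>x = P/M\<close> is determined by those at the \<open>y\<^sub>i\<close> and \<open>z\<close>.\<close>

lemma B_aut_eqI:
  assumes "B_aut \<phi>" "B_aut \<psi>" "\<And>i. i \<in> {1..m + 1} \<Longrightarrow> \<phi> (gen i) = \<psi> (gen i)" "f \<in> B"
  shows "\<phi> f = \<psi> f"
proof -
  have \<phi>B: "\<phi> f \<in> B" and \<psi>B: "\<psi> f \<in> B" if "f \<in> B" for f
    using assms that by (auto simp: B_aut_def bij_betw_def)
  note sub = iota_yz_B
  have yz: "\<phi> (iota p) = \<psi> (iota p)" if "p \<in> mpolys {1..m + 1}" for p
    using that
  proof (induction rule: mpolys_induct)
    case (Const a)
    then show ?case using assms by (simp add: B_aut_def)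
  next
    case (Var i)
    then show ?case using assms(3) by simp
  next
    case (add p q)
    then show ?case using assms sub by (simp add: B_aut_def iota.hom_add)
  next
    case (mult p q)
    then show ?case using assms sub by (simp add: B_aut_def iota.hom_mult)
  qed
  obtain N q where q: "q \<in> mpolys {1..m + 1}" "iota M ^ N * f = iota q" using zeta_clear[OF assms(4)] by blast
  have M1: "M ^ N \<in> mpolys {1..m + 1}" by (intro power_in_mpolys mpolys_mono[OF _ M_in]) auto
  have eq: "iota (M ^ N) * f = iota q" using q(2) by (simp add: iota.hom_power)
  have "\<phi> (iota (M ^ N)) * \<phi> f = \<psi> (iota (M ^ N)) * \<psi> f"
  proof -
    have "\<phi> (iota (M ^ N) * f) = \<psi> (iota (M ^ N) * f)" unfolding eq by (rule yz[OF q(1)])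
    then show ?thesis using assms(1,2,4) sub[OF M1] by (simp add: B_aut_def)
  qed
  then have "\<phi> (iota (M ^ N)) * \<phi> f = \<phi> (iota (M ^ N)) * \<psi> f" by (simp only: yz[OF M1])
  moreover have "\<phi> (iota (M ^ N)) \<noteq> 0"
  proof
    assume "\<phi> (iota (M ^ N)) = 0"
    moreover have "\<phi> 0 = 0"
      using assms(1) B_zero unfolding B_aut_def by (metis add_0 add_cancel_right_right)
    ultimately have "iota (M ^ N) = 0"
      using assms(1) sub[OF M1] B_zero unfolding B_aut_def bij_betw_def inj_on_def by metis
    then show False using iota_M_nonzero by (simp add: iota.hom_power)
  qed
  ultimately show ?thesis by simp
qed

lemma B_aut_comp:
  assumes "B_aut \<phi>" "B_aut \<psi>"
  shows "B_aut (\<lambda>f. \<phi> (\<psi> f))"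
proof -
  have "bij_betw (\<phi> \<circ> \<psi>) B B" using assms by (intro bij_betw_trans) (auto simp: B_aut_def)
  moreover have "\<psi> f \<in> B" if "f \<in> B" for f using assms that by (auto simp: B_aut_def bij_betw_def)
  ultimately show ?thesis using assms by (simp add: B_aut_def comp_def)
qed

lemma aut_locale:
  assumes "B_aut \<phi>"
  shows "danielewski_aut m d k s \<phi> (inv_into B \<phi>)"
proof -
  have "bij_betw \<phi> B B" using assms by (simp add: B_aut_def)
  then show ?thesis
    by unfold_locales
       (use assms in \<open>auto simp: B_aut_inv_into bij_betw_def f_inv_into_f intro: B_aut_inv_into\<close>)
qed

text \<open>Automorphisms preserve the ideal of \<open>K[y]\<close> generated by \<open>M\<close>.\<close>

lemma image_shift_element:
  assumes \<phi>: "B_aut \<phi>" and r: "r \<in> mpolys {1..m}"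
  shows "\<exists>r'\<in>mpolys {1..m}. \<phi> (iota (M * r)) = iota (M * r')"
proof -
  interpret a: danielewski_aut m d k s \<phi> "inv_into B \<phi>" by (rule aut_locale[OF \<phi>])
  obtain c where c: "a.yact M = Const c * M" using a.yact_M by blast
  have "\<phi> (iota (M * r)) = iota (a.yact (M * r))" by (rule a.yact(2)[symmetric]) (intro mult_in_mpolys M_in r)
  also have "a.yact (M * r) = M * (Const c * a.yact r)"
    unfolding a.yact_mult[OF M_in r] c by (simp only: mult_ac)
  finally show ?thesis using a.yact(1)[OF r] by (intro bexI[of _ "Const c * a.yact r"]) (auto intro: mult_in_mpolys)
qed

lemma iota_Mr: "r \<in> mpolys {1..m} \<Longrightarrow> iota (M * r) = [:Fract (M * r) 1:]"
  by (intro iota_y mult_in_mpolys M_in)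

lemma iota_Mr_B: "r \<in> mpolys {1..m} \<Longrightarrow> iota (M * r) \<in> B"
  by (intro iota_y_B mult_in_mpolys M_in)

lemma shift_gen_y: "i \<in> {1..m} \<Longrightarrow> shift r (gen i) = gen i"
  by (rule shift_degree_0) (simp add: gen_y)

lemma shift_gen_z: "r \<in> mpolys {1..m} \<Longrightarrow> shift r (gen (m + 1)) = gen (m + 1) + iota (M * r)"
  by (simp only: shift_z iota_Mr)

text \<open>If \<open>\<phi> z = t z + M r\<close>, translate \<open>z\<close> by the preimage of \<open>M r\<close> under \<open>\<phi>\<close>; what remains of \<open>\<phi>\<close> only permutes and scales
  the coordinates.\<close>

lemma automorphism_decomposition:
  assumes \<phi>: "B_aut \<phi>"
  shows "\<exists>g\<in>carrier G. \<exists>r\<in>mpolys {1..m}. \<forall>f\<in>B. \<phi> f = gact g (shift r f)"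
proof -
  interpret a: danielewski_aut m d k s \<phi> "inv_into B \<phi>" by (rule aut_locale[OF \<phi>])
  obtain \<sigma> t r where \<sigma>: "\<sigma> permutes {1..m}" "(\<Prod>i=1..m. Var (\<sigma> i) ^ k i) = M"
    and t: "\<And>i. i \<in> {1..m + 1} \<Longrightarrow> t i \<noteq> 0" and r: "r \<in> mpolys {1..m}"
    and y: "\<And>i. i \<in> {1..m} \<Longrightarrow> \<phi> (gen i) = pconst (t i) * gen (\<sigma> i)"
    and z: "\<phi> (gen (m + 1)) = pconst (t (m + 1)) * gen (m + 1) + iota (M * r)"
    using a.automorphism_shape by blast
  obtain r' where r': "r' \<in> mpolys {1..m}" "inv_into B \<phi> (iota (M * r)) = iota (M * r')"
    using image_shift_element[OF B_aut_inv_into[OF \<phi>] r] by blast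
  have \<phi>r': "\<phi> (iota (M * r')) = iota (M * r)"
    using a.phi_psi[OF iota_Mr_B[OF r]] r'(2) by simp
  have nr': "- r' \<in> mpolys {1..m}" by (rule uminus_in_mpolys[OF r'(1)])
  define \<phi>' where "\<phi>' f = \<phi> (shift (- r') f)" for f
  have \<phi>': "B_aut \<phi>'" unfolding \<phi>'_def by (rule B_aut_comp[OF \<phi> shift_B_aut[OF nr']])
  have zB: "gen (m + 1) \<in> B" by (intro B_gen) simp
  have \<phi>'z: "\<phi>' (gen (m + 1)) = pconst (t (m + 1)) * gen (m + 1)"
  proof -
    have "\<phi>' (gen (m + 1)) = \<phi> (gen (m + 1)) + \<phi> (iota (M * - r'))"
      unfolding \<phi>'_def shift_gen_z[OF nr'] by (rule a.phi_add[OF zB iota_Mr_B[OF nr']])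
    moreover have "\<phi> (iota (M * - r')) + \<phi> (iota (M * r')) = 0"
    proof -
      have "\<phi> (iota (M * - r')) + \<phi> (iota (M * r')) = \<phi> (iota (M * - r') + iota (M * r'))"
        by (rule a.phi_add[OF iota_Mr_B[OF nr'] iota_Mr_B[OF r'(1)], symmetric])
      also have "iota (M * - r') + iota (M * r') = 0" by (simp add: iota.hom_uminus)
      finally show ?thesis by (simp only: a.phi_zero)
    qed
    ultimately show ?thesis using z \<phi>r' by (simp add: algebra_simps add_eq_0_iff)
  qed
  define t' where "t' = (\<lambda>i\<in>{1..m + 1}. t i)"
  have g: "(\<sigma>, t') \<in> carrier GM"
    unfolding monomial_group_carrier using \<sigma> t by (auto simp: t'_def)
  have "\<sigma> (m + 1) = m + 1" using \<sigma>(1) by (rule permutes_not_in) simp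
  then have gens: "\<phi>' (gen i) = pconst (t' i) * gen (\<sigma> i)" if "i \<in> {1..m + 1}" for i
    using that y[of i] \<phi>'z shift_gen_y[of i "- r'"]
    by (cases "i = m + 1") (auto simp: t'_def \<phi>'_def)
  note G = G_memI[OF \<phi>' g gens]
  have "\<phi> f = gact (\<sigma>, t') (shift r' f)" if f: "f \<in> B" for f
  proof -
    have "gact (\<sigma>, t') (shift r' f) = \<phi>' (shift r' f)" by (rule G(2)[OF _ shift_B[OF r'(1) f]])
    also have "\<dots> = \<phi> f" by (simp add: \<phi>'_def shift_shift shift_0)
    finally show ?thesis by simp
  qed
  then show ?thesis using G(1) r'(1) by blast
qed

text \<open>The action on the \<open>y\<^sub>i\<close> determines the permutation and their scaling factors, and the coefficient of \<open>z\<close> in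
  the image of \<open>z\<close> determines the remaining factor.  The translations then agree because \<open>g\<close> acts injectively.\<close>

lemma decomposition_unique:
  assumes g: "g \<in> carrier G" "g' \<in> carrier G" and r: "r \<in> mpolys {1..m}" "r' \<in> mpolys {1..m}"
    and eq: "\<And>f. f \<in> B \<Longrightarrow> gact g (shift r f) = gact g' (shift r' f)"
  shows "g = g'" "r = r'"
proof -
  obtain \<sigma> t \<tau> u where gg: "g = (\<sigma>, t)" "g' = (\<tau>, u)" by (cases g; cases g') auto
  have C: "(\<sigma>, t) \<in> carrier GM" "(\<tau>, u) \<in> carrier GM" using g gg by (auto simp: G_carrier)
  have tnz: "t i \<noteq> 0" if "i \<in> {1..m + 1}" for i using C(1) that by (simp only: monomial_group_carrier) blast
  have yi: "t i = u i \<and> \<sigma> i = \<tau> i" if i: "i \<in> {1..m}" for i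
  proof -
    have iB: "gen i \<in> B" and i': "i \<in> {1..m + 1}" using i by (auto intro: B_gen)
    have "pconst (t i) * gen (\<sigma> i) = pconst (u i) * gen (\<tau> i)"
      using eq[OF iB] gact_gen[OF g(1)[unfolded gg(1)] i'] gact_gen[OF g(2)[unfolded gg(2)] i']
      unfolding gg shift_gen_y[OF i] by metis
    then have e: "iota (Const (t i) * Var (\<sigma> i)) = iota (Const (u i) * Var (\<tau> i))"
      by (simp add: iota.hom_mult)
    have p: "\<sigma> permutes {1..m}" "\<tau> permutes {1..m}" using C by (auto simp: monomial_group_carrier)
    have "\<sigma> i \<in> {1..m}" "\<tau> i \<in> {1..m}"
      using permutes_in_image[OF p(1)] permutes_in_image[OF p(2)] i by blast+
    then have "Const (t i) * Var (\<sigma> i) = Const (u i) * Var (\<tau> i)"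
      by (intro iota_y_inj[OF _ _ e] mult_in_mpolys) simp_all
    then have s: "single (single (\<sigma> i) (1::nat)) (t i) =
        single (single (\<tau> i) 1) (u i)"
      by (simp add: Const_def Var_def mult_single del: One_nat_def)
    then have "single (\<sigma> i) (1::nat) = single (\<tau> i) 1"
      using tnz[OF i'] by (rule single_exp_eqD)
    then have "\<sigma> i = \<tau> i" by (rule single_exp_eqD) simp
    then show ?thesis using s by (metis lookup_single_eq)
  qed
  have p: "\<sigma> permutes {1..m}" "\<tau> permutes {1..m}" using C by (auto simp: monomial_group_carrier)
  have "\<sigma> i = \<tau> i" for i
    by (cases "i \<in> {1..m}") (use yi permutes_not_in[OF p(1)] permutes_not_in[OF p(2)] in auto)
  then have \<sigma>\<tau>: "\<sigma> = \<tau>" by (rule ext)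
  have zB: "gen (m + 1) \<in> B" and m1: "m + 1 \<in> {1..m + 1}" by (auto intro: B_gen)
  have sz: "\<sigma> (m + 1) = m + 1" "\<tau> (m + 1) = m + 1"
    using permutes_not_in[OF p(1), of "m + 1"] permutes_not_in[OF p(2), of "m + 1"] by auto
  obtain q where q: "q \<in> mpolys {1..m}" "gact g (iota (M * r)) = iota (M * q)"
    using image_shift_element[OF gact_B_aut[OF g(1)] r(1)] by blast
  obtain q' where q': "q' \<in> mpolys {1..m}" "gact g' (iota (M * r')) = iota (M * q')"
    using image_shift_element[OF gact_B_aut[OF g(2)] r(2)] by blast
  have add: "gact h (f + f') = gact h f + gact h f'" if "h \<in> carrier G" "f \<in> B" "f' \<in> B" for h f f'
    using gact_B_aut[OF that(1)] that(2,3) by (simp add: B_aut_def)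
  have "pconst (t (m + 1)) * gen (m + 1) + iota (M * q) = gact g (shift r (gen (m + 1)))"
    unfolding shift_gen_z[OF r(1)] add[OF g(1) zB iota_Mr_B[OF r(1)]] q(2)
    using gact_gen[OF g(1)[unfolded gg(1)] m1] unfolding gg sz by simp
  also have "\<dots> = gact g' (shift r' (gen (m + 1)))" by (rule eq[OF zB])
  also have "\<dots> = pconst (u (m + 1)) * gen (m + 1) + iota (M * q')"
    unfolding shift_gen_z[OF r(2)] add[OF g(2) zB iota_Mr_B[OF r(2)]] q'(2)
    using gact_gen[OF g(2)[unfolded gg(2)] m1] unfolding gg sz by simp
  finally have "coeff (pconst (t (m + 1)) * gen (m + 1) + iota (M * q)) 1 =
      coeff (pconst (u (m + 1)) * gen (m + 1) + iota (M * q')) 1" by simp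
  then have "rat_const (t (m + 1)) = rat_const (u (m + 1))"
    unfolding iota_Mr[OF q(1)] iota_Mr[OF q'(1)] by (simp add: pconst_def gen_z)
  then have tz: "t (m + 1) = u (m + 1)"
    using rat_const_eq_0_iff[of "t (m + 1) - u (m + 1)"] by (simp add: ring_map.hom_diff[OF rat_const_hom])
  have "t = u"
  proof (rule extensionalityI)
    show "t \<in> extensional {1..m + 1}" "u \<in> extensional {1..m + 1}" using C by (simp_all only: monomial_group_carrier)
    fix i assume "i \<in> {1..m + 1}"
    then show "t i = u i" using tz yi[of i] by (cases "i = m + 1") auto
  qed
  then show gg': "g = g'" using gg \<sigma>\<tau> by simp
  have "inj_on (gact g) B" using gact_B_aut[OF g(1)] by (simp add: B_aut_def bij_betw_def)
  then have "shift r (gen (m + 1)) = shift r' (gen (m + 1))"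
    using eq[OF zB] unfolding gg'[symmetric] by (rule inj_onD) (intro shift_B r zB)+
  then show "r = r'" by (rule shift_inj)
qed

text \<open>On \<open>z\<close>: if \<open>g\<close> maps \<open>z\<close> to \<open>t z\<close> and \<open>M r\<close> to \<open>M q\<close>, both sides give \<open>t z + M q\<close> for \<open>r' = q/t\<close>.\<close>

lemma gact_shift_swap:
  assumes g: "g \<in> carrier G" and r: "r \<in> mpolys {1..m}"
  shows "\<exists>r'\<in>mpolys {1..m}. \<forall>f\<in>B. gact g (shift r f) = shift r' (gact g f)"
proof -
  obtain \<sigma> t where st: "g = (\<sigma>, t)" by (cases g)
  have C: "(\<sigma>, t) \<in> carrier GM" using g st by (auto simp: G_carrier)
  have g': "(\<sigma>, t) \<in> carrier G" using g st by simp
  have p: "\<sigma> permutes {1..m}" using C by (auto simp: monomial_group_carrier)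
  have tnz: "t (m + 1) \<noteq> 0" using C by (auto simp: monomial_group_carrier)
  have zB: "gen (m + 1) \<in> B" by (intro B_gen) simp
  have sz: "\<sigma> (m + 1) = m + 1" by (rule permutes_not_in[OF p]) simp
  obtain q where q: "q \<in> mpolys {1..m}" "gact g (iota (M * r)) = iota (M * q)"
    using image_shift_element[OF gact_B_aut[OF g] r] by blast
  define r' where "r' = Const (inverse (t (m + 1))) * q"
  have r': "r' \<in> mpolys {1..m}" unfolding r'_def by (intro mult_in_mpolys q) simp
  have tr: "pconst (t (m + 1)) * iota (M * r') = iota (M * q)"
  proof -
    have "Const (t (m + 1)) * Const (inverse (t (m + 1))) = (1 :: 'a mpoly)"
      using tnz ring_map.hom_mult[OF Const_hom, of "t (m + 1)" "inverse (t (m + 1))"]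
      by (simp add: ring_map.hom_one[OF Const_hom])
    then have "Const (t (m + 1)) * (M * r') = M * q"
    proof -
      assume 1: "Const (t (m + 1)) * Const (inverse (t (m + 1))) = (1 :: 'a mpoly)"
      have "Const (t (m + 1)) * (M * r') = M * ((Const (t (m + 1)) * Const (inverse (t (m + 1)))) * q)"
        unfolding r'_def by (simp only: mult_ac)
      then show ?thesis by (simp only: 1 mult_1_left)
    qed
    then have "iota (Const (t (m + 1))) * iota (M * r') = iota (M * q)"
      by (simp only: iota.hom_mult[symmetric])
    then show ?thesis by (simp only: iota_Const)
  qed
  have "gact g (shift r (gen i)) = shift r' (gact g (gen i))" if i: "i \<in> {1..m + 1}" for i
  proof (cases "i = m + 1")
    case True
    have gz: "gact g (gen (m + 1)) = pconst (t (m + 1)) * gen (m + 1)"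
      using gact_gen[OF g', of "m + 1"] sz st by simp
    have "gact g (shift r (gen (m + 1))) = gact g (gen (m + 1)) + gact g (iota (M * r))"
      unfolding shift_gen_z[OF r] using gact_B_aut[OF g] zB iota_Mr_B[OF r] by (simp add: B_aut_def)
    also have "\<dots> = pconst (t (m + 1)) * (gen (m + 1) + iota (M * r'))"
      unfolding gz q(2) by (simp only: distrib_left tr)
    also have "\<dots> = shift r' (pconst (t (m + 1)) * gen (m + 1))"
      unfolding shift_gen_z[OF r', symmetric]
      using shift_B_aut[OF r'] zB B_pconst by (simp add: B_aut_def)
    finally show ?thesis using True gz by simp
  next
    case False
    then have i': "i \<in> {1..m}" using i by auto
    then have "\<sigma> i \<in> {1..m}" using permutes_in_image[OF p] by blast
    then have "degree (pconst (t i) * gen (\<sigma> i)) = 0" by (simp add: pconst_def gen_y)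
    then have "shift r' (gact g (gen i)) = gact g (gen i)"
      using gact_gen[OF g' i] st by (metis shift_degree_0)
    then show ?thesis by (simp only: shift_gen_y[OF i'])
  qed
  then have "gact g (shift r f) = shift r' (gact g f)" if "f \<in> B" for f
    using B_aut_eqI[OF B_aut_comp[OF gact_B_aut[OF g] shift_B_aut[OF r]]
        B_aut_comp[OF shift_B_aut[OF r'] gact_B_aut[OF g]] _ that] by blast
  then show ?thesis using r' by blast
qed

lemma W_group: "group W"
  by (rule variety_Aut_group[OF aff.V_ext])

lemma J_induced_rho_mu:
  assumes "g \<in> carrier G" "r \<in> mpolys {1..m}" "f \<in> carrier A"
  shows "J (induced_aut V (\<rho> g \<otimes>\<^bsub>W\<^esub> \<mu> (U_elt r)) f) = gact g (shift r (J f))"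
    "J (induced_aut V (\<mu> (U_elt r) \<otimes>\<^bsub>W\<^esub> \<rho> g) f) = shift r (gact g (J f))"
proof -
  have c: "induced_aut V (\<mu> (U_elt r)) f \<in> carrier A" "induced_aut V (\<rho> g) f \<in> carrier A"
    using assms by (auto intro!: induced_aut_closed mu_U_elt rho)
  show "J (induced_aut V (\<rho> g \<otimes>\<^bsub>W\<^esub> \<mu> (U_elt r)) f) = gact g (shift r (J f))"
    using assms c by (simp add: induced_aut_mult rho mu_U_elt)
  show "J (induced_aut V (\<mu> (U_elt r) \<otimes>\<^bsub>W\<^esub> \<rho> g) f) = shift r (gact g (J f))"
    using assms c by (simp add: induced_aut_mult rho mu_U_elt)
qed

lemma rho_mu_bij: "bij_betw (\<lambda>(g, u). \<rho> g \<otimes>\<^bsub>W\<^esub> \<mu> u) (carrier G \<times> carrier U) (carrier W)"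
  unfolding bij_betw_def
proof
  interpret W: group W by (rule W_group)
  have cl: "\<rho> g \<otimes>\<^bsub>W\<^esub> \<mu> u \<in> carrier W" if "g \<in> carrier G" "u \<in> carrier U" for g u
    using that by (auto simp: U_carrier intro!: W.m_closed rho mu_U_elt)
  show "inj_on (\<lambda>(g, u). \<rho> g \<otimes>\<^bsub>W\<^esub> \<mu> u) (carrier G \<times> carrier U)"
  proof (rule inj_onI)
    fix x y
    assume "x \<in> carrier G \<times> carrier U" "y \<in> carrier G \<times> carrier U"
      and "(\<lambda>(g, u). \<rho> g \<otimes>\<^bsub>W\<^esub> \<mu> u) x = (\<lambda>(g, u). \<rho> g \<otimes>\<^bsub>W\<^esub> \<mu> u) y"
    then obtain g u g' u' where xy: "x = (g, u)" "y = (g', u')"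
      and gu: "g \<in> carrier G" "u \<in> carrier U" "g' \<in> carrier G" "u' \<in> carrier U"
      and eq: "\<rho> g \<otimes>\<^bsub>W\<^esub> \<mu> u = \<rho> g' \<otimes>\<^bsub>W\<^esub> \<mu> u'"
      by auto
    obtain r r' where r: "r \<in> mpolys {1..m}" "u = U_elt r" and r': "r' \<in> mpolys {1..m}" "u' = U_elt r'"
      using gu by (auto simp: U_carrier)
    have e: "gact g (shift r f) = gact g' (shift r' f)" if f: "f \<in> B" for f
      using J_induced_rho_mu(1)[OF gu(1) r(1) Jinv_closed[OF f]] J_induced_rho_mu(1)[OF gu(3) r'(1) Jinv_closed[OF f]]
        eq r(2) r'(2) J_Jinv[OF f] by metis
    have "g = g'" "r = r'" using decomposition_unique[OF gu(1,3) r(1) r'(1) e] by blast+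
    then show "x = y" using r r' xy by simp
  qed
  show "(\<lambda>(g, u). \<rho> g \<otimes>\<^bsub>W\<^esub> \<mu> u) ` (carrier G \<times> carrier U) = carrier W"
  proof
    show "(\<lambda>(g, u). \<rho> g \<otimes>\<^bsub>W\<^esub> \<mu> u) ` (carrier G \<times> carrier U) \<subseteq> carrier W" using cl by auto
    show "carrier W \<subseteq> (\<lambda>(g, u). \<rho> g \<otimes>\<^bsub>W\<^esub> \<mu> u) ` (carrier G \<times> carrier U)"
    proof
      fix a assume a: "a \<in> carrier W"
      obtain g r where gr: "g \<in> carrier G" "r \<in> mpolys {1..m}"
        "\<And>f. f \<in> B \<Longrightarrow> J (induced_aut V a (Jinv f)) = gact g (shift r f)"
        using automorphism_decomposition[OF induced_B_aut[OF a]] by blast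
      have u: "U_elt r \<in> carrier U" using gr by (simp add: U_carrier)
      have "a = \<rho> g \<otimes>\<^bsub>W\<^esub> \<mu> (U_elt r)"
      proof (rule Aut_eqI[OF a cl[OF gr(1) u]])
        fix f assume f: "f \<in> carrier A"
        show "J (induced_aut V a f) = J (induced_aut V (\<rho> g \<otimes>\<^bsub>W\<^esub> \<mu> (U_elt r)) f)"
          using gr(3)[OF J_closed[OF f]] J_induced_rho_mu(1)[OF gr(1,2) f] Jinv_J[OF f] by simp
      qed
      then show "a \<in> (\<lambda>(g, u). \<rho> g \<otimes>\<^bsub>W\<^esub> \<mu> u) ` (carrier G \<times> carrier U)" using gr(1) u by force
    qed
  qed
qed

lemma rho_mu_swap:
  assumes "g \<in> carrier G" "u \<in> carrier U"
  shows "\<exists>u'\<in>carrier U. \<rho> g \<otimes>\<^bsub>W\<^esub> \<mu> u = \<mu> u' \<otimes>\<^bsub>W\<^esub> \<rho> g"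
proof -
  interpret W: group W by (rule W_group)
  obtain r where r: "r \<in> mpolys {1..m}" "u = U_elt r" using assms(2) by (auto simp: U_carrier)
  obtain r' where r': "r' \<in> mpolys {1..m}" "\<And>f. f \<in> B \<Longrightarrow> gact g (shift r f) = shift r' (gact g f)"
    using gact_shift_swap[OF assms(1) r(1)] by blast
  have "\<rho> g \<otimes>\<^bsub>W\<^esub> \<mu> u = \<mu> (U_elt r') \<otimes>\<^bsub>W\<^esub> \<rho> g"
  proof (rule Aut_eqI)
    show "\<rho> g \<otimes>\<^bsub>W\<^esub> \<mu> u \<in> carrier W" "\<mu> (U_elt r') \<otimes>\<^bsub>W\<^esub> \<rho> g \<in> carrier W"
      using assms(1) r r' by (auto intro!: W.m_closed rho mu_U_elt)
    fix f assume f: "f \<in> carrier A"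
    show "J (induced_aut V (\<rho> g \<otimes>\<^bsub>W\<^esub> \<mu> u) f) = J (induced_aut V (\<mu> (U_elt r') \<otimes>\<^bsub>W\<^esub> \<rho> g) f)"
      unfolding r(2) J_induced_rho_mu(1)[OF assms(1) r(1) f] J_induced_rho_mu(2)[OF assms(1) r'(1) f]
      by (rule r'(2)[OF J_closed[OF f]])
  qed
  then show ?thesis using r'(1) by (auto simp: U_carrier)
qed

lemma embedding_rho_mu:
  assumes g: "g \<in> carrier G" and u: "u \<in> carrier U" and f: "f \<in> carrier A"
  shows "dan_embedding m k P (induced_aut V (\<rho> g \<otimes>\<^bsub>W\<^esub> \<mu> u) f) =
    monomial_action m g (dan_embedding m k P (u f))"
proof -
  interpret W: group W by (rule W_group)
  obtain r where r: "r \<in> mpolys {1..m}" "u = U_elt r" using u by (auto simp: U_carrier)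
  have "induced_aut V (\<rho> g \<otimes>\<^bsub>W\<^esub> \<mu> u) f \<in> carrier A"
    using g r f by (auto intro!: induced_aut_closed W.m_closed rho mu_U_elt)
  then have "dan_embedding m k P (induced_aut V (\<rho> g \<otimes>\<^bsub>W\<^esub> \<mu> u) f) = zeta (gact g (shift r (J f)))"
    using J_induced_rho_mu(1)[OF g r(1) f] r(2) by (simp add: dan_embedding_eq)
  also have "\<dots> = monomial_action m g (zeta (shift r (J f)))"
    by (rule gact(2)[OF g shift_B[OF r(1) J_closed[OF f]]])
  also have "zeta (shift r (J f)) = dan_embedding m k P (u f)"
    using U_elt_apply[OF r(1) f] r(2) by (simp add: dan_embedding_eq)
  finally show ?thesis .
qed

theorem automorphism_group:
  "group G \<and> group U \<and> group W \<and>
    (\<exists>\<theta> \<Psi>. \<theta> \<in> hom G (AutoGroup U) \<and> \<Psi> \<in> iso (semidirect G U \<theta>) W \<and>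
       (\<forall>g\<in>carrier G. \<forall>u\<in>carrier U. \<forall>f\<in>carrier A.
          dan_embedding m k P (induced_aut V (\<Psi> (g, u)) f) =
          monomial_action m g (dan_embedding m k P (u f))))"
proof (intro conjI G_group U_group W_group)
  obtain \<theta> where \<theta>: "\<theta> \<in> hom G (AutoGroup U)"
    "(\<lambda>(g, u). \<rho> g \<otimes>\<^bsub>W\<^esub> \<mu> u) \<in> iso (semidirect G U \<theta>) W"
    using semidirect_iso[OF G_group U_group W_group rho_hom mu_hom mu_inj rho_mu_swap rho_mu_bij] by blast
  show "\<exists>\<theta> \<Psi>. \<theta> \<in> hom G (AutoGroup U) \<and> \<Psi> \<in> iso (semidirect G U \<theta>) W \<and>
       (\<forall>g\<in>carrier G. \<forall>u\<in>carrier U. \<forall>f\<in>carrier A.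
          dan_embedding m k P (induced_aut V (\<Psi> (g, u)) f) =
          monomial_action m g (dan_embedding m k P (u f)))"
    by (intro exI[of _ \<theta>] exI[of _ "\<lambda>(g, u). \<rho> g \<otimes>\<^bsub>W\<^esub> \<mu> u"] conjI \<theta> ballI) (simp add: embedding_rho_mu)
qed

end

theorem theorem7p15:
  fixes m d :: nat
    and k :: "nat \<Rightarrow> nat"
    and s :: "nat \<Rightarrow> 'a::{alg_closed_field, field_char_0} mpoly"
  defines "P \<equiv> dan_poly m d s"
  defines "V \<equiv> dan_variety m k P"
  defines "A \<equiv> dan_algebra m k P"
  defines "G \<equiv> canonical_group m k P"
  defines "U \<equiv> big_unipotent A (canonical_LND m k P)"
  assumes "m \<ge> 1"
    and "d \<ge> 2"
    and "\<forall>i \<in> {1..m}. k i \<ge> 2"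
    and "\<forall>j < d. s j \<in> mpolys {1..m}"
    and "s (d - 1) = 0"
  shows "group G \<and> group U \<and> group (variety_Aut (m + 2) V) \<and>
    (\<exists>\<theta> \<Psi>. \<theta> \<in> hom G (AutoGroup U) \<and>
       \<Psi> \<in> iso (semidirect G U \<theta>) (variety_Aut (m + 2) V) \<and>
       (\<forall>g \<in> carrier G. \<forall>u \<in> carrier U. \<forall>f \<in> carrier A.
          dan_embedding m k P (induced_aut V (\<Psi> (g, u)) f) =
          monomial_action m g (dan_embedding m k P (u f))))"
proof -
  interpret danielewski m d k s
    by unfold_locales (use assms in auto)
  show ?thesis
    unfolding P_def V_def A_def G_def U_def by (rule automorphism_group)
qed

end
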